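(* Let $\mathbf{H}$ be a complex Hilbert space, and let $A,\mathbf{q}\in B(\mathbf{H})$ satisfy the parameter conditions (a)–(e) given in the context. Let $\pi_A^{(0)}$ be the $\star$-representation of $R_\infty$ constructed from $(A,\mathbf{q})$ in the context, with vector $\xi_0$, and set $f(r)=(\pi_A^{(0)}(r)\xi_0,\xi_0)$ for $r\in R_\infty$. Then: 1. If $r=q_1q_2\cdots q_m$ is a decomposition of $r\in R_\infty$ into a product of independent quasicycles, then $f(r)=\prod_{j=1}^m f(q_j)$. 2. For $c=(1\;2\;\ldots\;k)$ and $\mathbb{A}\subset{\rm supp}\,c=\{1,\ldots,k\}$ (with $k\geq2$ when $\mathbb{A}=\emptyset$; for $k=1$ read $c$ as the identity and $\{1,\ldots,k\}$ as $\{1\}$), $$f(c\cdot\epsilon_{\mathbb{A}})=\begin{cases}{\rm Tr}\left(|A|\cdot\mathbf{q}\cdot A^{k-1}\right),&\text{if }\mathbb{A}\neq\emptyset,\\ {\rm Tr}\left(|A|\cdot A^{k-1}\right),&\text{if }\mathbb{A}=\emptyset.\end{cases}$$ 3. There exists a spectral projection $E(\lambda)$ of the operator $A$, where $\lambda>0$, with the property $\mathbf{q}\cdot E(\lambda)=\mathbf{q}$, and hence, for $c$ and $\mathbb{A}$ as in part 2, $$f(c\cdot\epsilon_{\mathbb{A}})=\begin{cases}\lambda^k,&\text{if }\mathbb{A}\neq\emptyset,\\ \chi_{\alpha\beta}(c),&\text{if }\mathbb{A}=\emptyset,\end{cases}$$ where $\chi_{\alpha\beta}$ denotes the restriction of $f$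 to $\mathfrak{S}_\infty$, which is a character of $\mathfrak{S}_\infty$ with Thoma parameters $\alpha,\beta$ (see the context).
   Context: **Semigroup.** $R_\infty$ is the semigroup (under matrix multiplication) of all infinite 0-1 matrices $[r_{ij}]_{i,j\in\mathbb{N}}$ with at most one entry 1 in each row and column and $r_{nn}=1$ for all sufficiently large $n$, with involution the transposition. The group $\mathfrak{S}_\infty$ of finitely supported permutations of $\mathbb{N}$ is its subgroup of permutation matrices. ${\rm supp}\,r$ is the complement of $\{n:r_{nn}=1\}$. For finite $\mathbb{A}\subset\mathbb{N}$, $\epsilon_{\mathbb{A}}$ is the diagonal matrix with $i$th diagonal entry $0$ for $i\in\mathbb{A}$ and $1$ otherwise. A quasicycle is an element $c\cdot\epsilon_{\mathbb{A}}$ with $c=(n_1\,\cdots\,n_k)\in\mathfrak{S}_\infty$ a cycle and $\mathbb{A}\subseteq{\rm supp}\,c$; each $\epsilon_{\{k\}}$ is also a quasicycle. Quasicycles are independent if their supports are pairwise disjoint. **Thoma parameters.** A character of $\mathfrak{S}_\infty$ (normalized, central, positive definite, indecomposable function) is determined by its Thoma parameters $\alpha=\{\alpha_1\geq\alpha_2\geq\ldots>0\}$ and $\beta=\{\beta_1\geq\beta_2\geq\ldots>0\}$: its value on a cycle $c$ of length $l>1$ is $\chi_{\alpha\beta}(c)=\sum_i\alpha_i^{l}+(-1)^{l-1}\sum_i\beta_i^{l}$, and its value on a product of disjoint cycles is the product of its values on the cycles. **Parameters.** $B(\mathbf{H})$ is the algebra of bounded operators on $\mathbf{H}$ and ${\rm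 Tr}$ is the ordinary trace. $A\in B(\mathbf{H})$ is self-adjoint and $\mathbf{q}\in B(\mathbf{H})$ is a minimal orthogonal projection with $A\mathbf{q}=\mathbf{q}A$; $E(\Delta)$ is the spectral projection of $A$ for $\Delta\subset\mathbb{R}$, and $E(\lambda)=E(\{\lambda\})$. Conditions: (a) ${\rm Tr}(|A|)\leq1$; (b) if $\mathbf{q}\neq0$ then ${\rm Tr}(\mathbf{q})=1$; (c) if ${\rm Tr}(|A|)=1$ then ${\rm Ker}\,A=0$; (d) if ${\rm Tr}(|A|)<1$ then $\dim({\rm Ker}\,A)=\infty$; (e) $\mathbf{q}\cdot E([-1,0])=0$. **Hilbert space.** Let $\mathbb{S}=\{1,2,\ldots,\dim\mathbf{H}\}$ and fix a system of matrix units $\{e_{kl}\}_{k,l\in\mathbb{S}}\subset B(\mathbf{H})$ such that $Ae_{ll}=e_{ll}A$ for all $l$. Let $\{n_1<n_2<\ldots\}=\{l:e_{ll}\mathbf{H}\subset{\rm Ker}\,A\}$. Define states on $B(\mathbf{H})$ by $\psi_k(b)={\rm Tr}(b|A|)+(1-{\rm Tr}(|A|))\,{\rm Tr}(b\,e_{n_kn_k})$ (the second term being zero if ${\rm Tr}(|A|)=1$), and the product state ${}_1\psi_k(b_1\otimes\cdots\otimes b_k)=\prod_{j=1}^k\psi_j(b_j)$ on $B(\mathbf{H})^{\otimes k}$. Let $\mathcal{H}_k$ be the Hilbert space obtained by completing $B(\mathbf{H})^{\otimes k}$ with respect to the inner product $(v,u)_k={}_1\psi_k(u^*v)$. With the isometric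 embeddings $v\mapsto v\otimes{\rm I}$, $\mathcal{H}_k\to\mathcal{H}_{k+1}$, let $\mathcal{H}_A^{\mathbf{q}}$ be the completion of $\bigcup_k\mathcal{H}_k$. Let $B(\mathbf{H})^{\otimes\infty}=\bigcup_nB(\mathbf{H})^{\otimes n}$ (via $a\mapsto a\otimes{\rm I}$), and let $\xi_0\in\mathcal{H}_A^{\mathbf{q}}$ be the vector corresponding to its unit. **Action.** For $a\in B(\mathbf{H})$ let $a^{(k)}={\rm I}\otimes\cdots\otimes{\rm I}\otimes a\otimes{\rm I}\otimes\cdots$ with $a$ in the $k$th place. Let $E_-=E([-1,0))$ and $$U_{E_-}^{(k,k+1)}=({\rm I}-E_-)^{(k)}({\rm I}-E_-)^{(k+1)}+E_-^{(k)}({\rm I}-E_-)^{(k+1)}+({\rm I}-E_-)^{(k)}E_-^{(k+1)}-E_-^{(k)}E_-^{(k+1)}.$$ Set $T((k\;k+1))=U_{E_-}^{(k,k+1)}\sum_{i,j}e_{ij}^{(k)}e_{ji}^{(k+1)}$ and $T(\epsilon_{\{1\}})=\mathbf{q}^{(1)}$; $T$ extends by multiplicativity to a $\star$-homomorphism of $R_\infty$ to $B(\mathbf{H})^{\otimes\infty}$. Let $\mathfrak{L}_A$ be the $\star$-representation of $B(\mathbf{H})^{\otimes\infty}$ on $\mathcal{H}_A^{\mathbf{q}}$ by left multiplication, $\Pi_A(r)=\mathfrak{L}_A(T(r))$ for $r\in R_\infty$, and let $\pi_A^{(0)}$ be the restriction of $\Pi_A$ to the closed linear span of $\Pi_A(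R_\infty)\xi_0$.
   Formalization: In part 3 the value λ^k for nonempty 𝔸 is claimed only when q ≠ 0: condition (b) allows q = 0, and then part 2 gives f(c·ε_𝔸) = 0, which is not λ^k for λ > 0. All other claims are kept for q = 0. *)

theory Defs
  imports "HOL-Analysis.Analysis" "HOL-Combinatorics.Perm"
begin

section \<open>Complex Hilbert spaces and bounded operators\<close>

class complex_vector = real_vector +
  fixes scaleC :: "complex \<Rightarrow> 'a \<Rightarrow> 'a"  (infixr \<open>*\<^sub>C\<close> 75)
  assumes scaleC_add_right: "c *\<^sub>C (x + y) = c *\<^sub>C x + c *\<^sub>C y"
    and scaleC_add_left: "(c + d) *\<^sub>C x = c *\<^sub>C x + d *\<^sub>C x"
    and scaleC_scaleC: "c *\<^sub>C d *\<^sub>C x = (c * d) *\<^sub>C x"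
    and scaleR_scaleC: "r *\<^sub>R x = complex_of_real r *\<^sub>C x"

definition cspan :: "'a::complex_vector set \<Rightarrow> 'a set" where
  "cspan S = module.span scaleC S"

text \<open>The inner product is linear in the first argument.  The norm and the topology are those
  of the underlying real inner product space.\<close>

class chilbert_space = complex_vector + real_inner + complete_space +
  fixes cinner :: "'a \<Rightarrow> 'a \<Rightarrow> complex"
  assumes cinner_commute: "cinner x y = cnj (cinner y x)"
    and cinner_add_left: "cinner (x + y) z = cinner x z + cinner y z"
    and cinner_scaleC_left: "cinner (c *\<^sub>C x) y = c * cinner x y"
    and inner_eq_Re_cinner: "inner x y = Re (cinner x y)"

lemma scaleC_one: "1 *\<^sub>C (x::'a::complex_vector) = x"
  using scaleR_scaleC[of 1 x] by simp

lemma scaleC_0_right: "c *\<^sub>C (0::'a::complex_vector) = 0"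
  using scaleC_add_right[of c 0 "0::'a"] by simp

lemma scaleC_minus_right: "c *\<^sub>C (- x) = - (c *\<^sub>C (x::'a::complex_vector))"
  using scaleC_add_right[of c x "- x"] by (simp add: scaleC_0_right eq_neg_iff_add_eq_0 add.commute)

lemma scaleC_diff_right: "c *\<^sub>C (x - y) = c *\<^sub>C x - c *\<^sub>C (y::'a::complex_vector)"
  using scaleC_add_right[of c x "- y"] by (simp add: scaleC_minus_right)

lemma cinner_same: "cinner x x = complex_of_real ((norm (x::'a::chilbert_space))\<^sup>2)"
proof -
  have "Im (cinner x x) = 0"
    using cinner_commute[of x x] by (simp add: complex_eq_iff)
  then show ?thesis
    by (simp add: complex_eq_iff power2_norm_eq_inner inner_eq_Re_cinner)
qed

lemma norm_scaleC: "norm (c *\<^sub>C (x::'a::chilbert_space)) = cmod c * norm x"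
proof -
  have "cinner (c *\<^sub>C x) (c *\<^sub>C x) = c * (cnj c * cinner x x)"
    using cinner_commute[of x "c *\<^sub>C x"] cinner_commute[of x x]
    by (simp add: cinner_scaleC_left)
  then have "complex_of_real ((norm (c *\<^sub>C x))\<^sup>2) = complex_of_real ((cmod c * norm x)\<^sup>2)"
    by (simp add: cinner_same power_mult_distrib complex_mult_cnj cmod_power2 flip: mult.assoc)
  then have "(norm (c *\<^sub>C x))\<^sup>2 = (cmod c * norm x)\<^sup>2"
    using of_real_eq_iff by blast
  then show ?thesis by simp
qed

lemma norm_cinner: "cmod (cinner x (y::'a::chilbert_space)) \<le> norm x * norm y"
proof (cases "cinner x y = 0")
  case False
  define c where "c = cnj (sgn (cinner x y))"
  have "Re (cinner (c *\<^sub>C x) y) = cmod (cinner x y)"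
  proof -
    have "c * cinner x y = complex_of_real (cmod (cinner x y))"
      unfolding c_def sgn_eq using complex_norm_square[of "cinner x y"] False
      by (simp add: field_simps power2_eq_square)
    then show ?thesis by (simp add: cinner_scaleC_left)
  qed
  moreover have "inner (c *\<^sub>C x) y \<le> norm (c *\<^sub>C x) * norm y"
    by (rule norm_cauchy_schwarz)
  moreover have "cmod c = 1" using False by (simp add: c_def norm_sgn)
  ultimately show ?thesis by (simp add: inner_eq_Re_cinner norm_scaleC)
qed simp

definition orthonormal_basis :: "'a::chilbert_space set \<Rightarrow> bool" where
  "orthonormal_basis B \<longleftrightarrow>
     (\<forall>x\<in>B. \<forall>y\<in>B. cinner x y = (if x = y then 1 else 0)) \<and> closure (cspan B) = UNIV"

text \<open>The algebra of bounded operators on a Hilbert space.\<close>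

typedef (overloaded) 'a bop =
  "{f :: 'a::chilbert_space \<Rightarrow> 'a. bounded_linear f \<and> (\<forall>c x. f (c *\<^sub>C x) = c *\<^sub>C f x)}"
  morphisms app Abs_bop
  by (rule exI[of _ "\<lambda>_. 0"]) (simp add: scaleC_0_right)

setup_lifting type_definition_bop

instantiation bop :: (chilbert_space) "{complex_vector, ring, monoid_mult}"
begin

lift_definition zero_bop :: "'a bop" is "\<lambda>_. 0"
  by (simp add: scaleC_0_right)

lift_definition one_bop :: "'a bop" is "\<lambda>x. x"
  by (simp add: bounded_linear_ident)

lift_definition plus_bop :: "'a bop \<Rightarrow> 'a bop \<Rightarrow> 'a bop" is "\<lambda>f g x. f x + g x"
  by (auto simp: scaleC_add_right intro: bounded_linear_add)

lift_definition uminus_bop :: "'a bop \<Rightarrow> 'a bop" is "\<lambda>f x. - f x"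
  by (auto simp: scaleC_minus_right intro: bounded_linear_minus)

lift_definition minus_bop :: "'a bop \<Rightarrow> 'a bop \<Rightarrow> 'a bop" is "\<lambda>f g x. f x - g x"
  by (auto simp: scaleC_diff_right intro: bounded_linear_sub)

lift_definition times_bop :: "'a bop \<Rightarrow> 'a bop \<Rightarrow> 'a bop" is "\<lambda>f g x. f (g x)"
  by (auto intro: bounded_linear_compose)

lift_definition scaleC_bop :: "complex \<Rightarrow> 'a bop \<Rightarrow> 'a bop" is "\<lambda>c f x. c *\<^sub>C f x"
proof (intro conjI allI)
  fix c :: complex and f :: "'a \<Rightarrow> 'a"
  assume f: "bounded_linear f \<and> (\<forall>c x. f (c *\<^sub>C x) = c *\<^sub>C f x)"
  have "bounded_linear (\<lambda>x::'a. c *\<^sub>C x)"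
    by (rule bounded_linear_intro[where K = "cmod c"])
      (auto simp: scaleC_add_right scaleR_scaleC scaleC_scaleC norm_scaleC mult.commute)
  then show "bounded_linear (\<lambda>x. c *\<^sub>C f x)"
    using f by (auto intro: bounded_linear_compose)
  fix d x show "c *\<^sub>C f (d *\<^sub>C x) = d *\<^sub>C c *\<^sub>C f x"
    using f by (simp add: scaleC_scaleC mult.commute)
qed

definition scaleR_bop :: "real \<Rightarrow> 'a bop \<Rightarrow> 'a bop" where
  "scaleR_bop r f = complex_of_real r *\<^sub>C f"

instance
proof
  fix a b c :: "'a bop" and r s :: real and z w :: complex
  show "a + b + c = a + (b + c)" by transfer (simp add: add.assoc)
  show "a + b = b + a" by transfer (simp add: add.commute)
  show "0 + a = a" by transfer simp
  show "- a + a = 0" by transfer simp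
  show "a - b = a + - b" by transfer simp
  show "a * b * c = a * (b * c)" by transfer simp
  show "1 * a = a" "a * 1 = a" by (transfer; simp)+
  show "(a + b) * c = a * c + b * c" by transfer simp
  show "a * (b + c) = a * b + a * c"
    by transfer (auto simp: linear_add bounded_linear.linear)
  show zr: "z *\<^sub>C (a + b) = z *\<^sub>C a + z *\<^sub>C b" for z :: complex
    by transfer (simp add: scaleC_add_right)
  show zl: "(z + w) *\<^sub>C a = z *\<^sub>C a + w *\<^sub>C a" for z w :: complex
    by transfer (simp add: scaleC_add_left)
  show zz: "z *\<^sub>C w *\<^sub>C a = (z * w) *\<^sub>C a" for z w :: complex
    by transfer (simp add: scaleC_scaleC)
  show "r *\<^sub>R a = complex_of_real r *\<^sub>C a" by (simp add: scaleR_bop_def)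
  show "r *\<^sub>R (a + b) = r *\<^sub>R a + r *\<^sub>R b" by (simp add: scaleR_bop_def zr)
  show "(r + s) *\<^sub>R a = r *\<^sub>R a + s *\<^sub>R a" by (simp add: scaleR_bop_def zl)
  show "r *\<^sub>R s *\<^sub>R a = (r * s) *\<^sub>R a" by (simp add: scaleR_bop_def zz)
  show "1 *\<^sub>R a = a"
    unfolding scaleR_bop_def by transfer (simp add: scaleC_one)
qed

end

definition adj :: "'a::chilbert_space bop \<Rightarrow> 'a bop" where
  "adj a = (THE b. \<forall>x y. cinner (app a x) y = cinner x (app b y))"

definition selfadjoint :: "'a::chilbert_space bop \<Rightarrow> bool" where
  "selfadjoint a \<longleftrightarrow> adj a = a"

definition positive_bop :: "'a::chilbert_space bop \<Rightarrow> bool" where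
  "positive_bop a \<longleftrightarrow> (\<forall>x. Im (cinner (app a x) x) = 0 \<and> 0 \<le> Re (cinner (app a x) x))"

definition abs_bop :: "'a::chilbert_space bop \<Rightarrow> 'a bop" where
  "abs_bop a = (THE p. positive_bop p \<and> p * p = adj a * a)"

definition projection :: "'a::chilbert_space bop \<Rightarrow> bool" where
  "projection p \<longleftrightarrow> p * p = p \<and> adj p = p"

text \<open>The zero projection counts as minimal here.\<close>

definition minimal_projection :: "'a::chilbert_space bop \<Rightarrow> bool" where
  "minimal_projection p \<longleftrightarrow>
     projection p \<and> (\<forall>r. projection r \<and> p * r = r \<longrightarrow> r = 0 \<or> r = p)"

definition ker :: "'a::chilbert_space bop \<Rightarrow> 'a set" where
  "ker a = {x. app a x = 0}"

text \<open>In \<open>\<complex>\<close> unconditional and absolute summability agree, and an operator is trace class iff its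
  diagonal is summable with respect to every orthonormal basis; hence \<open>has_trace\<close> holds exactly
  for trace class operators.\<close>

definition has_trace :: "'a::chilbert_space bop \<Rightarrow> complex \<Rightarrow> bool" where
  "has_trace a t \<longleftrightarrow>
     (\<forall>B. orthonormal_basis B \<longrightarrow> ((\<lambda>x. cinner (app a x) x) has_sum t) B)"

definition trace_class :: "'a::chilbert_space bop \<Rightarrow> bool" where
  "trace_class a \<longleftrightarrow> (\<exists>t. has_trace (abs_bop a) t)"

definition Tr :: "'a::chilbert_space bop \<Rightarrow> complex" where
  "Tr a = (THE t. has_trace a t)"

text \<open>The spectral measure of a selfadjoint operator: the projection-valued Borel measure \<open>E\<close>
  on the line with \<open>a = \<integral> t dE(t)\<close>, the integral being taken weakly.  Non-Borel sets get the
  value \<open>0\<close> so that \<open>E\<close> is unique as a total function.\<close>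

definition spectral_measure :: "'a::chilbert_space bop \<Rightarrow> (real set \<Rightarrow> 'a bop) \<Rightarrow> bool" where
  "spectral_measure a E \<longleftrightarrow>
     (\<forall>D\<in>sets borel. projection (E D)) \<and>
     (\<forall>D. D \<notin> sets borel \<longrightarrow> E D = 0) \<and>
     E UNIV = 1 \<and>
     (\<forall>F :: nat \<Rightarrow> real set. range F \<subseteq> sets borel \<and> disjoint_family F \<longrightarrow>
        (\<forall>x. (\<lambda>n. app (E (F n)) x) sums app (E (\<Union>n. F n)) x)) \<and>
     (\<forall>x. let \<mu> = measure_of UNIV (sets borel) (\<lambda>D. ennreal ((norm (app (E D) x))\<^sup>2)) in
        integrable \<mu> (\<lambda>t. t) \<and>
        cinner (app a x) x = complex_of_real (\<integral>t. t \<partial>\<mu>))"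

definition spectral_projection :: "'a::chilbert_space bop \<Rightarrow> real set \<Rightarrow> 'a bop" where
  "spectral_projection a = (THE E. spectral_measure a E)"


section \<open>The Hilbert space of square-summable families\<close>

typedef 'i ell2 = "{x :: 'i \<Rightarrow> complex. (\<lambda>i. (cmod (x i))\<^sup>2) summable_on UNIV}"
  morphisms coeff Abs_ell2
  by (rule exI[of _ "\<lambda>_. 0"]) simp

setup_lifting type_definition_ell2

lemma ell2_add:
  fixes x y :: "'i \<Rightarrow> complex"
  assumes "(\<lambda>i. (cmod (x i))\<^sup>2) summable_on UNIV" "(\<lambda>i. (cmod (y i))\<^sup>2) summable_on UNIV"
  shows "(\<lambda>i. (cmod (x i + y i))\<^sup>2) summable_on UNIV"
proof (rule summable_on_comparison_test)
  show "(\<lambda>i. 2 * (cmod (x i))\<^sup>2 + 2 * (cmod (y i))\<^sup>2) summable_on UNIV"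
    using assms by (intro summable_on_add summable_on_cmult_right)
  fix i
  have "(cmod (x i + y i))\<^sup>2 \<le> (cmod (x i) + cmod (y i))\<^sup>2"
    by (intro power_mono norm_triangle_ineq) simp
  also have "\<dots> \<le> 2 * (cmod (x i))\<^sup>2 + 2 * (cmod (y i))\<^sup>2"
    using zero_le_power2[of "cmod (x i) - cmod (y i)"] by (simp add: power2_eq_square algebra_simps)
  finally show "(cmod (x i + y i))\<^sup>2 \<le> 2 * (cmod (x i))\<^sup>2 + 2 * (cmod (y i))\<^sup>2" .
qed simp

lemma ell2_scale:
  fixes x :: "'i \<Rightarrow> complex"
  assumes "(\<lambda>i. (cmod (x i))\<^sup>2) summable_on UNIV"
  shows "(\<lambda>i. (cmod (c * x i))\<^sup>2) summable_on UNIV"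
  using summable_on_cmult_right[OF assms, of "(cmod c)\<^sup>2"]
  by (simp add: norm_mult power_mult_distrib)

lemma ell2_inner_summable:
  fixes x y :: "'i \<Rightarrow> complex"
  assumes "(\<lambda>i. (cmod (x i))\<^sup>2) summable_on UNIV" "(\<lambda>i. (cmod (y i))\<^sup>2) summable_on UNIV"
  shows "(\<lambda>i. x i * cnj (y i)) summable_on UNIV"
proof (rule abs_summable_summable)
  show "(\<lambda>i. norm (x i * cnj (y i))) summable_on UNIV"
  proof (rule summable_on_comparison_test)
    show "(\<lambda>i. (cmod (x i))\<^sup>2 + (cmod (y i))\<^sup>2) summable_on UNIV"
      using assms by (rule summable_on_add)
    fix i
    have "2 * (cmod (x i) * cmod (y i)) \<le> (cmod (x i))\<^sup>2 + (cmod (y i))\<^sup>2"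
      using zero_le_power2[of "cmod (x i) - cmod (y i)"]
      by (simp add: power2_eq_square algebra_simps)
    moreover have "0 \<le> cmod (x i) * cmod (y i)" by simp
    ultimately show "norm (x i * cnj (y i)) \<le> (cmod (x i))\<^sup>2 + (cmod (y i))\<^sup>2"
      unfolding norm_mult complex_mod_cnj by linarith
  qed simp
qed

instantiation ell2 :: (type) complex_vector
begin

lift_definition zero_ell2 :: "'a ell2" is "\<lambda>_. 0" by simp

lift_definition plus_ell2 :: "'a ell2 \<Rightarrow> 'a ell2 \<Rightarrow> 'a ell2" is "\<lambda>x y i. x i + y i"
  by (simp add: ell2_add)

lift_definition uminus_ell2 :: "'a ell2 \<Rightarrow> 'a ell2" is "\<lambda>x i. - x i" by simp

lift_definition minus_ell2 :: "'a ell2 \<Rightarrow> 'a ell2 \<Rightarrow> 'a ell2" is "\<lambda>x y i. x i - y i"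
  subgoal for x y using ell2_add[of x "\<lambda>i. - y i"] by simp
  done

lift_definition scaleC_ell2 :: "complex \<Rightarrow> 'a ell2 \<Rightarrow> 'a ell2" is "\<lambda>c x i. c * x i"
  by (simp add: ell2_scale)

definition scaleR_ell2 :: "real \<Rightarrow> 'a ell2 \<Rightarrow> 'a ell2" where
  "scaleR_ell2 r x = complex_of_real r *\<^sub>C x"

instance
proof
  fix x y z :: "'a ell2" and r s :: real and c d :: complex
  show "x + y + z = x + (y + z)" by transfer (simp add: add.assoc)
  show "x + y = y + x" by transfer (simp add: add.commute)
  show "0 + x = x" by transfer simp
  show "- x + x = 0" by transfer simp
  show "x - y = x + - y" by transfer simp
  show cr: "c *\<^sub>C (x + y) = c *\<^sub>C x + c *\<^sub>C y" for c :: complex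
    by transfer (simp add: algebra_simps)
  show cl: "(c + d) *\<^sub>C x = c *\<^sub>C x + d *\<^sub>C x" for c d :: complex
    by transfer (simp add: algebra_simps)
  show cc: "c *\<^sub>C d *\<^sub>C x = (c * d) *\<^sub>C x" for c d :: complex
    by transfer (simp add: mult.assoc)
  show "r *\<^sub>R x = complex_of_real r *\<^sub>C x" by (simp add: scaleR_ell2_def)
  show "r *\<^sub>R (x + y) = r *\<^sub>R x + r *\<^sub>R y" by (simp add: scaleR_ell2_def cr)
  show "(r + s) *\<^sub>R x = r *\<^sub>R x + s *\<^sub>R x" by (simp add: scaleR_ell2_def cl)
  show "r *\<^sub>R s *\<^sub>R x = (r * s) *\<^sub>R x" by (simp add: scaleR_ell2_def cc)
  show "1 *\<^sub>R x = x" unfolding scaleR_ell2_def by transfer simp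
qed

end

lift_definition ell2_form :: "'a ell2 \<Rightarrow> 'a ell2 \<Rightarrow> complex" is
  "\<lambda>x y. \<Sum>\<^sub>\<infinity>i. x i * cnj (y i)" .

lemma ell2_form_same:
  "ell2_form x x = complex_of_real (\<Sum>\<^sub>\<infinity>i. (cmod (coeff x i))\<^sup>2)"
proof -
  have "((\<lambda>i. (cmod (coeff x i))\<^sup>2) has_sum (\<Sum>\<^sub>\<infinity>i. (cmod (coeff x i))\<^sup>2)) UNIV"
    using coeff[of x] by (simp add: has_sum_infsum)
  then have "((\<lambda>i. complex_of_real ((cmod (coeff x i))\<^sup>2)) has_sum
      complex_of_real (\<Sum>\<^sub>\<infinity>i. (cmod (coeff x i))\<^sup>2)) UNIV"
    by (simp only: has_sum_of_real_iff)
  moreover have "coeff x i * cnj (coeff x i) = complex_of_real ((cmod (coeff x i))\<^sup>2)" for i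
    by (metis complex_norm_square of_real_power)
  ultimately show ?thesis
    unfolding ell2_form.rep_eq by (simp add: infsumI)
qed

instantiation ell2 :: (type) real_inner
begin

definition inner_ell2 :: "'a ell2 \<Rightarrow> 'a ell2 \<Rightarrow> real" where
  "inner_ell2 x y = Re (ell2_form x y)"

definition norm_ell2 :: "'a ell2 \<Rightarrow> real" where
  "norm_ell2 x = sqrt (inner x x)"

definition dist_ell2 :: "'a ell2 \<Rightarrow> 'a ell2 \<Rightarrow> real" where
  "dist_ell2 x y = norm (x - y)"

definition sgn_ell2 :: "'a ell2 \<Rightarrow> 'a ell2" where
  "sgn_ell2 x = inverse (norm x) *\<^sub>R x"

definition uniformity_ell2 :: "('a ell2 \<times> 'a ell2) filter" where
  "uniformity_ell2 = (INF e\<in>{0<..}. principal {(x, y). dist x y < e})"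

definition open_ell2 :: "'a ell2 set \<Rightarrow> bool" where
  "open_ell2 U = (\<forall>x\<in>U. \<forall>\<^sub>F (x', y) in uniformity. x' = x \<longrightarrow> y \<in> U)"

instance
proof
  fix x y z :: "'a ell2" and r :: real and U :: "'a ell2 set"
  show "dist x y = norm (x - y)" by (rule dist_ell2_def)
  show "sgn x = x /\<^sub>R norm x" by (rule sgn_ell2_def)
  show "uniformity = (INF e\<in>{0<..}. principal {(x :: 'a ell2, y). dist x y < e})"
    by (rule uniformity_ell2_def)
  show "open U = (\<forall>x\<in>U. \<forall>\<^sub>F (x', y) in uniformity. x' = x \<longrightarrow> y \<in> U)"
    by (rule open_ell2_def)
  show "norm x = sqrt (inner x x)" by (rule norm_ell2_def)
  show "inner x y = inner y x"
  proof -
    have "ell2_form x y = cnj (ell2_form y x)"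
      unfolding ell2_form.rep_eq by (simp add: mult.commute flip: infsum_cnj)
    then show ?thesis by (simp add: inner_ell2_def)
  qed
  show "inner (x + y) z = inner x z + inner y z"
    unfolding inner_ell2_def
    by transfer (simp add: distrib_right infsum_add ell2_inner_summable)
  show "inner (r *\<^sub>R x) y = r * inner x y"
    unfolding inner_ell2_def scaleR_ell2_def
    by transfer (simp add: mult.assoc infsum_cmult_right')
  have ge: "0 \<le> (\<Sum>\<^sub>\<infinity>i. (cmod (coeff x i))\<^sup>2)" by (rule infsum_nonneg) simp
  then show "0 \<le> inner x x" by (simp add: inner_ell2_def ell2_form_same)
  have "coeff x i = 0" if "(\<Sum>\<^sub>\<infinity>i. (cmod (coeff x i))\<^sup>2) = 0" for i
    using nonneg_infsum_le_0D[of "\<lambda>i. (cmod (coeff x i))\<^sup>2" UNIV i] that coeff[of x] by auto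
  then have "x = 0" if "(\<Sum>\<^sub>\<infinity>i. (cmod (coeff x i))\<^sup>2) = 0"
    using that by (simp add: fun_eq_iff zero_ell2.rep_eq flip: coeff_inject)
  then show "(inner x x = 0) = (x = 0)"
    unfolding inner_ell2_def ell2_form_same by (auto simp: zero_ell2.rep_eq)
qed

end

lemma norm_ell2_sq: "(norm (x :: 'a ell2))\<^sup>2 = (\<Sum>\<^sub>\<infinity>i. (cmod (coeff x i))\<^sup>2)"
  unfolding power2_norm_eq_inner[of x] inner_ell2_def ell2_form_same by simp

lemma sum_le_norm_ell2:
  assumes "finite F"
  shows "(\<Sum>i\<in>F. (cmod (coeff x i))\<^sup>2) \<le> (norm (x :: 'a ell2))\<^sup>2"
  unfolding norm_ell2_sq using assms coeff[of x]
  by (intro finite_sum_le_infsum) auto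

instantiation ell2 :: (type) chilbert_space
begin

definition cinner_ell2 :: "'a ell2 \<Rightarrow> 'a ell2 \<Rightarrow> complex" where
  "cinner_ell2 = ell2_form"

instance
proof
  fix x y z :: "'a ell2" and c :: complex
  show "cinner x y = cnj (cinner y x)"
    unfolding cinner_ell2_def ell2_form.rep_eq by (simp add: mult.commute flip: infsum_cnj)
  show "cinner (x + y) z = cinner x z + cinner y z"
    unfolding cinner_ell2_def
    by transfer (simp add: distrib_right infsum_add ell2_inner_summable)
  show "cinner (c *\<^sub>C x) y = c * cinner x y"
    unfolding cinner_ell2_def by transfer (simp add: mult.assoc infsum_cmult_right')
  show "inner x y = Re (cinner x y)" by (simp add: inner_ell2_def cinner_ell2_def)
next
  fix X :: "nat \<Rightarrow> 'a ell2"
  assume X: "Cauchy X"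
  have le: "cmod (coeff z i) \<le> norm z" for z :: "'a ell2" and i
    using sum_le_norm_ell2[of "{i}" z] by (simp add: abs_le_square_iff[symmetric])
  have "Cauchy (\<lambda>n. coeff (X n) i)" for i
  proof (rule metric_CauchyI)
    fix e :: real assume "0 < e"
    then obtain N where N: "\<And>m n. m \<ge> N \<Longrightarrow> n \<ge> N \<Longrightarrow> dist (X m) (X n) < e"
      using X by (metis metric_CauchyD)
    have "dist (coeff (X m) i) (coeff (X n) i) \<le> dist (X m) (X n)" for m n
      using le[of "X m - X n" i] by (simp add: dist_norm minus_ell2.rep_eq)
    then show "\<exists>N. \<forall>m\<ge>N. \<forall>n\<ge>N. dist (coeff (X m) i) (coeff (X n) i) < e"
      using N by (meson le_less_trans)
  qed
  then have "convergent (\<lambda>n. coeff (X n) i)" for i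
    by (rule Cauchy_convergent)
  moreover define y where "y i = lim (\<lambda>n. coeff (X n) i)" for i
  ultimately have y: "(\<lambda>n. coeff (X n) i) \<longlonglongrightarrow> y i" for i
    by (simp add: convergent_LIMSEQ_iff)
  have bound: "\<exists>N. \<forall>n\<ge>N. \<forall>F. finite F \<longrightarrow> (\<Sum>i\<in>F. (cmod (coeff (X n) i - y i))\<^sup>2) \<le> e\<^sup>2"
    if "0 < e" for e
  proof -
    obtain N where N: "\<And>m n. m \<ge> N \<Longrightarrow> n \<ge> N \<Longrightarrow> dist (X m) (X n) < e"
      using X \<open>0 < e\<close> by (metis metric_CauchyD)
    have "(\<Sum>i\<in>F. (cmod (coeff (X n) i - y i))\<^sup>2) \<le> e\<^sup>2" if "n \<ge> N" "finite F" for n F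
    proof (rule tendsto_upperbound)
      show "(\<lambda>m. \<Sum>i\<in>F. (cmod (coeff (X n) i - coeff (X m) i))\<^sup>2)
              \<longlonglongrightarrow> (\<Sum>i\<in>F. (cmod (coeff (X n) i - y i))\<^sup>2)"
        by (intro tendsto_intros y)
      have "(\<Sum>i\<in>F. (cmod (coeff (X n) i - coeff (X m) i))\<^sup>2) \<le> e\<^sup>2" if "m \<ge> N" for m
      proof -
        have "(\<Sum>i\<in>F. (cmod (coeff (X n) i - coeff (X m) i))\<^sup>2) \<le> (norm (X n - X m))\<^sup>2"
          using sum_le_norm_ell2[OF \<open>finite F\<close>, of "X n - X m"] by (simp add: minus_ell2.rep_eq)
        also have "\<dots> \<le> e\<^sup>2"
          using N[OF \<open>n \<ge> N\<close> that] by (intro power_mono) (simp_all add: dist_norm)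
        finally show ?thesis .
      qed
      then show "\<forall>\<^sub>F m in sequentially.
          (\<Sum>i\<in>F. (cmod (coeff (X n) i - coeff (X m) i))\<^sup>2) \<le> e\<^sup>2"
        by (auto simp: eventually_sequentially)
    qed simp
    then show ?thesis by blast
  qed
  have sub: "(\<lambda>i. (cmod (coeff (X n) i - y i))\<^sup>2) summable_on UNIV"
    if "\<forall>F. finite F \<longrightarrow> (\<Sum>i\<in>F. (cmod (coeff (X n) i - y i))\<^sup>2) \<le> e\<^sup>2" for n e
    using that by (intro nonneg_bdd_above_summable_on) (auto intro!: bdd_aboveI)
  obtain N where N: "\<forall>n\<ge>N. \<forall>F. finite F \<longrightarrow> (\<Sum>i\<in>F. (cmod (coeff (X n) i - y i))\<^sup>2) \<le> 1\<^sup>2"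
    using bound[of 1] by auto
  have "(\<lambda>i. (cmod (coeff (X N) i + - (coeff (X N) i - y i)))\<^sup>2) summable_on UNIV"
    using sub[of N 1] N coeff[of "X N"] by (intro ell2_add) (auto simp: norm_minus_commute)
  then have "(\<lambda>i. (cmod (y i))\<^sup>2) summable_on UNIV" by simp
  then have Y: "coeff (Abs_ell2 y) = y" by (simp add: Abs_ell2_inverse)
  have "X \<longlonglongrightarrow> Abs_ell2 y"
  proof (rule metric_LIMSEQ_I)
    fix r :: real assume "0 < r"
    then obtain N where N: "\<forall>n\<ge>N. \<forall>F. finite F \<longrightarrow>
        (\<Sum>i\<in>F. (cmod (coeff (X n) i - y i))\<^sup>2) \<le> (r/2)\<^sup>2"
      using bound[of "r/2"] by auto
    have "dist (X n) (Abs_ell2 y) < r" if "n \<ge> N" for n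
    proof -
      have "(norm (X n - Abs_ell2 y))\<^sup>2 \<le> (r/2)\<^sup>2"
        unfolding norm_ell2_sq using N that sub[of n "r/2"]
        by (intro infsum_le_finite_sums) (auto simp: minus_ell2.rep_eq Y)
      then have "norm (X n - Abs_ell2 y) \<le> r/2"
        using \<open>0 < r\<close> by (simp add: abs_le_square_iff[symmetric])
      then show ?thesis using \<open>0 < r\<close> by (simp add: dist_norm)
    qed
    then show "\<exists>N. \<forall>n\<ge>N. dist (X n) (Abs_ell2 y) < r" by blast
  qed
  then show "convergent X" by (auto simp: convergent_def)
qed

end

lift_definition ket :: "'i \<Rightarrow> 'i ell2" is "\<lambda>i j. if i = j then 1 else 0"
proof -
  fix i :: 'i
  have "(\<lambda>j. (cmod (if i = j then 1 else 0))\<^sup>2) summable_on {i}" by simp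
  then show "(\<lambda>j. (cmod (if i = j then 1 else 0))\<^sup>2) summable_on UNIV"
    by (rule summable_on_cong_neutral[THEN iffD1, rotated 3]) auto
qed


section \<open>The semigroup \<open>R\<^sub>\<infinity>\<close>\<close>

text \<open>Rows and columns are numbered from \<open>0\<close>: the index \<open>n\<close> here is the index \<open>n + 1\<close> when
  counting starts at \<open>1\<close>.  The same shift applies to the tensor factors below.\<close>

definition rook_matrix :: "(nat \<Rightarrow> nat \<Rightarrow> nat) \<Rightarrow> bool" where
  "rook_matrix r \<longleftrightarrow>
     (\<forall>i j. r i j \<in> {0, 1}) \<and>
     (\<forall>i j j'. r i j = 1 \<and> r i j' = 1 \<longrightarrow> j = j') \<and>
     (\<forall>i i' j. r i j = 1 \<and> r i' j = 1 \<longrightarrow> i = i') \<and>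
     (\<forall>\<^sub>F n in sequentially. r n n = 1)"

text \<open>The sum over \<open>k\<close> has at most one nonzero term.\<close>

definition rook_mult ::
    "(nat \<Rightarrow> nat \<Rightarrow> nat) \<Rightarrow> (nat \<Rightarrow> nat \<Rightarrow> nat) \<Rightarrow> nat \<Rightarrow> nat \<Rightarrow> nat" where
  "rook_mult r s i j = (\<Sum>k | r i k \<noteq> 0. r i k * s k j)"

typedef rook = "{r. rook_matrix r}"
  morphisms entry Abs_rook
  by (rule exI[of _ "\<lambda>i j. if i = j then 1 else 0"]) (auto simp: rook_matrix_def)

setup_lifting type_definition_rook

lemma rook_mult_eq:
  assumes "rook_matrix r" "rook_matrix s"
  shows "rook_mult r s i j = (if \<exists>k. r i k = 1 \<and> s k j = 1 then 1 else 0)"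
proof (cases "\<exists>k. r i k = 1")
  case True
  then obtain k where k: "r i k = 1" by blast
  have "r i k' \<noteq> 0 \<longleftrightarrow> r i k' = 1" for k'
    using assms(1) unfolding rook_matrix_def by (metis empty_iff insert_iff zero_neq_one)
  then have "{k'. r i k' \<noteq> 0} = {k'. r i k' = 1}"
    by (simp only:)
  also have "\<dots> = {k}"
    using assms(1) k unfolding rook_matrix_def by blast
  finally have "{k. r i k \<noteq> 0} = {k}" .
  then have "rook_mult r s i j = s k j"
    using k by (simp add: rook_mult_def)
  moreover have "(\<exists>k. r i k = 1 \<and> s k j = 1) \<longleftrightarrow> s k j = 1"
    using assms(1) k unfolding rook_matrix_def by blast
  moreover have "s k j \<in> {0, 1}"
    using assms(2) unfolding rook_matrix_def by blast
  ultimately show ?thesis by auto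
next
  case False
  then have "r i k = 0" for k
    using assms(1) unfolding rook_matrix_def by (metis empty_iff insert_iff)
  then show ?thesis using False by (simp add: rook_mult_def)
qed

lemma rook_matrix_mult:
  assumes r: "rook_matrix r" and s: "rook_matrix s"
  shows "rook_matrix (rook_mult r s)"
proof -
  have ev: "\<forall>\<^sub>F n in sequentially. rook_mult r s n n = 1"
  proof -
    have "\<forall>\<^sub>F n in sequentially. r n n = 1" "\<forall>\<^sub>F n in sequentially. s n n = 1"
      using r s unfolding rook_matrix_def by blast+
    then show ?thesis
    proof eventually_elim
      case (elim n)
      then have "\<exists>k. r n k = 1 \<and> s k n = 1" by blast
      then show ?case by (simp only: rook_mult_eq[OF r s] if_True)
    qed
  qed
  have one: "rook_mult r s i j = 1 \<longleftrightarrow> (\<exists>k. r i k = 1 \<and> s k j = 1)" for i j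
    by (simp add: rook_mult_eq[OF r s])
  have entries: "rook_mult r s i j \<in> {0, 1}" for i j
    by (simp add: rook_mult_eq[OF r s])
  have row: "j = j'" if "r i k = 1" "s k j = 1" "r i k' = 1" "s k' j' = 1" for i j j' k k'
  proof -
    have "k = k'" using that r unfolding rook_matrix_def by blast
    then show ?thesis using that s unfolding rook_matrix_def by blast
  qed
  have col: "i = i'" if "r i k = 1" "s k j = 1" "r i' k' = 1" "s k' j = 1" for i i' j k k'
  proof -
    have "k = k'" using that s unfolding rook_matrix_def by blast
    then show ?thesis using that r unfolding rook_matrix_def by blast
  qed
  show ?thesis
    unfolding rook_matrix_def
  proof (intro conjI)
    show "\<forall>i j. rook_mult r s i j \<in> {0, 1}" using entries by blast
    show "\<forall>i j j'. rook_mult r s i j = 1 \<and> rook_mult r s i j' = 1 \<longrightarrow> j = j'"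
      unfolding one using row by blast
    show "\<forall>i i' j. rook_mult r s i j = 1 \<and> rook_mult r s i' j = 1 \<longrightarrow> i = i'"
      unfolding one using col by blast
  qed (rule ev)
qed

instantiation rook :: monoid_mult
begin

lift_definition one_rook :: rook is "\<lambda>i j. if i = j then 1 else 0"
  by (auto simp: rook_matrix_def)

lift_definition times_rook :: "rook \<Rightarrow> rook \<Rightarrow> rook" is rook_mult
  by (rule rook_matrix_mult)

instance
proof
  fix r s t :: rook
  show "r * s * t = r * (s * t)"
    by transfer (auto simp: fun_eq_iff rook_mult_eq rook_matrix_mult)
  have one: "rook_matrix (\<lambda>i j. if i = j then 1 else 0)" by (auto simp: rook_matrix_def)
  have entries: "(if r i j = 1 then 1 else 0) = r i j" if "rook_matrix r" for r i j
    using that unfolding rook_matrix_def by (metis empty_iff insert_iff)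
  show "1 * r = r"
  proof transfer
    fix r assume r: "rook_matrix r"
    have "(\<exists>k. (if i = k then 1 else 0) = (1::nat) \<and> r k j = 1) \<longleftrightarrow> r i j = 1" for i j
      by auto
    then show "rook_mult (\<lambda>i j. if i = j then 1 else 0) r = r"
      unfolding fun_eq_iff rook_mult_eq[OF one r] by (simp only: entries[OF r] simp_thms)
  qed
  show "r * 1 = r"
  proof transfer
    fix r assume r: "rook_matrix r"
    have "(\<exists>k. r i k = 1 \<and> (if k = j then 1 else 0) = (1::nat)) \<longleftrightarrow> r i j = 1" for i j
      by auto
    then show "rook_mult r (\<lambda>i j. if i = j then 1 else 0) = r"
      unfolding fun_eq_iff rook_mult_eq[OF r one] by (simp only: entries[OF r] simp_thms)
  qed
qed

end

lift_definition rook_transpose :: "rook \<Rightarrow> rook" is "\<lambda>r i j. r j i"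
  unfolding rook_matrix_def by blast

text \<open>The matrix sending the \<open>j\<close>-th basis vector to the \<open>p(j)\<close>-th one; the type \<open>nat perm\<close> is
  the group of finitely supported permutations of \<open>nat\<close>.\<close>

lift_definition perm_rook :: "nat perm \<Rightarrow> rook" is
  "\<lambda>p i j. if i = p j then 1 else 0"
proof -
  fix p :: "nat \<Rightarrow> nat"
  assume p: "bij p \<and> finite {a. p a \<noteq> a}"
  then have "\<forall>\<^sub>F n in sequentially. n \<notin> {a. p a \<noteq> a}"
    by (simp add: eventually_cofinite flip: cofinite_eq_sequentially)
  then have "\<forall>\<^sub>F n in sequentially. n = p n"
    by eventually_elim simp
  moreover have "inj p" using p by (simp add: bij_is_inj)
  ultimately show "rook_matrix (\<lambda>i j. if i = p j then 1 else 0)"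
    by (auto simp: rook_matrix_def inj_eq elim: eventually_mono)
qed

text \<open>Meaningful for finite \<open>A\<close> only.\<close>

lift_definition eps :: "nat set \<Rightarrow> rook" is
  "\<lambda>A i j. if i = j \<and> \<not> (finite A \<and> i \<in> A) then 1 else 0"
proof -
  fix A :: "nat set"
  have "\<forall>\<^sub>F n in sequentially. \<not> (finite A \<and> n \<in> A)"
    by (cases "finite A") (auto simp: eventually_cofinite simp flip: cofinite_eq_sequentially)
  then show "rook_matrix (\<lambda>i j. if i = j \<and> \<not> (finite A \<and> i \<in> A) then 1 else 0)"
    by (auto simp: rook_matrix_def elim: eventually_mono)
qed

definition rook_supp :: "rook \<Rightarrow> nat set" where
  "rook_supp r = - {n. entry r n n = 1}"

definition quasicycle :: "rook \<Rightarrow> bool" where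
  "quasicycle r \<longleftrightarrow>
     (\<exists>ns A. distinct ns \<and> 2 \<le> length ns \<and> A \<subseteq> set ns \<and> r = perm_rook (cycle ns) * eps A) \<or>
     (\<exists>k. r = eps {k})"

definition independent :: "rook list \<Rightarrow> bool" where
  "independent rs \<longleftrightarrow> pairwise (\<lambda>i j. rook_supp (rs ! i) \<inter> rook_supp (rs ! j) = {}) {..<length rs}"


section \<open>Characters of the infinite symmetric group\<close>

definition positive_definite :: "('g::{monoid_mult, inverse} \<Rightarrow> complex) \<Rightarrow> bool" where
  "positive_definite \<phi> \<longleftrightarrow>
     (\<forall>F c. finite F \<longrightarrow>
        (let s = (\<Sum>g\<in>F. \<Sum>h\<in>F. c g * cnj (c h) * \<phi> (inverse h * g)) in Im s = 0 \<and> 0 \<le> Re s))"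

definition normalized_central_pd :: "('g::{monoid_mult, inverse} \<Rightarrow> complex) \<Rightarrow> bool" where
  "normalized_central_pd \<phi> \<longleftrightarrow>
     \<phi> 1 = 1 \<and> (\<forall>g h. \<phi> (g * h) = \<phi> (h * g)) \<and> positive_definite \<phi>"

definition group_character :: "('g::{monoid_mult, inverse} \<Rightarrow> complex) \<Rightarrow> bool" where
  "group_character \<phi> \<longleftrightarrow>
     normalized_central_pd \<phi> \<and>
     (\<forall>\<phi>1 \<phi>2 t. normalized_central_pd \<phi>1 \<and> normalized_central_pd \<phi>2 \<and> 0 < t \<and> t < 1 \<and>
        (\<forall>g. \<phi> g = complex_of_real t * \<phi>1 g + complex_of_real (1 - t) * \<phi>2 g) \<longrightarrow>
        \<phi>1 = \<phi> \<and> \<phi>2 = \<phi>)"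

text \<open>A finite sequence of parameters is padded with zeros.\<close>

definition thoma_parameters :: "(nat \<Rightarrow> real) \<Rightarrow> (nat \<Rightarrow> real) \<Rightarrow> bool" where
  "thoma_parameters \<alpha> \<beta> \<longleftrightarrow>
     antimono \<alpha> \<and> antimono \<beta> \<and> (\<forall>i. 0 \<le> \<alpha> i) \<and> (\<forall>i. 0 \<le> \<beta> i) \<and>
     summable \<alpha> \<and> summable \<beta> \<and> (\<Sum>i. \<alpha> i) + (\<Sum>i. \<beta> i) \<le> 1"

definition thoma_cycle_value :: "(nat \<Rightarrow> real) \<Rightarrow> (nat \<Rightarrow> real) \<Rightarrow> nat \<Rightarrow> real" where
  "thoma_cycle_value \<alpha> \<beta> l = (\<Sum>i. \<alpha> i ^ l) + (-1) ^ (l - 1) * (\<Sum>i. \<beta> i ^ l)"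

text \<open>A list of pairwise disjoint cycles, each of length at least 2, is given by the lists of
  their entries.\<close>

definition has_thoma_parameters ::
    "(nat perm \<Rightarrow> complex) \<Rightarrow> (nat \<Rightarrow> real) \<Rightarrow> (nat \<Rightarrow> real) \<Rightarrow> bool" where
  "has_thoma_parameters \<phi> \<alpha> \<beta> \<longleftrightarrow>
     thoma_parameters \<alpha> \<beta> \<and>
     (\<forall>cs. distinct (concat cs) \<and> (\<forall>c\<in>set cs. 2 \<le> length c) \<longrightarrow>
        \<phi> (prod_list (map cycle cs)) =
          complex_of_real (\<Prod>c\<leftarrow>cs. thoma_cycle_value \<alpha> \<beta> (length c)))"


section \<open>Infinite tensor power of \<open>B(H)\<close>\<close>

text \<open>Here \<open>h\<close> is an orthonormal basis of \<open>H\<close>, indexed by the type \<open>'s\<close>.\<close>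

definition matrix_unit :: "('s \<Rightarrow> 'h::chilbert_space) \<Rightarrow> 's \<Rightarrow> 's \<Rightarrow> 'h bop" where
  "matrix_unit h k l = (THE b. \<forall>x. app b x = cinner x (h l) *\<^sub>C h k)"

text \<open>Operators on tensor powers are realised on the Hilbert space with orthonormal basis
  \<open>ket i\<close> (\<open>i :: nat \<Rightarrow> 's\<close>), where \<open>ket i\<close> stands for the tensor product of all the
  \<open>h (i 0), h (i 1), \<dots>\<close>.  The bounded operators on the \<open>n\<close>-th Hilbert tensor power of \<open>H\<close> are
  those acting on the first \<open>n\<close> factors only, so that \<open>b \<mapsto> b \<otimes> I\<close> becomes inclusion.  For
  infinite-dimensional \<open>H\<close> these, and not just algebraic tensors, are needed:
  the flip of two factors is not an algebraic tensor.\<close>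

definition tensor_algebra :: "nat \<Rightarrow> (nat \<Rightarrow> 's) ell2 bop set" where
  "tensor_algebra n =
     {b. \<exists>M. \<forall>i j. cinner (app b (ket j)) (ket i) =
           (if \<forall>l\<ge>n. i l = j l then M (restrict i {..<n}) (restrict j {..<n}) else 0)}"

definition tensor_algebra_inf :: "(nat \<Rightarrow> 's) ell2 bop set" where
  "tensor_algebra_inf = (\<Union>n. tensor_algebra n)"

text \<open>The operator \<open>a\<^sup>(\<^sup>k\<^sup>)\<close>, that is \<open>a\<close> acting in the \<open>k\<close>-th factor.\<close>

definition site :: "('s \<Rightarrow> 'h::chilbert_space) \<Rightarrow> nat \<Rightarrow> 'h bop \<Rightarrow> (nat \<Rightarrow> 's) ell2 bop" where
  "site h k a = (THE b. \<forall>i j. cinner (app b (ket j)) (ket i) =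
     (if \<forall>l. l \<noteq> k \<longrightarrow> i l = j l then cinner (app a (h (j k))) (h (i k)) else 0))"

text \<open>The operator \<open>\<Sum>\<^sub>i\<^sub>j e\<^sub>i\<^sub>j\<^sup>(\<^sup>k\<^sup>) e\<^sub>j\<^sub>i\<^sup>(\<^sup>k\<^sup>+\<^sup>1\<^sup>)\<close>; the sum converges strongly.\<close>

definition flip_op :: "('s \<Rightarrow> 'h::chilbert_space) \<Rightarrow> nat \<Rightarrow> (nat \<Rightarrow> 's) ell2 bop" where
  "flip_op h k = (THE b. \<forall>x.
     ((\<lambda>(i, j). app (site h k (matrix_unit h i j) * site h (Suc k) (matrix_unit h j i)) x)
        has_sum app b x) UNIV)"

definition sign_op ::
    "('s \<Rightarrow> 'h::chilbert_space) \<Rightarrow> 'h bop \<Rightarrow> nat \<Rightarrow> (nat \<Rightarrow> 's) ell2 bop" where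
  "sign_op h A k =
     (let E = spectral_projection A {-1..<0} in
        site h k (1 - E) * site h (Suc k) (1 - E) + site h k E * site h (Suc k) (1 - E)
        + site h k (1 - E) * site h (Suc k) E - site h k E * site h (Suc k) E)"

definition rook_hom ::
    "('s \<Rightarrow> 'h::chilbert_space) \<Rightarrow> 'h bop \<Rightarrow> 'h bop \<Rightarrow> rook \<Rightarrow> (nat \<Rightarrow> 's) ell2 bop" where
  "rook_hom h A q = (THE T.
     (\<forall>r. T r \<in> tensor_algebra_inf) \<and>
     (\<forall>r s. T (r * s) = T r * T s) \<and>
     (\<forall>r. T (rook_transpose r) = adj (T r)) \<and>
     (\<forall>k. T (perm_rook (cycle [k, Suc k])) = sign_op h A k * flip_op h k) \<and>
     T (eps {0}) = site h 0 q)"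


section \<open>The product state\<close>

definition kernel_indices :: "('s \<Rightarrow> 'h::chilbert_space) \<Rightarrow> 'h bop \<Rightarrow> 's set" where
  "kernel_indices h A = {l. range (app (matrix_unit h l l)) \<subseteq> ker A}"

text \<open>When \<open>Tr |A| = 1\<close> the second term vanishes, whatever the value of \<open>enumerate\<close>.\<close>

definition psi :: "('s::wellorder \<Rightarrow> 'h::chilbert_space) \<Rightarrow> 'h bop \<Rightarrow> nat \<Rightarrow> 'h bop \<Rightarrow> complex" where
  "psi h A k b =
     (let n = enumerate (kernel_indices h A) k in
        Tr (b * abs_bop A) + (1 - Tr (abs_bop A)) * Tr (b * matrix_unit h n n))"

text \<open>The product of the states \<open>psi h A l\<close>, \<open>l < n\<close>: its value on the tensor product of the
  matrix units \<open>matrix_unit h (i l) (j l)\<close> is the product of the values of the factors, and it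
  is extended by normality to all of \<open>tensor_algebra n\<close>.  The functions in
  \<open>{..<n} \<rightarrow>\<^sub>E UNIV\<close> are constant outside \<open>{..<n}\<close>, so \<open>cinner (app b (ket j)) (ket i)\<close> is the
  \<open>(i, j)\<close> matrix entry of \<open>b\<close> on the first \<open>n\<close> factors.\<close>

definition product_state ::
    "('s::wellorder \<Rightarrow> 'h::chilbert_space) \<Rightarrow> 'h bop \<Rightarrow> nat \<Rightarrow> (nat \<Rightarrow> 's) ell2 bop \<Rightarrow> complex"
  where
  "product_state h A n b =
     (\<Sum>\<^sub>\<infinity>(i, j) \<in> ({..<n} \<rightarrow>\<^sub>E UNIV) \<times> ({..<n} \<rightarrow>\<^sub>E UNIV).
        cinner (app b (ket j)) (ket i) * (\<Prod>l<n. psi h A l (matrix_unit h (i l) (j l))))"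

definition product_state_inf ::
    "('s::wellorder \<Rightarrow> 'h::chilbert_space) \<Rightarrow> 'h bop \<Rightarrow> (nat \<Rightarrow> 's) ell2 bop \<Rightarrow> complex" where
  "product_state_inf h A b = product_state h A (LEAST n. b \<in> tensor_algebra n) b"


section \<open>Completion of a semi-inner product space\<close>

text \<open>The completion of a subspace \<open>V\<close> with respect to a positive semidefinite sesquilinear form
  \<open>g\<close>: Cauchy sequences modulo null sequences.\<close>

definition cauchy_seqs :: "'v::complex_vector set \<Rightarrow> ('v \<Rightarrow> 'v \<Rightarrow> complex) \<Rightarrow> (nat \<Rightarrow> 'v) set" where
  "cauchy_seqs V g = {x. (\<forall>n. x n \<in> V) \<and>
     (\<forall>e>0. \<exists>N. \<forall>m\<ge>N. \<forall>n\<ge>N. Re (g (x m - x n) (x m - x n)) < e)}"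

definition null_rel ::
    "'v::complex_vector set \<Rightarrow> ('v \<Rightarrow> 'v \<Rightarrow> complex) \<Rightarrow> ((nat \<Rightarrow> 'v) \<times> (nat \<Rightarrow> 'v)) set" where
  "null_rel V g = {(x, y). x \<in> cauchy_seqs V g \<and> y \<in> cauchy_seqs V g \<and>
     (\<lambda>n. g (x n - y n) (x n - y n)) \<longlonglongrightarrow> 0}"

definition completion ::
    "'v::complex_vector set \<Rightarrow> ('v \<Rightarrow> 'v \<Rightarrow> complex) \<Rightarrow> (nat \<Rightarrow> 'v) set set" where
  "completion V g = cauchy_seqs V g // null_rel V g"

definition completion_embed ::
    "'v::complex_vector set \<Rightarrow> ('v \<Rightarrow> 'v \<Rightarrow> complex) \<Rightarrow> 'v \<Rightarrow> (nat \<Rightarrow> 'v) set" where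
  "completion_embed V g v = null_rel V g `` {\<lambda>_. v}"

definition completion_inner ::
    "('v::complex_vector \<Rightarrow> 'v \<Rightarrow> complex) \<Rightarrow> (nat \<Rightarrow> 'v) set \<Rightarrow> (nat \<Rightarrow> 'v) set \<Rightarrow> complex" where
  "completion_inner g X Y = (THE z. \<forall>x\<in>X. \<forall>y\<in>Y. (\<lambda>n. g (x n) (y n)) \<longlonglongrightarrow> z)"

text \<open>The linear combination \<open>c X + Y\<close>.\<close>

definition completion_comb :: "'v::complex_vector set \<Rightarrow> ('v \<Rightarrow> 'v \<Rightarrow> complex) \<Rightarrow>
    complex \<Rightarrow> (nat \<Rightarrow> 'v) set \<Rightarrow> (nat \<Rightarrow> 'v) set \<Rightarrow> (nat \<Rightarrow> 'v) set" where
  "completion_comb V g c X Y = (\<Union>x\<in>X. \<Union>y\<in>Y. null_rel V g `` {\<lambda>n. c *\<^sub>C x n + y n})"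

text \<open>The continuous extension of a bounded linear map \<open>F\<close> on \<open>V\<close>.\<close>

definition completion_map :: "'v::complex_vector set \<Rightarrow> ('v \<Rightarrow> 'v \<Rightarrow> complex) \<Rightarrow>
    ('v \<Rightarrow> 'v) \<Rightarrow> (nat \<Rightarrow> 'v) set \<Rightarrow> (nat \<Rightarrow> 'v) set" where
  "completion_map V g F X = (\<Union>x\<in>X. null_rel V g `` {\<lambda>n. F (x n)})"

definition completion_tendsto :: "'v::complex_vector set \<Rightarrow> ('v \<Rightarrow> 'v \<Rightarrow> complex) \<Rightarrow>
    (nat \<Rightarrow> (nat \<Rightarrow> 'v) set) \<Rightarrow> (nat \<Rightarrow> 'v) set \<Rightarrow> bool" where
  "completion_tendsto V g X Y \<longleftrightarrow>
     (\<lambda>n. let D = completion_comb V g (-1) Y (X n) in completion_inner g D D) \<longlonglongrightarrow> 0"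

definition closed_subspace :: "'v::complex_vector set \<Rightarrow> ('v \<Rightarrow> 'v \<Rightarrow> complex) \<Rightarrow>
    (nat \<Rightarrow> 'v) set set \<Rightarrow> bool" where
  "closed_subspace V g W \<longleftrightarrow>
     W \<subseteq> completion V g \<and> completion_embed V g 0 \<in> W \<and>
     (\<forall>c. \<forall>X\<in>W. \<forall>Y\<in>W. completion_comb V g c X Y \<in> W) \<and>
     (\<forall>X. \<forall>Y\<in>completion V g. (\<forall>n. X n \<in> W) \<and> completion_tendsto V g X Y \<longrightarrow> Y \<in> W)"

definition closed_span :: "'v::complex_vector set \<Rightarrow> ('v \<Rightarrow> 'v \<Rightarrow> complex) \<Rightarrow>
    (nat \<Rightarrow> 'v) set set \<Rightarrow> (nat \<Rightarrow> 'v) set set" where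
  "closed_span V g M = \<Inter>{W. closed_subspace V g W \<and> M \<subseteq> W}"


section \<open>The representation\<close>

definition gns_form :: "('s::wellorder \<Rightarrow> 'h::chilbert_space) \<Rightarrow> 'h bop \<Rightarrow>
    (nat \<Rightarrow> 's) ell2 bop \<Rightarrow> (nat \<Rightarrow> 's) ell2 bop \<Rightarrow> complex" where
  "gns_form h A v u = product_state_inf h A (adj u * v)"

text \<open>Vectors of the Hilbert space on which the representation acts.\<close>

type_synonym 's gns_vector = "(nat \<Rightarrow> (nat \<Rightarrow> 's) ell2 bop) set"

definition xi0 :: "('s::wellorder \<Rightarrow> 'h::chilbert_space) \<Rightarrow> 'h bop \<Rightarrow> 's gns_vector" where
  "xi0 h A = completion_embed tensor_algebra_inf (gns_form h A) 1"

definition left_mult :: "('s::wellorder \<Rightarrow> 'h::chilbert_space) \<Rightarrow> 'h bop \<Rightarrow>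
    (nat \<Rightarrow> 's) ell2 bop \<Rightarrow> 's gns_vector \<Rightarrow> 's gns_vector" where
  "left_mult h A a = completion_map tensor_algebra_inf (gns_form h A) (\<lambda>v. a * v)"

definition Pi_rep :: "('s::wellorder \<Rightarrow> 'h::chilbert_space) \<Rightarrow> 'h bop \<Rightarrow> 'h bop \<Rightarrow>
    rook \<Rightarrow> 's gns_vector \<Rightarrow> 's gns_vector" where
  "Pi_rep h A q r = left_mult h A (rook_hom h A q r)"

definition pi0_space :: "('s::wellorder \<Rightarrow> 'h::chilbert_space) \<Rightarrow> 'h bop \<Rightarrow> 'h bop \<Rightarrow>
    's gns_vector set" where
  "pi0_space h A q =
     closed_span tensor_algebra_inf (gns_form h A) (range (\<lambda>r. Pi_rep h A q r (xi0 h A)))"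

definition pi0 :: "('s::wellorder \<Rightarrow> 'h::chilbert_space) \<Rightarrow> 'h bop \<Rightarrow> 'h bop \<Rightarrow>
    rook \<Rightarrow> 's gns_vector \<Rightarrow> 's gns_vector" where
  "pi0 h A q r = restrict (Pi_rep h A q r) (pi0_space h A q)"

definition rook_function :: "('s::wellorder \<Rightarrow> 'h::chilbert_space) \<Rightarrow> 'h bop \<Rightarrow> 'h bop \<Rightarrow>
    rook \<Rightarrow> complex" where
  "rook_function h A q r = completion_inner (gns_form h A) (pi0 h A q r (xi0 h A)) (xi0 h A)"


section \<open>Admissible data\<close>

definition admissible_parameters :: "'h::chilbert_space bop \<Rightarrow> 'h bop \<Rightarrow> bool" where
  "admissible_parameters A q \<longleftrightarrow>
     selfadjoint A \<and> minimal_projection q \<and> A * q = q * A \<and>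
     trace_class A \<and> Re (Tr (abs_bop A)) \<le> 1 \<and>
     (q \<noteq> 0 \<longrightarrow> Tr q = 1) \<and>
     (Tr (abs_bop A) = 1 \<longrightarrow> ker A = {0}) \<and>
     (Re (Tr (abs_bop A)) < 1 \<longrightarrow> \<not> (\<exists>B. finite B \<and> ker A \<subseteq> cspan B)) \<and>
     q * spectral_projection A {-1..0} = 0"

text \<open>An indexed orthonormal basis that yields matrix units commuting with \<open>A\<close> on the diagonal.
  Finiteness of all initial segments says that the well-ordered index type \<open>'s\<close> is a copy of
  \<open>{1, \<dots>, dim H}\<close> or of the natural numbers.\<close>

definition adapted_basis :: "'h::chilbert_space bop \<Rightarrow> ('s::wellorder \<Rightarrow> 'h) \<Rightarrow> bool" where
  "adapted_basis A h \<longleftrightarrow>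
     (\<forall>s::'s. finite {..s}) \<and> inj h \<and> orthonormal_basis (range h) \<and>
     (\<forall>l. A * matrix_unit h l l = matrix_unit h l l * A)"

end

theory Submission
  imports Defs
begin

text \<open>In the basis \<open>h\<close> the operator \<open>A\<close> is diagonal, with spectral measure concentrated on the
  eigenvalues, and \<open>q = \<langle>_, x\<rangle> x\<close> for an eigenvector \<open>x\<close> of a positive eigenvalue.  On the infinite tensor
  power a permutation acts by permuting the factors, with the sign of the induced reordering of the
  factors with negative eigenvalue; these signs form a cocycle, and \<open>x \<otimes> x\<close> is fixed by the flip, so
  the action extends to \<open>R\<^sub>\<infinity>\<close>.  The function \<open>f r\<close> is the mean of the diagonal matrix entries of
  \<open>T r\<close> under a product probability measure on basis vectors.  An operator attached to a quasicycle
  changes factors in its support only and its diagonal entries depend on these factors only; hence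
  the diagonal entries, and then \<open>f\<close>, are multiplicative for disjoint supports.  On a single cycle the
  mean is a sum over constant configurations, or a closed chain of rank-one matrices when some
  \<open>\<epsilon>\<close> is present.  Indecomposability follows from multiplicativity by averaging over disjoint
  conjugates.\<close>

subsection \<open>Inner products and bounded operators\<close>

text \<open>The state at each site carries the mass \<open>1 - Tr |A|\<close> on a kernel vector of
  \<open>A\<close>, and condition (d) supplies a different vector for every site. A cycle of length
  at least 2 forces equal basis indices at distinct sites, so this mass never contributes and only
  the nonzero eigenvalues survive as Thoma parameters. Positivity of the eigenvalue of
  \<open>x\<close>, which comes from condition (e), is used twice: the factors on which
  \<open>q\<close> acts are even, so no sign obstructs the relations with permutations; and a
  nonzero eigenvalue of a trace class operator has finite multiplicity, so \<open>x\<close>, which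
  need not be a basis vector, has only finitely many coordinates. The sign of a permutation is an
  inversion count and not a product along a word in the generators, so no presentation of the
  symmetric group enters. The objects given by descriptions (absolute value, trace, spectral
  projections, \<open>rook_hom\<close>, inner product of the completion) must be shown to be unique
  as well as to exist; for the spectral measure uniqueness is the harder half, since the integral
  formula for \<open>A\<close> is available only as a quadratic form.\<close>

lemma cinner_add_right: "cinner x (y + z) = cinner x y + cinner x (z::'a::chilbert_space)"
  by (metis cinner_add_left cinner_commute complex_cnj_add)

lemma cinner_scaleC_right: "cinner x (c *\<^sub>C y) = cnj c * cinner x (y::'a::chilbert_space)"
  by (metis cinner_scaleC_left cinner_commute complex_cnj_mult)

lemma scaleC_0_left: "0 *\<^sub>C (x::'a::complex_vector) = 0"
  using scaleR_scaleC[of 0 x] by simp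

lemma scaleC_minus_left: "(- c) *\<^sub>C (x::'a::complex_vector) = - (c *\<^sub>C x)"
  using scaleC_add_left[of c "-c" x] by (simp add: scaleC_0_left eq_neg_iff_add_eq_0 add.commute)

lemma minus_eq_scaleC: "- (x::'a::complex_vector) = (-1) *\<^sub>C x"
  by (simp add: scaleC_minus_left scaleC_one)

lemma cinner_zero_left [simp]: "cinner 0 (y::'a::chilbert_space) = 0"
  using cinner_add_left[of 0 0 y] by simp

lemma cinner_zero_right [simp]: "cinner (y::'a::chilbert_space) 0 = 0"
  using cinner_add_right[of y 0 0] by simp

lemma cinner_minus_left: "cinner (- x) (y::'a::chilbert_space) = - cinner x y"
  by (metis minus_eq_scaleC cinner_scaleC_left mult_minus1)

lemma cinner_minus_right: "cinner x (- y::'a::chilbert_space) = - cinner x y"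
  using cinner_scaleC_right[of x "-1" y] by (simp add: minus_eq_scaleC)

lemma cinner_diff_left: "cinner (x - y) (z::'a::chilbert_space) = cinner x z - cinner y z"
  using cinner_add_left[of x "- y" z] by (simp add: cinner_minus_left)

lemma cinner_diff_right: "cinner z (x - y::'a::chilbert_space) = cinner z x - cinner z y"
  using cinner_add_right[of z x "- y"] by (simp add: cinner_minus_right)

lemma cinner_sum_left: "cinner (sum f S) (z::'a::chilbert_space) = (\<Sum>i\<in>S. cinner (f i) z)"
  by (induct S rule: infinite_finite_induct) (simp_all add: cinner_add_left)

lemma cinner_sum_right: "cinner (z::'a::chilbert_space) (sum f S) = (\<Sum>i\<in>S. cinner z (f i))"
  by (induct S rule: infinite_finite_induct) (simp_all add: cinner_add_right)

lemmas cinner_simps = cinner_add_left cinner_add_right cinner_scaleC_left cinner_scaleC_right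
  cinner_diff_left cinner_diff_right cinner_minus_left cinner_minus_right

lemma cinner_self_eq_0: "cinner x x = 0 \<longleftrightarrow> (x::'a::chilbert_space) = 0"
  by (simp add: cinner_same)

lemma bounded_linear_cinner_left: "bounded_linear (\<lambda>x::'a::chilbert_space. cinner x y)"
  by (rule bounded_linear_intro[where K = "norm y"])
    (simp_all add: cinner_add_left scaleR_scaleC cinner_scaleC_left norm_cinner scaleR_conv_of_real)

lemma cinner_eqI:
  assumes "\<And>x. cinner x y = cinner x (z::'a::chilbert_space)"
  shows "y = z"
  using assms[of "y - z"] cinner_self_eq_0[of "y - z"] by (simp add: cinner_diff_right)

lemma bounded_linear_app: "bounded_linear (app a)"
  using app[of a] by simp

lemma app_scaleC: "app a (c *\<^sub>C x) = c *\<^sub>C app a x"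
  using app[of a] by simp

lemma app_add: "app a (x + y) = app a x + app a y"
  using bounded_linear_app[of a] by (simp add: linear_simps)

lemma app_diff: "app a (x - y) = app a x - app a y"
  using bounded_linear_app[of a] by (simp add: linear_simps)

lemma app_0 [simp]: "app a 0 = 0"
  using bounded_linear_app[of a] by (simp add: linear_simps)

lemma app_zero [simp]: "app 0 x = 0" by (simp add: zero_bop.rep_eq)
lemma app_one [simp]: "app 1 x = x" by (simp add: one_bop.rep_eq)
lemma app_plus: "app (a + b) x = app a x + app b x" by (simp add: plus_bop.rep_eq)
lemma app_minus: "app (a - b) x = app a x - app b x" by (simp add: minus_bop.rep_eq)
lemma app_times: "app (a * b) x = app a (app b x)" by (simp add: times_bop.rep_eq)
lemma app_scale: "app (c *\<^sub>C a) x = c *\<^sub>C app a x" by (simp add: scaleC_bop.rep_eq)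

lemma app_sum_op: "app (sum f S) x = (\<Sum>i\<in>S. app (f i) x)"
  by (induct S rule: infinite_finite_induct) (simp_all add: app_plus)

lemmas app_simps = app_plus app_minus app_times app_scale app_scaleC app_add app_diff

lemma bop_eqI: "(\<And>x. app a x = app b x) \<Longrightarrow> a = b"
  by (metis app_inject ext)

lemma norm_app: "norm (app a x) \<le> onorm (app a) * norm x"
  by (rule onorm[OF bounded_linear_app])

lemma app_Abs_bop:
  assumes "bounded_linear f" "\<And>c x. f (c *\<^sub>C x) = c *\<^sub>C f x"
  shows "app (Abs_bop f) x = f x"
  using assms by (simp add: Abs_bop_inverse)

subsection \<open>Adjoints\<close>

text \<open>The representing vector minimises \<open>\<parallel>x\<parallel>\<^sup>2 - 2 f x\<close>; the parallelogram law makes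
  minimising sequences Cauchy.\<close>

lemma riesz_real:
  fixes f :: "'a::chilbert_space \<Rightarrow> real"
  assumes f: "bounded_linear f"
  shows "\<exists>z. \<forall>x. f x = inner x z"
proof -
  interpret f: bounded_linear f by fact
  obtain K where K: "\<And>x. norm (f x) \<le> norm x * K" "K > 0"
    using f.pos_bounded by auto
  define J where "J x = (norm x)\<^sup>2 - 2 * f x" for x
  have Jge: "J x \<ge> - K\<^sup>2" for x
  proof -
    have "f x \<le> norm x * K" using K(1)[of x] by simp
    moreover have "0 \<le> (norm x - K)\<^sup>2" by simp
    ultimately show ?thesis unfolding J_def power2_diff by linarith
  qed
  define m where "m = Inf (range J)"
  have bdd: "bdd_below (range J)" using Jge by (intro bdd_belowI[of _ "- K\<^sup>2"]) auto
  have mle: "m \<le> J x" for x unfolding m_def using bdd by (simp add: cINF_lower)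
  have par: "(norm (x - y))\<^sup>2 \<le> 2 * (J x - m) + 2 * (J y - m)" for x y
  proof -
    have "J x + J y = 2 * J ((1/2) *\<^sub>R (x + y)) + (norm (x - y))\<^sup>2 / 2"
      unfolding J_def
      by (simp add: f.add f.scaleR power2_norm_eq_inner inner_simps algebra_simps inner_commute)
        (simp add: field_simps)
    moreover note mle[of "(1/2) *\<^sub>R (x + y)"]
    ultimately show ?thesis unfolding right_diff_distrib by argo
  qed
  have "\<exists>x. J x < m + 1 / real (Suc n)" for n
  proof -
    have "Inf (range J) < m + 1 / real (Suc n)" unfolding m_def by simp
    then show ?thesis by (subst (asm) cInf_less_iff) (use bdd in auto)
  qed
  then obtain X where X: "\<And>n. J (X n) < m + 1 / real (Suc n)" by metis
  have "Cauchy X"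
  proof (rule metric_CauchyI)
    fix e :: real assume e: "0 < e"
    obtain N where N: "1 / real (Suc N) < e\<^sup>2 / 4"
      using reals_Archimedean[of "e\<^sup>2/4"] e by (auto simp: inverse_eq_divide)
    have "dist (X i) (X j) < e" if "i \<ge> N" "j \<ge> N" for i j
    proof -
      have "J (X k) - m < e\<^sup>2 / 4" if "k \<ge> N" for k
      proof -
        have "1 / real (Suc k) \<le> 1 / real (Suc N)" using that by (simp add: frac_le)
        then show ?thesis using X[of k] N by linarith
      qed
      from this[OF that(1)] this[OF that(2)] have "(norm (X i - X j))\<^sup>2 < e\<^sup>2"
        using par[of "X i" "X j"] unfolding right_diff_distrib by argo
      then show ?thesis using e by (simp add: dist_norm power2_less_imp_less)
    qed
    then show "\<exists>N. \<forall>i\<ge>N. \<forall>j\<ge>N. dist (X i) (X j) < e" by blast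
  qed
  then obtain z where z: "X \<longlonglongrightarrow> z" using Cauchy_convergent convergent_def by blast
  have "(\<lambda>n. J (X n)) \<longlonglongrightarrow> J z"
    unfolding J_def by (intro tendsto_intros z f.tendsto)
  moreover have "(\<lambda>n. J (X n)) \<longlonglongrightarrow> m"
  proof (rule tendsto_sandwich[where f = "\<lambda>_. m" and h = "\<lambda>n. m + 1 / real (Suc n)"])
    show "(\<lambda>n. m + 1 / real (Suc n)) \<longlonglongrightarrow> m"
      using tendsto_add[OF tendsto_const LIMSEQ_inverse_real_of_nat, of m]
      by (simp add: inverse_eq_divide)
  qed (use X mle in \<open>auto intro!: always_eventually less_imp_le\<close>)
  ultimately have Jz: "J z = m" by (rule LIMSEQ_unique)
  have "f x = inner x z" for x
  proof -
    define d where "d = inner x z - f x"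
    have q: "0 \<le> t\<^sup>2 * (norm x)\<^sup>2 + 2 * t * d" for t
    proof -
      have "J (z + t *\<^sub>R x) = J z + (t\<^sup>2 * (norm x)\<^sup>2 + 2 * t * d)"
        unfolding J_def d_def
        by (simp add: f.add f.scaleR power2_norm_eq_inner inner_simps algebra_simps inner_commute power2_eq_square[of t])
      then show ?thesis using mle[of "z + t *\<^sub>R x"] Jz by linarith
    qed
    have "d = 0"
    proof (cases "x = 0")
      case True then show ?thesis by (simp add: d_def f.zero)
    next
      case False
      have "0 \<le> - (d\<^sup>2) / (norm x)\<^sup>2"
        using q[of "- d / (norm x)\<^sup>2"] False by (simp add: field_simps power2_eq_square)
      then have "d\<^sup>2 \<le> 0" using False by (simp add: divide_le_0_iff)
      then show ?thesis by simp
    qed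
    then show ?thesis by (simp add: d_def)
  qed
  then show ?thesis by blast
qed

text \<open>The real Riesz representation is applied in the first argument with the second one
  frozen; conjugate linearity in the second argument and the bound then pass to the representing
  vector.\<close>

lemma form_operator:
  fixes F :: "'a::chilbert_space \<Rightarrow> 'a \<Rightarrow> complex"
  assumes add1: "\<And>x y z. F (x + y) z = F x z + F y z"
    and add2: "\<And>x y z. F x (y + z) = F x y + F x z"
    and scale1: "\<And>c x y. F (c *\<^sub>C x) y = c * F x y"
    and scale2: "\<And>c x y. F x (c *\<^sub>C y) = cnj c * F x y"
    and bound: "\<And>x y. cmod (F x y) \<le> K * norm x * norm y"
  shows "\<exists>b. \<forall>x y. F x y = cinner x (app b y)"
proof -
  have "\<exists>z. \<forall>x. F x y = cinner x z" for y
  proof -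
    have "bounded_linear (\<lambda>x. Re (F x y))"
    proof (rule bounded_linear_intro[where K = "K * norm y"])
      show "norm (Re (F x y)) \<le> norm x * (K * norm y)" for x
        using abs_Re_le_cmod[of "F x y"] bound[of x y] by (simp add: mult_ac)
    qed (simp_all add: add1 scaleR_scaleC scale1)
    then obtain z where z: "\<And>x. Re (F x y) = inner x z" using riesz_real by blast
    have "F x y = cinner x z" for x
    proof (rule complex_eqI)
      show "Re (F x y) = Re (cinner x z)"
        using z[of x] by (simp add: inner_eq_Re_cinner)
      show "Im (F x y) = Im (cinner x z)"
        using z[of "(- \<i>) *\<^sub>C x"] by (simp add: inner_eq_Re_cinner scale1 cinner_scaleC_left)
    qed
    then show ?thesis by blast
  qed
  then obtain g where g: "\<And>x y. F x y = cinner x (g y)" by metis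
  have gadd: "g (x + y) = g x + g y" for x y
    by (rule cinner_eqI) (simp add: cinner_add_right add2 flip: g)
  have gscale: "g (c *\<^sub>C x) = c *\<^sub>C g x" for c x
    by (rule cinner_eqI) (simp add: cinner_scaleC_right scale2 flip: g)
  have "bounded_linear g"
  proof (rule bounded_linear_intro[where K = "\<bar>K\<bar>"])
    show "g (r *\<^sub>R x) = r *\<^sub>R g x" for r x by (simp add: scaleR_scaleC gscale)
    show "norm (g x) \<le> norm x * \<bar>K\<bar>" for x
    proof (cases "g x = 0")
      case False
      have "(norm (g x))\<^sup>2 = cmod (F (g x) x)"
        by (simp only: g cinner_same norm_of_real) simp
      also have "\<dots> \<le> K * norm (g x) * norm x" by (rule bound)
      also have "\<dots> \<le> \<bar>K\<bar> * norm (g x) * norm x" by (intro mult_right_mono) simp_all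
      finally show ?thesis using False by (simp add: power2_eq_square mult.commute mult.left_commute)
    qed simp
  qed (simp add: gadd)
  then have "app (Abs_bop g) y = g y" for y by (intro app_Abs_bop) (simp_all add: gscale)
  then show ?thesis using g by metis
qed

lemma adj_exists: "\<exists>b. \<forall>x y. cinner (app a x) y = cinner x (app b (y::'a::chilbert_space))"
proof (rule form_operator[where K = "onorm (app a)"])
  show "cmod (cinner (app a x) y) \<le> onorm (app a) * norm x * norm y" for x y
    by (rule order_trans[OF norm_cinner]) (intro mult_right_mono norm_app norm_ge_zero)
qed (simp_all add: app_add app_scaleC cinner_simps)

lemma adj_eqI:
  assumes "\<And>x y. cinner (app a x) y = cinner x (app b y)"
  shows "adj a = b"
  unfolding adj_def
proof (rule the_equality)
  fix c assume "\<forall>x y. cinner (app a x) y = cinner x (app c y)"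
  then have "cinner x (app c y) = cinner x (app b y)" for x y using assms by simp
  then show "c = b" by (intro bop_eqI cinner_eqI)
qed (use assms in blast)

lemma cinner_adj: "cinner (app a x) y = cinner x (app (adj a) y)"
  using adj_exists[of a] adj_eqI by metis

lemma cinner_adj': "cinner (app (adj a) x) y = cinner x (app a y)"
  by (metis cinner_adj cinner_commute)

lemma adj_adj [simp]: "adj (adj a) = a"
  by (rule adj_eqI) (rule cinner_adj')

lemma adj_times: "adj (a * b) = adj b * adj a"
  by (rule adj_eqI) (simp add: app_times cinner_adj)

text \<open>Polarisation: the vectors \<open>x + y\<close> and \<open>x + \<i> y\<close> recover the
  imaginary and the real part of the Hermitian symmetry from the quadratic form.\<close>

lemma selfadjointI:
  assumes "\<And>x. Im (cinner (app a x) x) = 0"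
  shows "adj a = a"
proof (rule adj_eqI)
  fix x y
  have "Im (cinner (app a x) y) + Im (cinner (app a y) x) = 0"
    using assms[of "x + y"] assms[of x] assms[of y] by (simp add: app_add cinner_simps)
  moreover have "Re (cinner (app a y) x) - Re (cinner (app a x) y) = 0"
    using assms[of "x + \<i> *\<^sub>C y"] assms[of x] assms[of y]
    by (simp add: app_add app_scaleC cinner_simps)
  ultimately have "cinner (app a x) y = cnj (cinner (app a y) x)"
    by (simp add: complex_eq_iff)
  then show "cinner (app a x) y = cinner x (app a y)" by (metis cinner_commute)
qed

lemma adj_one [simp]: "adj 1 = 1"
  by (rule adj_eqI) simp

subsection \<open>Orthonormal bases and traces\<close>

lemma module_scaleC: "module (scaleC :: complex \<Rightarrow> 'a::complex_vector \<Rightarrow> 'a)"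
  by standard (simp_all add: scaleC_add_right scaleC_add_left scaleC_scaleC scaleC_one)

lemma cspan_explicit:
  "cspan S = {\<Sum>x\<in>t. r x *\<^sub>C x | t r. finite t \<and> t \<subseteq> S}"
  unfolding cspan_def by (rule module.span_explicit[OF module_scaleC])

text \<open>The partial sum over a finite \<open>G\<close> is the best approximation to
  \<open>x\<close> from the span of \<open>G\<close>. Density gives some finite combination close to
  \<open>x\<close>, and every larger finite set does at least as well.\<close>

lemma onb_expansion:
  assumes "orthonormal_basis (B::'a::chilbert_space set)"
  shows "((\<lambda>b. cinner x b *\<^sub>C b) has_sum x) B"
proof -
  have orth: "cinner b c = (if b = c then 1 else 0)" if "b \<in> B" "c \<in> B" for b c
    using assms that by (simp add: orthonormal_basis_def)
  have best: "norm (x - (\<Sum>b\<in>G. cinner x b *\<^sub>C b)) \<le> norm (x - (\<Sum>b\<in>G. r b *\<^sub>C b))"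
    if G: "finite G" "G \<subseteq> B" for G and r :: "'a \<Rightarrow> complex"
  proof -
    define P where "P = (\<Sum>b\<in>G. cinner x b *\<^sub>C b)"
    define z where "z = (\<Sum>b\<in>G. r b *\<^sub>C b)"
    have perp: "cinner (x - P) b = 0" if "b \<in> G" for b
    proof -
      have "cinner P b = (\<Sum>c\<in>G. if c = b then cinner x c else 0)"
        unfolding P_def cinner_sum_left
        by (rule sum.cong) (use orth[of _ b] that G in \<open>auto simp: cinner_scaleC_left subset_eq\<close>)
      then show ?thesis using that G by (simp add: cinner_diff_left)
    qed
    have "P - z = (\<Sum>b\<in>G. (cinner x b - r b) *\<^sub>C b)"
      unfolding P_def z_def sum_subtractf[symmetric]
      by (intro sum.cong refl) (metis diff_add_cancel scaleC_add_left add_diff_cancel_right')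
    then have "cinner (x - P) (P - z) = 0"
      by (simp add: cinner_sum_right cinner_scaleC_right perp)
    then have "inner (x - P) (P - z) = 0" by (simp add: inner_eq_Re_cinner)
    then have "(norm ((x - P) + (P - z)))\<^sup>2 = (norm (x - P))\<^sup>2 + (norm (P - z))\<^sup>2"
      by (simp only: power2_norm_eq_inner inner_add_left inner_add_right)
        (simp add: inner_commute)
    then have "(norm (x - P))\<^sup>2 \<le> (norm (x - z))\<^sup>2" by simp
    then show ?thesis unfolding P_def z_def by (rule power2_le_imp_le) simp
  qed
  show ?thesis
    unfolding has_sum_def tendsto_iff
  proof (intro allI impI)
    fix e :: real assume "0 < e"
    have "x \<in> closure (cspan B)" using assms by (simp add: orthonormal_basis_def)
    then obtain z where z: "z \<in> cspan B" "dist z x < e"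
      using \<open>0 < e\<close> by (auto simp: closure_approachable)
    then obtain F r where F: "finite F" "F \<subseteq> B" "z = (\<Sum>b\<in>F. r b *\<^sub>C b)"
      unfolding cspan_explicit by blast
    show "\<forall>\<^sub>F G in finite_subsets_at_top B. dist (\<Sum>b\<in>G. cinner x b *\<^sub>C b) x < e"
      unfolding eventually_finite_subsets_at_top
    proof (intro exI conjI allI impI)
      fix G assume G: "finite G \<and> F \<subseteq> G \<and> G \<subseteq> B"
      have "z = (\<Sum>b\<in>G. (if b \<in> F then r b else 0) *\<^sub>C b)"
        unfolding F(3) using G by (intro sum.mono_neutral_cong_left) (auto simp: scaleC_0_left)
      then show "dist (\<Sum>b\<in>G. cinner x b *\<^sub>C b) x < e"
        using best[of G "\<lambda>b. if b \<in> F then r b else 0"] G z(2) by (simp add: dist_norm norm_minus_commute)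
    qed (use F in auto)
  qed
qed

lemma onb_parseval:
  assumes "orthonormal_basis (B::'a::chilbert_space set)"
  shows "((\<lambda>b. cinner x b * cnj (cinner y b)) has_sum cinner x y) B"
  using has_sum_bounded_linear[OF bounded_linear_cinner_left onb_expansion[OF assms, of x], of y]
  by (simp add: cinner_scaleC_left o_def flip: cinner_commute)

lemma onb_norm:
  assumes "orthonormal_basis (B::'a::chilbert_space set)"
  shows "((\<lambda>b. (cmod (cinner x b))\<^sup>2) has_sum (norm x)\<^sup>2) B"
proof -
  have "((\<lambda>b. complex_of_real ((cmod (cinner x b))\<^sup>2)) has_sum complex_of_real ((norm x)\<^sup>2)) B"
    using onb_parseval[OF assms, of x x] unfolding cinner_same
    by (simp add: complex_norm_square[symmetric])
  then show ?thesis by (simp only: has_sum_of_real_iff)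
qed

lemma onb_bessel:
  assumes "orthonormal_basis (B::'a::chilbert_space set)" "finite F" "F \<subseteq> B"
  shows "(\<Sum>b\<in>F. (cmod (cinner x b))\<^sup>2) \<le> (norm x)\<^sup>2"
  using finite_sum_le_has_sum[OF onb_norm[OF assms(1)] assms(2,3)] by simp

lemma onb_cauchy_schwarz:
  assumes B: "orthonormal_basis (B::'a::chilbert_space set)"
  shows "(\<lambda>b. cmod (cinner x b) * cmod (cinner y b)) summable_on B"
    "(\<Sum>\<^sub>\<infinity>b\<in>B. cmod (cinner x b) * cmod (cinner y b)) \<le> norm x * norm y"
proof -
  have le: "(\<Sum>b\<in>F. cmod (cinner x b) * cmod (cinner y b)) \<le> norm x * norm y"
    if "finite F" "F \<subseteq> B" for F
  proof -
    have "(\<Sum>b\<in>F. cmod (cinner x b) * cmod (cinner y b))\<^sup>2 \<le>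
        (\<Sum>b\<in>F. (cmod (cinner x b))\<^sup>2) * (\<Sum>b\<in>F. (cmod (cinner y b))\<^sup>2)"
      by (rule Cauchy_Schwarz_ineq_sum)
    also have "\<dots> \<le> (norm x)\<^sup>2 * (norm y)\<^sup>2"
      by (intro mult_mono onb_bessel[OF B that] sum_nonneg) auto
    finally show ?thesis unfolding power_mult_distrib[symmetric] by (rule power2_le_imp_le) simp
  qed
  show s: "(\<lambda>b. cmod (cinner x b) * cmod (cinner y b)) summable_on B"
    by (rule nonneg_bdd_above_summable_on) (auto intro!: bdd_aboveI[of _ "norm x * norm y"] le)
  show "(\<Sum>\<^sub>\<infinity>b\<in>B. cmod (cinner x b) * cmod (cinner y b)) \<le> norm x * norm y"
    by (rule infsum_le_finite_sums[OF s le])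
qed

text \<open>By Cauchy-Schwarz in each rank-one term the double family over \<open>I\<close> and
  \<open>B\<close> is absolutely summable, so the sums may be exchanged and the result no longer
  depends on \<open>B\<close>. This yields the trace in every basis from an expansion in a single
  one.\<close>

lemma has_trace_nuclear:
  fixes a :: "'a::chilbert_space bop"
  assumes exp: "\<And>x. ((\<lambda>l. cinner x (u l) *\<^sub>C w l) has_sum app a x) I"
    and sm: "(\<lambda>l. norm (u l) * norm (w l)) summable_on I"
  shows "has_trace a (\<Sum>\<^sub>\<infinity>l\<in>I. cinner (w l) (u l))"
  unfolding has_trace_def
proof (intro allI impI)
  fix B :: "'a set" assume B: "orthonormal_basis B"
  define F where "F l b = cinner (w l) b * cnj (cinner (u l) b)" for l b
  have nF: "norm (F l b) = cmod (cinner (w l) b) * cmod (cinner (u l) b)" for l b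
    by (simp add: F_def norm_mult)
  have "(\<lambda>p. norm (case_prod F p)) summable_on I \<times> B"
    unfolding Infinite_Sum.abs_summable_on_Sigma_iff
  proof (intro conjI ballI)
    show "(\<lambda>b. norm (case_prod F (l, b))) summable_on B" for l
      using onb_cauchy_schwarz(1)[OF B] by (simp add: nF)
    have "(\<lambda>l. \<Sum>\<^sub>\<infinity>b\<in>B. norm (F l b)) summable_on I"
    proof (rule summable_on_comparison_test[OF sm])
      show "(\<Sum>\<^sub>\<infinity>b\<in>B. norm (F l b)) \<le> norm (u l) * norm (w l)" for l
        using onb_cauchy_schwarz(2)[OF B, of "w l" "u l"] by (simp add: nF mult.commute)
    qed (simp add: infsum_nonneg)
    then show "(\<lambda>l. norm (\<Sum>\<^sub>\<infinity>b\<in>B. norm (case_prod F (l, b)))) summable_on I"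
      by (simp add: infsum_nonneg)
  qed
  then have sF: "(\<lambda>(l, b). F l b) summable_on I \<times> B" by (rule abs_summable_summable)
  then have sF': "(\<lambda>(b, l). F l b) summable_on B \<times> I"
    by (simp add: summable_on_swap[of _ B I] case_prod_unfold)
  have "((\<lambda>l. F l b) has_sum cinner (app a b) b) I" for b
    using has_sum_bounded_linear[OF bounded_linear_cinner_left exp[of b], of b]
    by (simp add: F_def cinner_scaleC_left o_def mult.commute flip: cinner_commute)
  then have i1: "(\<Sum>\<^sub>\<infinity>l\<in>I. F l b) = cinner (app a b) b" for b by (rule infsumI)
  have i2: "(\<Sum>\<^sub>\<infinity>b\<in>B. F l b) = cinner (w l) (u l)" for l
    unfolding F_def by (rule infsumI[OF onb_parseval[OF B]])
  have "(\<lambda>b. \<Sum>\<^sub>\<infinity>l\<in>I. F l b) summable_on B"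
    using summable_on_Sigma_banach[OF sF'] .
  then have "(\<lambda>b. cinner (app a b) b) summable_on B" by (simp add: i1)
  moreover have "(\<Sum>\<^sub>\<infinity>b\<in>B. cinner (app a b) b) = (\<Sum>\<^sub>\<infinity>l\<in>I. cinner (w l) (u l))"
    using infsum_swap_banach[OF sF] by (simp add: i1 i2)
  ultimately show "((\<lambda>b. cinner (app a b) b) has_sum (\<Sum>\<^sub>\<infinity>l\<in>I. cinner (w l) (u l))) B"
    by (simp add: has_sum_iff)
qed

text \<open>One orthonormal basis has to be at hand, because \<open>has_trace\<close> quantifies
  over all of them and would otherwise hold of every value.\<close>

lemma Tr_eqI:
  fixes a :: "'a::chilbert_space bop"
  assumes "has_trace a t" "orthonormal_basis (B :: 'a set)"
  shows "Tr a = t"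
  unfolding Tr_def
proof (rule the_equality)
  fix s assume "has_trace a s"
  then have "((\<lambda>x. cinner (app a x) x) has_sum s) B"
    using assms(2) by (simp add: has_trace_def)
  moreover have "((\<lambda>x. cinner (app a x) x) has_sum t) B"
    using assms by (simp add: has_trace_def)
  ultimately show "s = t" by (rule has_sum_unique)
qed (rule assms)

definition ONB :: "('i \<Rightarrow> 'a::chilbert_space) \<Rightarrow> bool" where
  "ONB h \<longleftrightarrow> inj h \<and> orthonormal_basis (range h)"

lemma ONB_orth:
  assumes "ONB h" shows "cinner (h i) (h j) = (if i = j then 1 else 0)"
proof -
  have "cinner (h i) (h j) = (if h i = h j then 1 else 0)"
    using assms unfolding ONB_def orthonormal_basis_def by blast
  also have "h i = h j \<longleftrightarrow> i = j" using assms unfolding ONB_def by (blast dest: injD)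
  finally show ?thesis .
qed

lemma ONB_norm_1: "ONB h \<Longrightarrow> norm (h i) = 1"
  using ONB_orth[of h i i] by (simp add: cinner_same)
    (metis of_real_1 of_real_eq_iff of_real_power norm_ge_zero power2_eq_1_iff abs_1 abs_norm_cancel abs_minus_cancel)

lemma ONB_expansion:
  assumes "ONB h" shows "((\<lambda>i. cinner x (h i) *\<^sub>C h i) has_sum x) UNIV"
  using onb_expansion[of "range h" x] assms has_sum_reindex[of h UNIV "\<lambda>b. cinner x b *\<^sub>C b"]
  by (simp add: ONB_def o_def)

lemma ONB_norm:
  assumes "ONB h" shows "((\<lambda>i. (cmod (cinner x (h i)))\<^sup>2) has_sum (norm x)\<^sup>2) UNIV"
  using onb_norm[of "range h" x] assms has_sum_reindex[of h UNIV "\<lambda>b. (cmod (cinner x b))\<^sup>2"]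
  by (simp add: ONB_def o_def)

lemma ONB_eqI:
  assumes h: "ONB h" and eq: "\<And>i. cinner x (h i) = cinner y (h i)"
  shows "x = y"
  using has_sum_unique[OF ONB_expansion[OF h, of x]] ONB_expansion[OF h, of y] eq by simp

lemma ONB_bop_eqI:
  assumes h: "ONB h" and eq: "\<And>i. app a (h i) = app b (h i)"
  shows "a = b"
proof (rule bop_eqI)
  fix x
  show "app a x = app b x"
    using has_sum_bounded_linear[OF bounded_linear_app ONB_expansion[OF h, of x], of a]
      has_sum_bounded_linear[OF bounded_linear_app ONB_expansion[OF h, of x], of b]
    by (auto simp: app_scaleC eq o_def intro: has_sum_unique)
qed

lemma matrix_unit_app:
  "app (matrix_unit h k l) x = cinner x (h l) *\<^sub>C h k"
proof -
  have "bounded_linear (\<lambda>x. cinner x (h l) *\<^sub>C h k)"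
  proof (rule bounded_linear_intro[where K = "norm (h l) * norm (h k)"])
    show "norm (cinner x (h l) *\<^sub>C h k) \<le> norm x * (norm (h l) * norm (h k))" for x
      unfolding norm_scaleC mult.assoc[symmetric] by (intro mult_right_mono norm_cinner) simp
  qed (simp_all add: cinner_add_left scaleC_add_left scaleR_scaleC cinner_scaleC_left scaleC_scaleC)
  then have e: "app (Abs_bop (\<lambda>x. cinner x (h l) *\<^sub>C h k)) x = cinner x (h l) *\<^sub>C h k" for x
    by (intro app_Abs_bop) (simp_all add: cinner_scaleC_left scaleC_scaleC)
  have "\<forall>x. app (matrix_unit h k l) x = cinner x (h l) *\<^sub>C h k"
    unfolding matrix_unit_def
  proof (rule theI)
    show "\<forall>x. app (Abs_bop (\<lambda>x. cinner x (h l) *\<^sub>C h k)) x = cinner x (h l) *\<^sub>C h k"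
      by (rule allI) (rule e)
    show "b = Abs_bop (\<lambda>x. cinner x (h l) *\<^sub>C h k)"
      if "\<forall>x. app b x = cinner x (h l) *\<^sub>C h k" for b
      by (rule bop_eqI) (simp only: e that[rule_format])
  qed
  then show ?thesis by (rule spec)
qed

subsection \<open>Diagonal operators\<close>

lemma ONB_range: "ONB h \<Longrightarrow> orthonormal_basis (range h)"
  by (simp add: ONB_def)

lemma ONB_parseval:
  assumes "ONB h" shows "((\<lambda>i. cinner x (h i) * cnj (cinner y (h i))) has_sum cinner x y) UNIV"
  using onb_parseval[of "range h" x y] assms
    has_sum_reindex[of h UNIV "\<lambda>b. cinner x b * cnj (cinner y b)"]
  by (simp add: ONB_def o_def)

lemma ONB_cauchy_schwarz:
  assumes "ONB h"
  shows "(\<lambda>i. cmod (cinner x (h i)) * cmod (cinner y (h i))) summable_on UNIV"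
    "(\<Sum>\<^sub>\<infinity>i. cmod (cinner x (h i)) * cmod (cinner y (h i))) \<le> norm x * norm y"
  using onb_cauchy_schwarz[of "range h" x y] assms
    summable_on_reindex[of h UNIV "\<lambda>b. cmod (cinner x b) * cmod (cinner y b)"]
    infsum_reindex[of h UNIV "\<lambda>b. cmod (cinner x b) * cmod (cinner y b)"]
  by (simp_all add: ONB_def o_def)

lemma diagonal_exists:
  assumes h: "ONB h" and d: "\<And>l. cmod (d l) \<le> K"
  shows "\<exists>b. \<forall>l. app b (h l) = d l *\<^sub>C h l"
proof -
  \<comment> \<open>The weight is conjugated because \<open>form_operator\<close> delivers the
    operator in the second, conjugate linear argument.\<close>
  define G where "G x y l = cnj (d l) * (cinner x (h l) * cnj (cinner y (h l)))" for x y l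
  have K: "0 \<le> K" using d[of undefined] norm_ge_zero order_trans by blast
  have nG: "norm (G x y l) \<le> K * (cmod (cinner x (h l)) * cmod (cinner y (h l)))" for x y l
    unfolding G_def norm_mult complex_mod_cnj by (intro mult_right_mono d) simp
  have sn: "(\<lambda>l. norm (G x y l)) summable_on UNIV" for x y
    by (rule summable_on_comparison_test[OF summable_on_cmult_right[OF ONB_cauchy_schwarz(1)[OF h, of x y], of K]])
      (use nG in auto)
  have s: "G x y summable_on UNIV" for x y
    using sn[of x y] by (rule abs_summable_summable)
  have "\<exists>b. \<forall>x y. (\<Sum>\<^sub>\<infinity>l. G x y l) = cinner x (app b y)"
  proof (rule form_operator[where K = K])
    show "cmod (\<Sum>\<^sub>\<infinity>l. G x y l) \<le> K * norm x * norm y" for x y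
    proof -
      have "cmod (\<Sum>\<^sub>\<infinity>l. G x y l) \<le> (\<Sum>\<^sub>\<infinity>l. norm (G x y l))"
        by (rule norm_infsum_bound[OF sn])
      also have "\<dots> \<le> (\<Sum>\<^sub>\<infinity>l. K * (cmod (cinner x (h l)) * cmod (cinner y (h l))))"
        by (intro infsum_mono sn summable_on_cmult_right ONB_cauchy_schwarz(1)[OF h] nG)
      also have "\<dots> = K * (\<Sum>\<^sub>\<infinity>l. cmod (cinner x (h l)) * cmod (cinner y (h l)))"
        by (rule infsum_cmult_right')
      also have "\<dots> \<le> K * (norm x * norm y)"
        by (intro mult_left_mono ONB_cauchy_schwarz(2)[OF h] K)
      finally show ?thesis by (simp add: mult.assoc)
    qed
    show "(\<Sum>\<^sub>\<infinity>l. G (x + y) z l) = (\<Sum>\<^sub>\<infinity>l. G x z l) + (\<Sum>\<^sub>\<infinity>l. G y z l)" for x y z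
      unfolding infsum_add[OF s s, symmetric]
      by (intro infsum_cong) (simp add: G_def cinner_add_left algebra_simps)
    show "(\<Sum>\<^sub>\<infinity>l. G x (y + z) l) = (\<Sum>\<^sub>\<infinity>l. G x y l) + (\<Sum>\<^sub>\<infinity>l. G x z l)" for x y z
      unfolding infsum_add[OF s s, symmetric]
      by (intro infsum_cong) (simp add: G_def cinner_add_left algebra_simps)
    show "(\<Sum>\<^sub>\<infinity>l. G (c *\<^sub>C x) y l) = c * (\<Sum>\<^sub>\<infinity>l. G x y l)" for c x y
      unfolding infsum_cmult_right'[symmetric]
      by (intro infsum_cong) (simp add: G_def cinner_scaleC_left algebra_simps)
    show "(\<Sum>\<^sub>\<infinity>l. G x (c *\<^sub>C y) l) = cnj c * (\<Sum>\<^sub>\<infinity>l. G x y l)" for c x y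
      unfolding infsum_cmult_right'[symmetric]
      by (intro infsum_cong) (simp add: G_def cinner_scaleC_left algebra_simps)
  qed
  then obtain b where b: "\<And>x y. (\<Sum>\<^sub>\<infinity>l. G x y l) = cinner x (app b y)" by blast
  have "app b (h l) = d l *\<^sub>C h l" for l
  proof (rule cinner_eqI)
    fix x
    have "cinner x (app b (h l)) = (\<Sum>\<^sub>\<infinity>m. G x (h l) m)" by (simp add: b)
    also have "\<dots> = (\<Sum>\<^sub>\<infinity>m\<in>{l}. G x (h l) m)"
      by (rule infsum_cong_neutral) (auto simp: G_def ONB_orth[OF h])
    also have "\<dots> = cinner x (d l *\<^sub>C h l)"
      by (simp add: G_def ONB_orth[OF h] cinner_scaleC_right)
    finally show "cinner x (app b (h l)) = cinner x (d l *\<^sub>C h l)" .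
  qed
  then show ?thesis by blast
qed

lemma diagonal_adj:
  assumes h: "ONB h" and d: "\<And>l. app b (h l) = d l *\<^sub>C h l"
  shows "app (adj b) (h l) = cnj (d l) *\<^sub>C h l"
  by (rule ONB_eqI[OF h]) (simp add: cinner_adj' d cinner_simps ONB_orth[OF h])

lemma diagonal_cinner:
  assumes h: "ONB h" and d: "\<And>l. app b (h l) = d l *\<^sub>C h l"
  shows "cinner (app b x) (h l) = d l * cinner x (h l)"
  by (simp add: cinner_adj diagonal_adj[OF assms] cinner_scaleC_right)

locale diagonal =
  fixes A :: "'h::chilbert_space bop" and h :: "'s \<Rightarrow> 'h" and a :: "'s \<Rightarrow> real"
  assumes h: "ONB h" and Ah: "\<And>l. app A (h l) = complex_of_real (a l) *\<^sub>C h l"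
begin

lemma a_bounded: "\<bar>a l\<bar> \<le> onorm (app A)"
  using norm_app[of A "h l"] by (simp add: Ah norm_scaleC ONB_norm_1[OF h])

lemma adj_A: "adj A = A"
  by (rule ONB_bop_eqI[OF h]) (simp add: diagonal_adj[OF h Ah] Ah)

text \<open>Uniqueness of the positive root is settled on each basis vector. If \<open>r\<close> is
  positive with \<open>r * r = adj A * A\<close> and \<open>b\<close> is the modulus of the
  eigenvalue, then \<open>y = r h - b h\<close> satisfies \<open>r y = - b y\<close>; for
  \<open>b > 0\<close> positivity forces \<open>y = 0\<close>, and for \<open>b = 0\<close> the norm
  of \<open>r h\<close> vanishes.\<close>

lemma abs_bop_app: "app (abs_bop A) (h l) = complex_of_real \<bar>a l\<bar> *\<^sub>C h l"
proof -
  have "\<exists>p. \<forall>l. app p (h l) = complex_of_real \<bar>a l\<bar> *\<^sub>C h l"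
    by (rule diagonal_exists[OF h, where K = "onorm (app A)"]) (simp add: a_bounded)
  then obtain p where p: "\<And>l. app p (h l) = complex_of_real \<bar>a l\<bar> *\<^sub>C h l" by blast
  have "abs_bop A = p" unfolding abs_bop_def
  proof (rule the_equality)
    have "positive_bop p" unfolding positive_bop_def
    proof
      fix x
      have e: "cinner (app p x) (h l) * cnj (cinner x (h l)) =
          complex_of_real (\<bar>a l\<bar> * (cmod (cinner x (h l)))\<^sup>2)" for l
        by (simp add: diagonal_cinner[OF h p] complex_norm_square[symmetric] mult.assoc)
      have H: "((\<lambda>l. complex_of_real (\<bar>a l\<bar> * (cmod (cinner x (h l)))\<^sup>2)) has_sum cinner (app p x) x) UNIV"
        using ONB_parseval[OF h, of "app p x" x] unfolding e .
      have "((\<lambda>l. \<bar>a l\<bar> * (cmod (cinner x (h l)))\<^sup>2) has_sum Re (cinner (app p x) x)) UNIV"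
        using has_sum_Re[OF H] by simp
      then have "0 \<le> Re (cinner (app p x) x)" by (rule has_sum_nonneg) simp
      moreover have "((\<lambda>l::'s. 0::real) has_sum Im (cinner (app p x) x)) UNIV"
        using has_sum_Im[OF H] by simp
      then have "Im (cinner (app p x) x) = 0" by (rule has_sum_unique) simp
      ultimately show "Im (cinner (app p x) x) = 0 \<and> 0 \<le> Re (cinner (app p x) x)" by blast
    qed
    moreover have "p * p = adj A * A"
      by (rule ONB_bop_eqI[OF h])
        (simp add: adj_A app_times p Ah app_scaleC scaleC_scaleC flip: of_real_mult abs_mult)
    ultimately show "positive_bop p \<and> p * p = adj A * A" ..
    fix r assume r: "positive_bop r \<and> r * r = adj A * A"
    have sa: "adj r = r" by (rule selfadjointI) (use r in \<open>simp add: positive_bop_def\<close>)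
    show "r = p"
    proof (rule ONB_bop_eqI[OF h])
      fix l
      define b where "b = \<bar>a l\<bar>"
      have rr: "app r (app r (h l)) = complex_of_real (b * b) *\<^sub>C h l"
      proof -
        have "app r (app r (h l)) = app (adj A * A) (h l)" using r by (metis app_times)
        then show ?thesis
          by (simp add: adj_A app_times Ah app_scaleC scaleC_scaleC b_def flip: of_real_mult abs_mult)
      qed
      define y where "y = app r (h l) - complex_of_real b *\<^sub>C h l"
      have ry: "app r y = - (complex_of_real b *\<^sub>C y)"
        unfolding y_def by (simp add: app_diff rr app_scaleC scaleC_diff_right scaleC_scaleC)
      have "y = 0"
      proof (cases "b = 0")
        case True
        then have "app r (app r (h l)) = 0" using rr by (simp add: scaleC_0_left)
        then have "cinner (app r (h l)) (app r (h l)) = 0" by (subst cinner_adj) (simp add: sa)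
        then show ?thesis using True by (simp add: y_def cinner_self_eq_0 scaleC_0_left)
      next
        case False
        then have "b > 0" by (simp add: b_def)
        have "0 \<le> Re (cinner (app r y) y)" using r by (simp add: positive_bop_def)
        then have "b * (norm y)\<^sup>2 \<le> 0"
          by (simp add: ry cinner_minus_left cinner_scaleC_left cinner_same flip: of_real_power)
        then show ?thesis using \<open>b > 0\<close> by (simp add: mult_le_0_iff)
      qed
      then show "app r (h l) = app p (h l)" by (simp add: y_def p b_def)
    qed
  qed
  then show ?thesis using p by simp
qed

end

subsection \<open>The spectral measure of a diagonal operator\<close>

abbreviation scalar_measure :: "(real set \<Rightarrow> 'a::chilbert_space bop) \<Rightarrow> 'a \<Rightarrow> real measure" where
  "scalar_measure E x \<equiv> measure_of UNIV (sets borel) (\<lambda>D. ennreal ((norm (app (E D) x))\<^sup>2))"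

lemma projection_norm:
  assumes "projection p"
  shows "cinner (app p x) x = complex_of_real ((norm (app p x))\<^sup>2)" "norm (app p x) \<le> norm x"
    "app p (app p x) = app p x"
proof -
  show pp: "app p (app p x) = app p x" using assms by (metis app_times projection_def)
  have "cinner (app p (app p x)) x = cinner (app p x) (app p x)"
    using assms by (simp add: cinner_adj projection_def)
  then show e: "cinner (app p x) x = complex_of_real ((norm (app p x))\<^sup>2)"
    by (simp only: pp cinner_same)
  have "(norm (app p x))\<^sup>2 = cmod (cinner (app p x) x)" unfolding e norm_of_real by simp
  also have "\<dots> \<le> norm (app p x) * norm x" by (rule norm_cinner)
  finally show "norm (app p x) \<le> norm x"
    by (cases "app p x = 0") (auto simp: power2_eq_square)
qed

lemma projectionI:
  assumes "p * p = p" "\<And>x y. cinner (app p x) y = cinner x (app p y)"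
  shows "projection p"
  using assms adj_eqI[of p p] by (simp add: projection_def)

lemma
  fixes f :: "'s \<Rightarrow> real"
  assumes "f summable_on UNIV"
  shows integrable_count_space: "integrable (count_space UNIV) f"
    and integral_count_space: "(\<integral>l. f l \<partial>count_space UNIV) = (\<Sum>\<^sub>\<infinity>l. f l)"
proof -
  have "Infinite_Sum.abs_summable_on f UNIV"
    using assms summable_on_iff_abs_summable_on_real by blast
  then have "Infinite_Set_Sum.abs_summable_on f UNIV"
    by (simp only: abs_summable_equivalent)
  then show "integrable (count_space UNIV) f" "(\<integral>l. f l \<partial>count_space UNIV) = (\<Sum>\<^sub>\<infinity>l. f l)"
    using infsetsum_infsum[of f UNIV] by (simp_all add: abs_summable_on_def infsetsum_def)
qed

context diagonal
begin

definition diag_spectral :: "real set \<Rightarrow> 'h bop" where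
  "diag_spectral D = (SOME p. \<forall>l. app p (h l) = (if D \<in> sets borel \<and> a l \<in> D then h l else 0))"

lemma diag_spectral_app:
  "app (diag_spectral D) (h l) = (if D \<in> sets borel \<and> a l \<in> D then h l else 0)"
proof -
  have "\<exists>p. \<forall>l. app p (h l) = (if D \<in> sets borel \<and> a l \<in> D then 1 else 0) *\<^sub>C h l"
    by (rule diagonal_exists[OF h, where K = 1]) simp
  moreover have "(if D \<in> sets borel \<and> a l \<in> D then 1 else 0) *\<^sub>C h l =
      (if D \<in> sets borel \<and> a l \<in> D then h l else 0)" for l
    by (simp add: scaleC_one scaleC_0_left)
  ultimately have "\<exists>p. \<forall>l. app p (h l) = (if D \<in> sets borel \<and> a l \<in> D then h l else 0)"
    by (simp only:)
  from someI_ex[OF this] show ?thesis unfolding diag_spectral_def by blast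
qed

lemma diag_spectral_app':
  "app (diag_spectral D) (h l) = (if D \<in> sets borel \<and> a l \<in> D then 1 else 0) *\<^sub>C h l"
  by (simp add: diag_spectral_app scaleC_one scaleC_0_left)

lemma diag_spectral_cinner:
  "cinner (app (diag_spectral D) x) (h l) = (if D \<in> sets borel \<and> a l \<in> D then cinner x (h l) else 0)"
  using diagonal_cinner[OF h diag_spectral_app'[of D], of x l] by simp

lemma diag_spectral_norm:
  assumes "D \<in> sets borel"
  shows "((\<lambda>l. if a l \<in> D then (cmod (cinner x (h l)))\<^sup>2 else 0) has_sum
    (norm (app (diag_spectral D) x))\<^sup>2) UNIV"
proof -
  have "(cmod (cinner (app (diag_spectral D) x) (h l)))\<^sup>2 =
      (if a l \<in> D then (cmod (cinner x (h l)))\<^sup>2 else 0)" for l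
    using assms by (simp add: diag_spectral_cinner)
  then show ?thesis using ONB_norm[OF h, of "app (diag_spectral D) x"] by simp
qed

text \<open>As the image of a discrete measure under the eigenvalue function, the scalar measure
  turns integrals over the line into sums over basis indices.\<close>

lemma scalar_diag:
  "scalar_measure diag_spectral x =
    distr (density (count_space UNIV) (\<lambda>l. ennreal ((cmod (cinner x (h l)))\<^sup>2))) borel a"
    (is "_ = ?N")
proof -
  let ?w = "\<lambda>l. (cmod (cinner x (h l)))\<^sup>2"
  have N: "emeasure ?N D = ennreal ((norm (app (diag_spectral D) x))\<^sup>2)" if D: "D \<in> sets borel" for D
  proof -
    have "emeasure ?N D = (\<integral>\<^sup>+ l. ennreal (?w l) * indicator (a -` D) l \<partial>count_space UNIV)"
      using D by (subst emeasure_distr) (auto simp: emeasure_density)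
    also have "\<dots> = (\<integral>\<^sup>+ l. ennreal (if a l \<in> D then ?w l else 0) \<partial>count_space UNIV)"
      by (intro nn_integral_cong) (auto simp: indicator_def)
    also have "\<dots> = ennreal (\<integral>l. (if a l \<in> D then ?w l else 0) \<partial>count_space UNIV)"
      using diag_spectral_norm[OF D, of x]
      by (intro nn_integral_eq_integral integrable_count_space) (auto simp: has_sum_iff)
    also have "\<dots> = ennreal ((norm (app (diag_spectral D) x))\<^sup>2)"
      using diag_spectral_norm[OF D, of x] by (subst integral_count_space) (auto simp: has_sum_iff)
    finally show ?thesis .
  qed
  have "scalar_measure diag_spectral x = measure_of (space ?N) (sets ?N) (emeasure ?N)"
    unfolding space_distr sets_distr space_borel
  proof (rule measure_of_eq)
    fix D assume "D \<in> sigma_sets UNIV (sets (borel :: real measure))"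
    then have "D \<in> sets borel" using sets.sigma_sets_eq[of "borel :: real measure"] by simp
    then show "ennreal ((norm (app (diag_spectral D) x))\<^sup>2) = emeasure ?N D" by (simp add: N)
  qed simp
  then show ?thesis by (simp only: measure_of_of_measure)
qed

text \<open>A finite index set \<open>L\<close> carries all of the squared norm of \<open>x\<close>
  but \<open>e\<^sup>2 / 2\<close>. Once the first \<open>N\<close> sets have caught every
  eigenvalue with index in \<open>L\<close> that is caught at all, the error has no coordinates in
  \<open>L\<close>.\<close>

lemma diag_spectral_sums:
  assumes F: "range F \<subseteq> sets borel" "disjoint_family F"
  shows "(\<lambda>n. app (diag_spectral (F n)) x) sums app (diag_spectral (\<Union>n. F n)) x"
  unfolding sums_def
proof (rule metric_LIMSEQ_I)
  fix e :: real assume e: "e > 0"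
  let ?w = "\<lambda>l. (cmod (cinner x (h l)))\<^sup>2"
  have Fb: "F n \<in> sets borel" for n using F by auto
  obtain L where L: "finite L" "dist (sum ?w L) ((norm x)\<^sup>2) \<le> e\<^sup>2 / 2"
    using has_sum_finite_approximation[OF ONB_norm[OF h], of "e\<^sup>2/2" x] e by auto
  have tail: "(?w has_sum ((norm x)\<^sup>2 - sum ?w L)) (UNIV - L)"
    by (rule has_sum_Diff[OF ONB_norm[OF h]]) (use L in auto)
  have "\<exists>N. \<forall>l\<in>L. (\<exists>n. a l \<in> F n) \<longrightarrow> (\<exists>n<N. a l \<in> F n)"
  proof -
    define g where "g l = (SOME n. a l \<in> F n)" for l
    have g: "a l \<in> F (g l)" if "\<exists>n. a l \<in> F n" for l
      unfolding g_def using that by (rule someI_ex)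
    have "g l < Suc (Max (g ` L))" if "l \<in> L" for l
      using L(1) that by (simp add: less_Suc_eq_le)
    then show ?thesis using g by blast
  qed
  then obtain N where N: "\<And>l. l \<in> L \<Longrightarrow> (\<exists>n. a l \<in> F n) \<Longrightarrow> (\<exists>n<N. a l \<in> F n)" by blast
  show "\<exists>N. \<forall>n\<ge>N. dist (\<Sum>i<n. app (diag_spectral (F i)) x) (app (diag_spectral (\<Union>n. F n)) x) < e"
  proof (intro exI allI impI)
    fix n assume n: "n \<ge> N"
    let ?d = "app (diag_spectral (\<Union>n. F n)) x - (\<Sum>i<n. app (diag_spectral (F i)) x)"
    have U: "(\<Union>n. F n) \<in> sets borel" using Fb by auto
    have sumF: "(\<Sum>i<n. if a l \<in> F i then c else 0) = (if \<exists>i<n. a l \<in> F i then c else 0)" for l and c :: complex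
    proof (cases "\<exists>i<n. a l \<in> F i")
      case True
      then obtain j where j: "j < n" "a l \<in> F j" by blast
      then have "a l \<in> F i \<longleftrightarrow> i = j" for i using F(2) unfolding disjoint_family_on_def by blast
      then show ?thesis using j by auto
    qed (auto intro!: sum.neutral)
    have d: "cinner ?d (h l) = (if (\<exists>i. a l \<in> F i) \<and> \<not> (\<exists>i<n. a l \<in> F i) then cinner x (h l) else 0)" for l
      using U Fb by (auto simp: cinner_diff_left cinner_sum_left diag_spectral_cinner sumF)
    have zero: "cinner ?d (h l) = 0" if "l \<in> L" for l
      unfolding d using N[OF that] n by (meson less_le_trans)
    have "(norm ?d)\<^sup>2 \<le> (norm x)\<^sup>2 - sum ?w L"
    proof (rule has_sum_mono_neutral[OF ONB_norm[OF h] tail])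
      show "(cmod (cinner ?d (h l)))\<^sup>2 \<le> ?w l" for l unfolding d by simp
      show "(cmod (cinner ?d (h l)))\<^sup>2 \<le> 0" if "l \<in> UNIV - (UNIV - L)" for l
        using that zero[of l] by (metis Diff_iff UNIV_I norm_zero order_refl zero_power2)
    qed simp
    also have "\<dots> < e\<^sup>2" using L(2) e by (simp add: dist_real_def)
        (smt (verit) zero_less_power)
    finally show "dist (\<Sum>i<n. app (diag_spectral (F i)) x) (app (diag_spectral (\<Union>n. F n)) x) < e"
      using e by (subst dist_commute) (simp add: dist_norm power2_less_imp_less)
  qed
qed

lemma spectral_measure_diag: "spectral_measure A diag_spectral"
  unfolding spectral_measure_def Let_def
proof (intro conjI allI ballI impI)
  show "projection (diag_spectral D)" for D
    unfolding projection_def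
    by (intro conjI ONB_bop_eqI[OF h])
      (simp_all add: app_times diag_spectral_app diagonal_adj[OF h diag_spectral_app'] scaleC_one scaleC_0_left)
  show "diag_spectral D = 0" if "D \<notin> sets borel" for D
    by (rule ONB_bop_eqI[OF h]) (use that in \<open>simp add: diag_spectral_app\<close>)
  show "diag_spectral UNIV = 1"
    by (rule ONB_bop_eqI[OF h]) (simp add: diag_spectral_app)
  show "(\<lambda>n. app (diag_spectral (F n)) x) sums app (diag_spectral (\<Union>n. F n)) x"
    if "range F \<subseteq> sets borel \<and> disjoint_family F" for F x
    using that diag_spectral_sums by blast
  fix x
  let ?w = "\<lambda>l. (cmod (cinner x (h l)))\<^sup>2"
  have sw: "(\<lambda>l. ?w l * a l) summable_on UNIV"
  proof -
    have "(\<lambda>l. norm (?w l * a l)) summable_on UNIV"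
    proof (rule summable_on_comparison_test)
      show "(\<lambda>l. ?w l * onorm (app A)) summable_on UNIV"
        using ONB_norm[OF h, of x] by (intro summable_on_cmult_left) (simp add: has_sum_iff)
      show "norm (?w l * a l) \<le> ?w l * onorm (app A)" for l
        unfolding norm_mult using a_bounded by (simp add: mult_left_mono)
    qed simp
    then show ?thesis by (rule abs_summable_summable)
  qed
  show "integrable (scalar_measure diag_spectral x) (\<lambda>t. t)"
    unfolding scalar_diag
    by (subst integrable_distr_eq) (auto simp: integrable_density integrable_count_space[OF sw])
  have "(\<integral>t. t \<partial>scalar_measure diag_spectral x) = (\<Sum>\<^sub>\<infinity>l. ?w l * a l)"
    unfolding scalar_diag
    by (subst integral_distr) (auto simp: integral_density integral_count_space[OF sw])
  moreover have H: "((\<lambda>l. complex_of_real (?w l * a l)) has_sum cinner (app A x) x) UNIV"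
  proof -
    have "cinner (app A x) (h l) * cnj (cinner x (h l)) = complex_of_real (?w l * a l)" for l
      by (simp add: diagonal_cinner[OF h Ah] complex_norm_square[symmetric] mult.assoc mult.commute)
    then show ?thesis using ONB_parseval[OF h, of "app A x" x] by simp
  qed
  moreover have "((\<lambda>l. complex_of_real (?w l * a l)) has_sum complex_of_real (\<Sum>\<^sub>\<infinity>l. ?w l * a l)) UNIV"
    using sw by (simp only: has_sum_of_real_iff has_sum_infsum)
  from has_sum_unique[OF H this]
  have "cinner (app A x) x = complex_of_real (\<Sum>\<^sub>\<infinity>l. ?w l * a l)" .
  ultimately show "cinner (app A x) x = complex_of_real (\<integral>t. t \<partial>scalar_measure diag_spectral x)"
    by simp
qed

end

section \<open>Uniqueness of the spectral measure: an arbitrary one evaluated on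
  eigenvectors\<close>

locale spectral =
  fixes A :: "'h::chilbert_space bop" and E :: "real set \<Rightarrow> 'h bop"
  assumes E: "spectral_measure A E" and selfadj: "adj A = A"
begin

lemma E_proj: "projection (E D)"
proof (cases "D \<in> sets borel")
  case False
  then have "E D = 0" using E by (simp add: spectral_measure_def)
  then show ?thesis by (auto intro!: projectionI bop_eqI simp: app_times)
qed (use E in \<open>simp add: spectral_measure_def\<close>)

lemma E_UNIV: "E UNIV = 1"
  using E by (simp add: spectral_measure_def)

lemma E_sums:
  "range F \<subseteq> sets borel \<Longrightarrow> disjoint_family F \<Longrightarrow> (\<lambda>n. app (E (F n)) x) sums app (E (\<Union>n. F n)) x"
  using E unfolding spectral_measure_def by blast

lemma E_empty: "app (E {}) x = 0"
proof -
  have "(\<lambda>n::nat. app (E {}) x) sums app (E (\<Union>n::nat. {})) x"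
    by (rule E_sums) (auto simp: disjoint_family_on_def)
  then have "(\<lambda>n::nat. app (E {}) x) \<longlonglongrightarrow> 0"
    using summable_LIMSEQ_zero sums_summable by blast
  then show ?thesis by (simp add: LIMSEQ_const_iff)
qed

lemma E_Un:
  assumes "D1 \<in> sets borel" "D2 \<in> sets borel" "D1 \<inter> D2 = {}"
  shows "app (E (D1 \<union> D2)) x = app (E D1) x + app (E D2) x"
proof -
  define F where "F n = (if n = 0 then D1 else if n = 1 then D2 else {})" for n :: nat
  have "(\<lambda>n. app (E (F n)) x) sums app (E (\<Union>n. F n)) x"
    by (rule E_sums) (use assms in \<open>auto simp: disjoint_family_on_def F_def\<close>)
  moreover have "(\<lambda>n. app (E (F n)) x) sums (\<Sum>n\<in>{0,1}. app (E (F n)) x)"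
    by (rule sums_finite) (auto simp: F_def E_empty)
  moreover have "(\<Union>n. F n) = D1 \<union> D2"
    by (auto simp: F_def split: if_splits)
  ultimately show ?thesis by (auto simp: F_def dest: sums_unique2)
qed

text \<open>For \<open>y\<close> in the range of \<open>E D2\<close> additivity reads
  \<open>|E (D1 Un D2) y|^2 = |E D1 y|^2 + |y|^2\<close>, and a projection does not increase
  norms.\<close>

lemma E_disjoint:
  assumes "D1 \<in> sets borel" "D2 \<in> sets borel" "D1 \<inter> D2 = {}"
  shows "app (E D1) (app (E D2) x) = 0"
proof -
  define y where "y = app (E D2) x"
  have y: "app (E D2) y = y" unfolding y_def by (rule projection_norm(3)[OF E_proj])
  have "cinner (app (E (D1 \<union> D2)) y) y = cinner (app (E D1) y) y + cinner (app (E D2) y) y"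
    by (simp add: E_Un[OF assms] cinner_add_left)
  then have "complex_of_real ((norm (app (E (D1 \<union> D2)) y))\<^sup>2) =
      complex_of_real ((norm (app (E D1) y))\<^sup>2 + (norm (app (E D2) y))\<^sup>2)"
    by (simp only: projection_norm(1)[OF E_proj] of_real_add)
  then have "(norm (app (E (D1 \<union> D2)) y))\<^sup>2 = (norm (app (E D1) y))\<^sup>2 + (norm y)\<^sup>2"
    unfolding of_real_eq_iff y .
  moreover have "(norm (app (E (D1 \<union> D2)) y))\<^sup>2 \<le> (norm y)\<^sup>2"
    by (intro power_mono projection_norm(2)[OF E_proj]) simp
  ultimately show ?thesis by (simp add: y_def)
qed

lemma E_Int:
  assumes "S \<in> sets borel" "D \<in> sets borel"
  shows "app (E S) (app (E D) x) = app (E (S \<inter> D)) x"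
proof -
  have b: "S \<inter> D \<in> sets borel" "S - D \<in> sets borel" "D - S \<in> sets borel" using assms by auto
  have 1: "app (E S) y = app (E (S \<inter> D)) y + app (E (S - D)) y" for y
    using E_Un[OF b(1,2)] by (metis Diff_disjoint Int_Diff_Un inf_commute inf_left_commute inf_bot_right)
  have 2: "app (E (S - D)) (app (E D) x) = 0"
    by (rule E_disjoint) (use assms b in auto)
  have 3: "app (E D) x = app (E (S \<inter> D)) x + app (E (D - S)) x"
    using E_Un[OF b(1,3), of x] by (metis Diff_disjoint Int_Diff_Un inf_commute inf_left_commute inf_bot_right)
  have "app (E (S \<inter> D)) (app (E (D - S)) x) = 0"
    by (rule E_disjoint[OF b(1,3)]) auto
  then have "app (E (S \<inter> D)) (app (E D) x) = app (E (S \<inter> D)) x"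
    by (simp only: 3 app_add projection_norm(3)[OF E_proj]) simp
  then show ?thesis by (simp add: 1[of "app (E D) x"] 2)
qed

text \<open>\<open>measure_of\<close> takes the prescribed values only once countable additivity is
  known. Squared norms inherit it from the vector-valued sums because they equal the quadratic form
  of a projection.\<close>

lemma scalar_emeasure:
  assumes D: "D \<in> sets borel"
  shows "emeasure (scalar_measure E x) D = ennreal ((norm (app (E D) x))\<^sup>2)"
proof (rule emeasure_measure_of_sigma[OF _ _ _ D])
  show "sigma_algebra UNIV (sets (borel :: real measure))"
    using sets.sigma_algebra_axioms[of "borel :: real measure"] by simp
  show "positive (sets borel) (\<lambda>D. ennreal ((norm (app (E D) x))\<^sup>2))"
    by (simp add: positive_def E_empty)
  show "countably_additive (sets borel) (\<lambda>D. ennreal ((norm (app (E D) x))\<^sup>2))"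
    unfolding countably_additive_def
  proof (intro allI impI)
    fix F :: "nat \<Rightarrow> real set" assume F: "range F \<subseteq> sets borel" "disjoint_family F"
    have "(\<lambda>n. cinner (app (E (F n)) x) x) sums cinner (app (E (\<Union>n. F n)) x) x"
      by (rule bounded_linear.sums[OF bounded_linear_cinner_left E_sums[OF F]])
    then have "(\<lambda>n. (norm (app (E (F n)) x))\<^sup>2) sums (norm (app (E (\<Union>n. F n)) x))\<^sup>2"
      unfolding projection_norm(1)[OF E_proj] by (simp only: sums_of_real_iff)
    then show "(\<Sum>n. ennreal ((norm (app (E (F n)) x))\<^sup>2)) = ennreal ((norm (app (E (\<Union> (range F))) x))\<^sup>2)"
      by (simp add: suminf_ennreal2 sums_summable sums_unique[symmetric])
  qed
qed

lemma sets_scalar: "sets (scalar_measure E x) = sets borel" "space (scalar_measure E x) = UNIV"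
  using sets.sigma_sets_eq[of "borel :: real measure"]
  by (simp_all add: sets_measure_of_conv space_measure_of_conv)

lemma scalar_integral:
  "integrable (scalar_measure E x) (\<lambda>t. t)"
  "cinner (app A x) x = complex_of_real (\<integral>t. t \<partial>scalar_measure E x)"
  using E unfolding spectral_measure_def Let_def by blast+

lemma scalar_restrict:
  assumes D: "D \<in> sets borel"
  shows "scalar_measure E (app (E D) x) = density (scalar_measure E x) (indicator D)"
proof (rule measure_eqI)
  show "sets (scalar_measure E (app (E D) x)) = sets (density (scalar_measure E x) (indicator D))"
    by (simp only: sets_density sets_scalar)
  fix S assume "S \<in> sets (scalar_measure E (app (E D) x))"
  then have S: "S \<in> sets borel" unfolding sets_scalar .
  have "(\<lambda>t. indicator D t * indicator S t) = (indicator (S \<inter> D) :: real \<Rightarrow> ennreal)"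
    by (auto simp: indicator_def)
  then have "emeasure (density (scalar_measure E x) (indicator D)) S = emeasure (scalar_measure E x) (S \<inter> D)"
    using S D by (subst emeasure_density) (auto simp: sets_scalar cong: measurable_cong_sets)
  then show "emeasure (scalar_measure E (app (E D) x)) S = emeasure (density (scalar_measure E x) (indicator D)) S"
    using S D by (simp add: scalar_emeasure E_Int)
qed

text \<open>It is not yet known that \<open>A\<close> commutes with \<open>E D\<close>, since the
  integral represents \<open>A\<close> only through its quadratic form. Splitting the integral over
  \<open>D\<close> and its complement shows that the two cross terms cancel; being conjugate to each
  other, they have real part zero, which is all that is used below.\<close>

lemma scalar_split:
  assumes D: "D \<in> sets borel"
  shows "Re (cinner (app A (app (E D) x)) (app (E (- D)) x)) = 0"
proof -
  define u w where "u = app (E D) x" and "w = app (E (- D)) x"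
  have D': "- D \<in> sets borel" using D by (metis Compl_in_sets_lebesgue borel_comp)
  have "x = u + w"
    using E_Un[OF D D', of x] by (simp add: u_def w_def E_UNIV)
  have meas: "(indicator S :: real \<Rightarrow> real) \<in> borel_measurable (scalar_measure E x)"
    if "S \<in> sets borel" for S
    using that by (auto simp: sets_scalar cong: measurable_cong_sets)
  have i: "(\<integral>t. t \<partial>scalar_measure E (app (E S) x)) = (\<integral>t. indicator S t * t \<partial>scalar_measure E x)"
    "integrable (scalar_measure E x) (\<lambda>t. indicator S t * t)" if S: "S \<in> sets borel" for S
  proof -
    have id: "(\<lambda>t. t) \<in> borel_measurable (scalar_measure E x)"
      by (simp add: sets_scalar cong: measurable_cong_sets)
    have e: "(indicator S :: real \<Rightarrow> ennreal) = (\<lambda>t. ennreal (indicator S t))"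
      by (auto simp: indicator_def)
    show "(\<integral>t. t \<partial>scalar_measure E (app (E S) x)) = (\<integral>t. indicator S t * t \<partial>scalar_measure E x)"
      unfolding scalar_restrict[OF S] e using integral_density[OF id meas[OF S]] by simp
    show "integrable (scalar_measure E x) (\<lambda>t. indicator S t * t)"
      using integrable_real_mult_indicator[OF _ scalar_integral(1), of S] S
      by (simp add: sets_scalar mult.commute)
  qed
  have "(\<integral>t. t \<partial>scalar_measure E x) = (\<integral>t. indicator D t * t + indicator (- D) t * t \<partial>scalar_measure E x)"
    by (intro Bochner_Integration.integral_cong) (auto simp: indicator_def)
  also have "\<dots> = (\<integral>t. t \<partial>scalar_measure E u) + (\<integral>t. t \<partial>scalar_measure E w)"
    unfolding u_def w_def i(1)[OF D] i(1)[OF D']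
    by (rule Bochner_Integration.integral_add[OF i(2)[OF D] i(2)[OF D']])
  finally have "cinner (app A x) x = cinner (app A u) u + cinner (app A w) w"
    by (simp add: scalar_integral(2))
  then have "cinner (app A u) w + cinner (app A w) u = 0"
    by (simp add: \<open>x = u + w\<close> app_add cinner_simps add.commute)
  moreover have "cinner (app A w) u = cnj (cinner (app A u) w)"
    by (metis cinner_adj cinner_commute selfadj)
  ultimately have "Re (cinner (app A u) w) + Re (cnj (cinner (app A u) w)) = 0"
    by (metis plus_complex.simps(1) zero_complex.simps(1))
  then show ?thesis by (simp add: u_def w_def)
qed

text \<open>For \<open>u = E D x\<close> the vanishing cross term gives that the integral of
  \<open>t - c\<close> against the scalar measure of \<open>u\<close> is zero. This measure lives on
  \<open>D\<close>, where \<open>t - c\<close> has one strict sign, so the measure is zero and with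
  it \<open>u\<close>.\<close>

lemma eigen_split:
  assumes x: "app A x = complex_of_real c *\<^sub>C x" and D: "D \<in> sets borel"
    and pos: "(\<forall>t\<in>D. c < t) \<or> (\<forall>t\<in>D. t < c)"
  shows "app (E D) x = 0"
proof -
  define u w where "u = app (E D) x" and "w = app (E (- D)) x"
  have D': "- D \<in> sets borel" using D by (metis borel_comp)
  have xuw: "x = u + w"
    using E_Un[OF D D', of x] by (simp add: u_def w_def E_UNIV)
  have Eu: "app (E D) u = u" unfolding u_def by (rule projection_norm(3)[OF E_proj])
  let ?M = "scalar_measure E u"
  have E'u: "app (E (- D)) u = 0" unfolding u_def by (rule E_disjoint) (use D D' in auto)
  have "cinner (app A x) u = complex_of_real (c * (norm u)\<^sup>2)"
  proof -
    have "cinner x u = cinner (app (E D) x) u"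
      using Eu E_proj by (metis cinner_adj projection_def)
    then show ?thesis by (simp add: x cinner_scaleC_left cinner_same flip: u_def)
  qed
  moreover have "Re (cinner (app A x) u) = Re (cinner (app A u) u)"
  proof -
    have "cinner (app A w) u = cnj (cinner (app A u) w)"
      by (metis cinner_adj cinner_commute selfadj)
    then show ?thesis
      using scalar_split[OF D, of x, folded u_def w_def] by (simp add: xuw app_add cinner_add_left)
  qed
  ultimately have eq: "(\<integral>t. t \<partial>?M) = c * (norm u)\<^sup>2"
    by (simp add: scalar_integral(2))
  have tot: "emeasure ?M UNIV = ennreal ((norm u)\<^sup>2)"
    by (subst scalar_emeasure) (simp_all add: E_UNIV)
  interpret finite_measure ?M
    by (rule finite_measureI) (simp add: sets_scalar tot)
  have int0: "(\<integral>t. t - c \<partial>?M) = 0"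
    using scalar_integral(1)[of u] eq tot
    by (subst Bochner_Integration.integral_diff) (simp_all add: sets_scalar measure_def)
  have int: "integrable ?M (\<lambda>t. t - c)" using scalar_integral(1)[of u] by simp
  have "emeasure ?M (- D) = 0" using D' by (simp add: scalar_emeasure E'u)
  then have AE: "AE t in ?M. t \<in> D"
    using D' by (intro AE_I[of _ _ "- D"]) (auto simp: sets_scalar)
  have "AE t in ?M. t - c = 0"
  proof (cases "\<forall>t\<in>D. c < t")
    case True
    have "AE t in ?M. 0 \<le> t - c" using AE by eventually_elim (use True in auto)
    from integral_nonneg_eq_0_iff_AE[OF int this] int0 show ?thesis by simp
  next
    case False
    then have *: "\<forall>t\<in>D. t < c" using pos by blast
    have "AE t in ?M. 0 \<le> - (t - c)" using AE by eventually_elim (use * in auto)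
    note iff = integral_nonneg_eq_0_iff_AE[OF Bochner_Integration.integrable_minus[OF int] this]
    have "(\<integral>t. - (t - c) \<partial>?M) = 0"
      unfolding Bochner_Integration.integral_minus int0 by simp
    then have "AE t in ?M. - (t - c) = 0" by (simp only: iff)
    then show ?thesis by eventually_elim simp
  qed
  with AE have "AE t in ?M. False" by eventually_elim (use pos in auto)
  then have "emeasure ?M UNIV = 0"
    by (subst (asm) AE_iff_measurable[of UNIV]) (simp_all add: sets_scalar)
  then show ?thesis unfolding tot by (simp add: u_def)
qed

text \<open>Both open half-lines at \<open>c\<close> are removed by \<open>eigen_split\<close>, so
  all of \<open>x\<close> lies in the range of \<open>E {c}\<close>.\<close>

lemma eigen_app:
  assumes x: "app A x = complex_of_real c *\<^sub>C x" and D: "D \<in> sets borel"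
  shows "app (E D) x = (if c \<in> D then x else 0)"
proof -
  have "x = app (E ({c} \<union> ({c<..} \<union> {..<c}))) x"
  proof -
    have "{c} \<union> ({c<..} \<union> {..<c}) = UNIV" by auto
    then show ?thesis by (simp only: E_UNIV app_one)
  qed
  also have "\<dots> = app (E {c}) x"
    by (subst E_Un, simp, simp, force, subst E_Un)
      (auto simp: eigen_split[OF x])
  finally have c: "app (E {c}) x = x" by simp
  then have "app (E D) x = app (E (D \<inter> {c})) x" using E_Int[OF D, of "{c}" x] by simp
  then show ?thesis using c by (auto simp: E_empty)
qed

end

lemma (in diagonal) spectral_projection_app:
  assumes "D \<in> sets borel"
  shows "app (spectral_projection A D) (h l) = (if a l \<in> D then h l else 0)"
proof -
  have "spectral_projection A = diag_spectral"
    unfolding spectral_projection_def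
  proof (rule the_equality)
    fix E assume E: "spectral_measure A E"
    interpret spectral A E by unfold_locales (rule E, rule adj_A)
    show "E = diag_spectral"
    proof
      fix S show "E S = diag_spectral S"
      proof (rule ONB_bop_eqI[OF h])
        fix l show "app (E S) (h l) = app (diag_spectral S) (h l)"
        proof (cases "S \<in> sets borel")
          case True
          then show ?thesis by (simp add: eigen_app[OF Ah] diag_spectral_app)
        next
          case False
          then have "E S = 0" using E by (simp add: spectral_measure_def)
          then show ?thesis using False by (simp add: diag_spectral_app)
        qed
      qed
    qed
  qed (rule spectral_measure_diag)
  then show ?thesis using assms by (simp add: diag_spectral_app)
qed

subsection \<open>Weighted composition operators\<close>

lemma coeff_ket: "coeff (ket i) j = (if i = j then 1 else 0)"
  by (simp add: ket.rep_eq)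

lemma ell2_eqI: "(\<And>i. coeff x i = coeff y i) \<Longrightarrow> x = y"
  by (metis coeff_inject ext)

lemma coeff_simps [simp]:
  "coeff (x + y) i = coeff x i + coeff y i" "coeff (x - y) i = coeff x i - coeff y i"
  "coeff (c *\<^sub>C x) i = c * coeff x i" "coeff 0 i = 0" "coeff (- x) i = - coeff x i"
  by (simp_all add: plus_ell2.rep_eq minus_ell2.rep_eq scaleC_ell2.rep_eq zero_ell2.rep_eq
      uminus_ell2.rep_eq)

lemma coeff_sum: "coeff (sum f S) i = (\<Sum>k\<in>S. coeff (f k) i)"
  by (induct S rule: infinite_finite_induct) simp_all

lemma cinner_ket: "cinner x (ket i) = coeff x i"
proof -
  have "cinner x (ket i) = (\<Sum>\<^sub>\<infinity>j. coeff x j * cnj (coeff (ket i) j))"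
    by (simp add: cinner_ell2_def ell2_form.rep_eq)
  also have "\<dots> = (\<Sum>\<^sub>\<infinity>j\<in>{i}. coeff x j)"
    by (rule infsum_cong_neutral) (auto simp: coeff_ket)
  finally show ?thesis by simp
qed

lemma cinner_ell2: "cinner x y = (\<Sum>\<^sub>\<infinity>i. coeff x i * cnj (coeff y i))"
  by (simp add: cinner_ell2_def ell2_form.rep_eq)

lemma ell2_norm_has_sum: "((\<lambda>i. (cmod (coeff x i))\<^sup>2) has_sum (norm x)\<^sup>2) UNIV"
  unfolding norm_ell2_sq using coeff[of x] by (simp add: has_sum_infsum)

lemma ell2_norm_le:
  assumes "\<And>F. finite F \<Longrightarrow> (\<Sum>i\<in>F. (cmod (coeff x i))\<^sup>2) \<le> K\<^sup>2" "0 \<le> K"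
  shows "norm x \<le> K"
proof -
  have "(norm x)\<^sup>2 \<le> K\<^sup>2"
    by (rule has_sum_le_finite_sums[OF ell2_norm_has_sum]) (rule assms(1))
  then show ?thesis using assms(2) by (rule power2_le_imp_le)
qed

text \<open>Common source of two approximation arguments: density of the span of the kets, and
  convergence of the sum that defines the flip.\<close>

lemma ell2_tail:
  assumes "e > 0"
  shows "\<exists>S. finite S \<and> (\<forall>y. (\<forall>i. cmod (coeff y i) \<le> (if i \<in> S then 0 else cmod (coeff x i))) \<longrightarrow> norm y < e)"
proof -
  let ?w = "\<lambda>i. (cmod (coeff x i))\<^sup>2"
  obtain S where S: "finite S" "dist (sum ?w S) ((norm x)\<^sup>2) \<le> e\<^sup>2 / 2"
    using has_sum_finite_approximation[OF ell2_norm_has_sum, of "e\<^sup>2/2" x] assms by auto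
  have tail: "(?w has_sum ((norm x)\<^sup>2 - sum ?w S)) (UNIV - S)"
    by (rule has_sum_Diff[OF ell2_norm_has_sum]) (use S in auto)
  have "norm y < e" if y: "\<And>i. cmod (coeff y i) \<le> (if i \<in> S then 0 else cmod (coeff x i))" for y
  proof -
    have "(norm y)\<^sup>2 \<le> (norm x)\<^sup>2 - sum ?w S"
    proof (rule has_sum_mono_neutral[OF ell2_norm_has_sum tail])
      show "(cmod (coeff y i))\<^sup>2 \<le> ?w i" if "i \<in> UNIV \<inter> (UNIV - S)" for i
        using y[of i] that by (intro power_mono) auto
      show "(cmod (coeff y i))\<^sup>2 \<le> 0" if "i \<in> UNIV - (UNIV - S)" for i
        using y[of i] that by simp
    qed simp
    also have "\<dots> \<le> e\<^sup>2 / 2" using S(2) unfolding dist_real_def by linarith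
    also have "\<dots> < e\<^sup>2" using assms by simp
    finally show ?thesis using assms by (simp add: power2_less_imp_less)
  qed
  then show ?thesis using S(1) by blast
qed

lemma ONB_ket: "ONB (ket :: 'i \<Rightarrow> 'i ell2)"
  unfolding ONB_def
proof
  show inj: "inj (ket :: 'i \<Rightarrow> 'i ell2)"
    by (rule injI) (metis coeff_ket zero_neq_one)
  show "orthonormal_basis (range (ket :: 'i \<Rightarrow> 'i ell2))" unfolding orthonormal_basis_def
  proof (intro conjI ballI)
    fix x y :: "'i ell2" assume x: "x \<in> range ket" and y: "y \<in> range ket"
    have "cinner (ket i) (ket j) = (if ket i = ket j then 1 else 0)" for i j :: 'i
      using inj by (simp add: cinner_ket coeff_ket inj_eq)
    then show "cinner x y = (if x = y then 1 else 0)" using x y by blast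
  next
    have "x \<in> closure (cspan (range ket))" for x :: "'i ell2"
      unfolding closure_approachable
    proof (intro allI impI)
      fix e :: real assume "e > 0"
      then obtain S where S: "finite S"
        "\<And>y. (\<And>i. cmod (coeff y i) \<le> (if i \<in> S then 0 else cmod (coeff x i))) \<Longrightarrow> norm y < e"
        using ell2_tail[of e x] by blast
      define z where "z = (\<Sum>i\<in>S. coeff x i *\<^sub>C ket i)"
      have cz: "coeff z i = (if i \<in> S then coeff x i else 0)" for i
      proof -
        have "coeff z i = (\<Sum>j\<in>S. if j = i then coeff x j else 0)"
          unfolding z_def coeff_sum by (intro sum.cong) (auto simp: coeff_ket)
        then show ?thesis using S(1) by simp
      qed
      have "norm (x - z) < e" by (rule S(2)) (simp add: cz)
      moreover have "z \<in> cspan (range ket)"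
        unfolding z_def cspan_def
        by (intro module.span_sum[OF module_scaleC] module.span_scale[OF module_scaleC]
            module.span_base[OF module_scaleC]) auto
      ultimately show "\<exists>y\<in>cspan (range ket). dist y x < e"
        by (auto simp: dist_norm norm_minus_commute)
    qed
    then show "closure (cspan (range ket)) = (UNIV :: 'i ell2 set)" by blast
  qed
qed

lemma ell2_bop_eqI: "(\<And>j. app a (ket j) = app b (ket j)) \<Longrightarrow> a = b"
  by (rule ONB_bop_eqI[OF ONB_ket])

text \<open>Sufficient for the weighted composition operator to be a contraction. Injectivity is
  asked only where the weight is nonzero, since maps that overwrite a coordinate or a tail are
  injective only on the indices they do not annihilate.\<close>

definition weight_ok :: "('i \<Rightarrow> complex) \<Rightarrow> ('i \<Rightarrow> 'i) \<Rightarrow> bool" where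
  "weight_ok c g \<longleftrightarrow> (\<forall>i. cmod (c i) \<le> 1) \<and> inj_on g {i. c i \<noteq> 0}"

definition wcomp :: "('i \<Rightarrow> complex) \<Rightarrow> ('i \<Rightarrow> 'i) \<Rightarrow> 'i ell2 bop" where
  "wcomp c g = Abs_bop (\<lambda>x. Abs_ell2 (\<lambda>i. c i * coeff x (g i)))"

lemma coeff_wcomp:
  assumes "weight_ok c g"
  shows "coeff (app (wcomp c g) x) i = c i * coeff x (g i)"
proof -
  define f where "f = (\<lambda>x. Abs_ell2 (\<lambda>i. c i * coeff x (g i)))"
  have le: "(\<Sum>i\<in>F. (cmod (c i * coeff x (g i)))\<^sup>2) \<le> (norm x)\<^sup>2" if F: "finite F" for x F
  proof -
    let ?G = "{i\<in>F. c i \<noteq> 0}"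
    have inj: "inj_on g ?G" using assms unfolding weight_ok_def inj_on_def by blast
    have "(\<Sum>i\<in>F. (cmod (c i * coeff x (g i)))\<^sup>2) = (\<Sum>i\<in>?G. (cmod (c i * coeff x (g i)))\<^sup>2)"
      by (rule sum.mono_neutral_right) (use F in auto)
    also have "\<dots> \<le> (\<Sum>i\<in>?G. (cmod (coeff x (g i)))\<^sup>2)"
    proof (rule sum_mono)
      fix i
      have "cmod (c i) * cmod (coeff x (g i)) \<le> 1 * cmod (coeff x (g i))"
        using assms unfolding weight_ok_def by (intro mult_right_mono) auto
      then show "(cmod (c i * coeff x (g i)))\<^sup>2 \<le> (cmod (coeff x (g i)))\<^sup>2"
        by (intro power_mono) (simp_all add: norm_mult)
    qed
    also have "\<dots> = (\<Sum>i\<in>g ` ?G. (cmod (coeff x i))\<^sup>2)"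
      by (simp add: sum.reindex[OF inj])
    also have "\<dots> \<le> (norm x)\<^sup>2" by (rule sum_le_norm_ell2) (use F in auto)
    finally show ?thesis .
  qed
  have c: "coeff (f x) i = c i * coeff x (g i)" for x i
  proof -
    have "(\<lambda>i. (cmod (c i * coeff x (g i)))\<^sup>2) summable_on UNIV"
      by (rule nonneg_bdd_above_summable_on) (auto intro!: bdd_aboveI[of _ "(norm x)\<^sup>2"] le)
    then show ?thesis by (simp add: f_def Abs_ell2_inverse)
  qed
  have "bounded_linear f"
  proof (rule bounded_linear_intro[where K = 1])
    show "norm (f x) \<le> norm x * 1" for x
      by (rule ell2_norm_le) (simp_all add: c le)
  qed (auto intro!: ell2_eqI simp: c scaleR_scaleC algebra_simps)
  then have "app (wcomp c g) x = f x"
    unfolding wcomp_def f_def[symmetric] by (rule app_Abs_bop) (auto intro!: ell2_eqI simp: c)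
  then show ?thesis by (simp add: c)
qed

lemma bop_eq_coeffI: "(\<And>x i. coeff (app a x) i = coeff (app b x) i) \<Longrightarrow> a = b"
  by (intro bop_eqI ell2_eqI)

subsection \<open>Operators on the tensor factors\<close>

lemma site_eqI:
  assumes "\<And>i j. coeff (app b (ket j)) i =
    (if \<forall>l. l \<noteq> k \<longrightarrow> i l = j l then cinner (app a (h (j k))) (h (i k)) else 0)"
  shows "site h k a = b"
  unfolding site_def
proof (rule the_equality)
  fix c assume "\<forall>i j. cinner (app c (ket j)) (ket i) =
    (if \<forall>l. l \<noteq> k \<longrightarrow> i l = j l then cinner (app a (h (j k))) (h (i k)) else 0)"
  then show "c = b" by (intro ell2_bop_eqI ell2_eqI) (simp only: cinner_ket assms)
qed (simp add: cinner_ket assms)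

definition diag_weight :: "('i \<Rightarrow> complex) \<Rightarrow> 'i ell2 bop" where
  "diag_weight c = wcomp c (\<lambda>i. i)"

lemma coeff_diag_weight: "(\<And>i. cmod (c i) \<le> 1) \<Longrightarrow> coeff (app (diag_weight c) x) i = c i * coeff x i"
  unfolding diag_weight_def by (subst coeff_wcomp) (auto simp: weight_ok_def)

lemma site_diag:
  assumes h: "ONB h" and a: "\<And>s. app a (h s) = d s *\<^sub>C h s" and d: "\<And>s. cmod (d s) \<le> 1"
  shows "site h k a = diag_weight (\<lambda>i. d (i k))"
proof (rule site_eqI)
  fix i j :: "nat \<Rightarrow> 'a"
  have "i = j \<longleftrightarrow> (\<forall>l. l \<noteq> k \<longrightarrow> i l = j l) \<and> i k = j k"
    by (auto simp: fun_eq_iff)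
  then show "coeff (app (diag_weight (\<lambda>i. d (i k))) (ket j)) i =
      (if \<forall>l. l \<noteq> k \<longrightarrow> i l = j l then cinner (app a (h (j k))) (h (i k)) else 0)"
    by (auto simp: coeff_diag_weight d coeff_ket a cinner_scaleC_left ONB_orth[OF h])
qed

text \<open>This is the matrix unit \<open>e_st\<close> acting in factor \<open>k\<close>, written
  by its effect on coefficients.\<close>

definition site_unit :: "nat \<Rightarrow> 's \<Rightarrow> 's \<Rightarrow> (nat \<Rightarrow> 's) ell2 bop" where
  "site_unit k s t = wcomp (\<lambda>i. if i k = s then 1 else 0) (\<lambda>i. i(k := t))"

lemma coeff_site_unit:
  "coeff (app (site_unit k s t) x) i = (if i k = s then coeff x (i(k := t)) else 0)"
proof -
  have "weight_ok (\<lambda>i. if i k = s then 1 else 0) (\<lambda>i. i(k := t))"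
    unfolding weight_ok_def
    by (auto simp: inj_on_def) (metis fun_upd_triv fun_upd_upd)
  then show ?thesis unfolding site_unit_def by (simp add: coeff_wcomp)
qed

lemma site_matrix_unit:
  assumes h: "ONB h"
  shows "site h k (matrix_unit h s t) = site_unit k s t"
proof (rule site_eqI)
  fix i j :: "nat \<Rightarrow> 'a"
  have "j = i(k := t) \<longleftrightarrow> (\<forall>l. l \<noteq> k \<longrightarrow> i l = j l) \<and> j k = t"
    by (auto simp: fun_eq_iff)
  then show "coeff (app (site_unit k s t) (ket j)) i =
      (if \<forall>l. l \<noteq> k \<longrightarrow> i l = j l then cinner (app (matrix_unit h s t) (h (j k))) (h (i k)) else 0)"
    by (auto simp: coeff_site_unit coeff_ket matrix_unit_app cinner_scaleC_left ONB_orth[OF h])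
qed

definition flip :: "nat \<Rightarrow> (nat \<Rightarrow> 's) ell2 bop" where
  "flip k = wcomp (\<lambda>_. 1) (\<lambda>i. i(k := i (Suc k), Suc k := i k))"

lemma coeff_flip: "coeff (app (flip k) x) i = coeff x (i(k := i (Suc k), Suc k := i k))"
proof -
  have "weight_ok (\<lambda>_. 1) (\<lambda>i :: nat \<Rightarrow> 'a. i(k := i (Suc k), Suc k := i k))"
    unfolding weight_ok_def
  proof (intro conjI inj_onI)
    fix i j :: "nat \<Rightarrow> 'a" assume e: "i(k := i (Suc k), Suc k := i k) = j(k := j (Suc k), Suc k := j k)"
    show "i = j"
    proof
      fix l show "i l = j l"
        using fun_cong[OF e, of k] fun_cong[OF e, of "Suc k"] fun_cong[OF e, of l]
        by (cases "l = k"; cases "l = Suc k") auto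
    qed
  qed simp
  then show ?thesis unfolding flip_def by (simp add: coeff_wcomp)
qed

text \<open>The summands of the flip applied to \<open>x\<close> are its restrictions to the fibres of a map.\<close>

lemma fibre_has_sum:
  fixes y :: "'i ell2" and p :: "'i \<Rightarrow> 'c"
  assumes "\<And>c i. coeff (z c) i = (if p i = c then coeff y i else 0)"
  shows "(z has_sum y) UNIV"
  unfolding has_sum_def tendsto_iff
proof (intro allI impI)
  fix e :: real assume "0 < e"
  then obtain S where S: "finite S"
    "\<And>v. (\<And>i. cmod (coeff v i) \<le> (if i \<in> S then 0 else cmod (coeff y i))) \<Longrightarrow> norm v < e"
    using ell2_tail[of e y] by blast
  show "\<forall>\<^sub>F G in finite_subsets_at_top UNIV. dist (sum z G) y < e"
    unfolding eventually_finite_subsets_at_top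
  proof (intro exI conjI allI impI)
    fix G assume G: "finite G \<and> p ` S \<subseteq> G \<and> G \<subseteq> UNIV"
    then have "coeff (sum z G) i = (if p i \<in> G then coeff y i else 0)" for i
      by (simp add: coeff_sum assms)
    then have "norm (sum z G - y) < e" using G by (intro S(2)) auto
    then show "dist (sum z G) y < e" by (simp add: dist_norm)
  qed (use S in auto)
qed

lemma flip_op_eq:
  assumes h: "ONB (h :: 's \<Rightarrow> 'h::chilbert_space)"
  shows "flip_op h k = flip k"
proof -
  have "((\<lambda>(i, j). app (site h k (matrix_unit h i j) * site h (Suc k) (matrix_unit h j i)) x)
        has_sum app (flip k) x) UNIV" for x
  proof (rule fibre_has_sum[where p = "\<lambda>i. (i k, i (Suc k))"])
    fix c :: "'s \<times> 's" and i
    show "coeff (case c of (i, j) \<Rightarrow> app (site h k (matrix_unit h i j) * site h (Suc k) (matrix_unit h j i)) x) i =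
        (if (i k, i (Suc k)) = c then coeff (app (flip k) x) i else 0)"
      by (cases c) (auto simp: site_matrix_unit[OF h] app_times coeff_site_unit coeff_flip fun_upd_twist)
  qed
  then show ?thesis
    unfolding flip_op_def
    by (intro the_equality allI bop_eqI) (auto intro: has_sum_unique)
qed

subsection \<open>The tensor algebra as a commutant\<close>

definition agree :: "nat \<Rightarrow> (nat \<Rightarrow> 's) \<Rightarrow> (nat \<Rightarrow> 's) \<Rightarrow> bool" where
  "agree n i j \<longleftrightarrow> (\<forall>l\<ge>n. i l = j l)"

definition splice :: "nat \<Rightarrow> (nat \<Rightarrow> 's) \<Rightarrow> (nat \<Rightarrow> 's) \<Rightarrow> nat \<Rightarrow> 's" where
  "splice n i t l = (if l < n then i l else t l)"

lemma agree_refl [simp]: "agree n i i"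
  by (simp add: agree_def)

lemma agree_sym: "agree n i j \<longleftrightarrow> agree n j i"
  by (auto simp: agree_def)

text \<open>Exchanging tails is a partial bijection whose inverse is the reverse exchange. Both the
  injectivity behind \<open>tail_unit\<close> and its adjoint rest on this symmetry.\<close>

lemma splice_swap_iff: "agree n i s \<and> splice n i t = j \<longleftrightarrow> agree n j t \<and> splice n j s = i"
  by (auto simp: agree_def splice_def fun_eq_iff not_less)

lemma agree_splice [simp]: "agree n (splice n j s) i \<longleftrightarrow> agree n s i" "agree n i (splice n j s) \<longleftrightarrow> agree n i s"
  by (auto simp: agree_def splice_def)

lemma restrict_splice [simp]: "restrict (splice n j s) {..<n} = restrict j {..<n}"
  by (auto simp: splice_def)

lemma splice_eq: "agree n i j \<Longrightarrow> splice n i j = i"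
  by (auto simp: agree_def splice_def fun_eq_iff)

lemma splice_restrict [simp]: "splice n (restrict i {..<n}) j = splice n i j"
  by (auto simp: splice_def)

lemma restrict_eq_splice: "restrict i {..<n} = splice n i (\<lambda>_. undefined)"
  by (auto simp: splice_def restrict_def)

text \<open>\<open>tail_unit n s t\<close> replaces the tail \<open>t\<close> (beyond the first \<open>n\<close> factors) of a basis vector
  by the tail \<open>s\<close> and annihilates basis vectors with other tails.  The operators acting on the first
  \<open>n\<close> factors are those that commute with all of these.\<close>

definition tail_unit :: "nat \<Rightarrow> (nat \<Rightarrow> 's) \<Rightarrow> (nat \<Rightarrow> 's) \<Rightarrow> (nat \<Rightarrow> 's) ell2 bop" where
  "tail_unit n s t = wcomp (\<lambda>i. if agree n i s then 1 else 0) (\<lambda>i. splice n i t)"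

lemma coeff_tail_unit:
  "coeff (app (tail_unit n s t) x) i = (if agree n i s then coeff x (splice n i t) else 0)"
proof -
  have "weight_ok (\<lambda>i. if agree n i s then 1 else 0) (\<lambda>i. splice n i t)"
    unfolding weight_ok_def
  proof (intro conjI inj_onI allI)
    fix i j
    assume "i \<in> {i. (if agree n i s then 1 else 0::complex) \<noteq> 0}"
      "j \<in> {i. (if agree n i s then 1 else 0::complex) \<noteq> 0}" "splice n i t = splice n j t"
    then show "i = j"
      using splice_swap_iff[of n i s t "splice n i t"] splice_swap_iff[of n j s t "splice n i t"]
      by (auto split: if_splits)
  qed simp
  then show ?thesis unfolding tail_unit_def by (simp add: coeff_wcomp)
qed

lemma tail_unit_ket:
  "app (tail_unit n s t) (ket j) = (if agree n j t then ket (splice n j s) else 0)"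
proof (rule ell2_eqI)
  fix i
  show "coeff (app (tail_unit n s t) (ket j)) i = coeff (if agree n j t then ket (splice n j s) else 0) i"
    using splice_swap_iff[of n i s t j] by (auto simp: coeff_tail_unit coeff_ket)
qed

lemma adj_tail_unit: "adj (tail_unit n s t) = tail_unit n t s"
proof (rule ell2_bop_eqI, rule ell2_eqI)
  fix i j
  have "coeff (app (adj (tail_unit n s t)) (ket j)) i = cnj (coeff (app (tail_unit n s t) (ket i)) j)"
    unfolding cinner_ket[symmetric] by (metis cinner_adj' cinner_commute)
  then show "coeff (app (adj (tail_unit n s t)) (ket j)) i = coeff (app (tail_unit n t s) (ket j)) i"
    using splice_swap_iff[of n i t s j] by (auto simp: coeff_tail_unit coeff_ket tail_unit_ket)
qed

text \<open>The existentially quantified \<open>M\<close> is read off from indices whose tail is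
  constantly \<open>undefined\<close>; these are exactly the values of
  \<open>restrict\<close>.\<close>

lemma tensor_algebra_entries:
  "b \<in> tensor_algebra n \<longleftrightarrow>
    (\<forall>i j. coeff (app b (ket j)) i = (if agree n i j
       then coeff (app b (ket (restrict j {..<n}))) (restrict i {..<n}) else 0))"
    (is "_ \<longleftrightarrow> ?R")
proof
  assume "b \<in> tensor_algebra n"
  then obtain M where M: "\<And>i j. coeff (app b (ket j)) i =
      (if agree n i j then M (restrict i {..<n}) (restrict j {..<n}) else 0)"
    unfolding tensor_algebra_def cinner_ket agree_def by blast
  have "agree n (restrict i {..<n}) (restrict j {..<n})" for i j :: "nat \<Rightarrow> 'a"
    by (simp add: agree_def)
  then show ?R by (simp add: M)
next
  assume R: ?R
  show "b \<in> tensor_algebra n" unfolding tensor_algebra_def cinner_ket agree_def[symmetric]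
    by (rule CollectI, rule exI[of _ "\<lambda>i j. coeff (app b (ket j)) i"]) (rule R)
qed

text \<open>As a commutant of a self-adjoint family the algebra is visibly closed under products and
  adjoints, whereas the entries of a product are infinite sums. Conversely, the unit with
  \<open>s = t = j\<close> forces entries with different tails to vanish, and moving the common tail
  to \<open>undefined\<close> shows that it has no influence.\<close>

lemma tensor_algebra_commutant:
  "b \<in> tensor_algebra n \<longleftrightarrow> (\<forall>s t. b * tail_unit n s t = tail_unit n s t * b)"
proof
  assume b: "b \<in> tensor_algebra n"
  show "\<forall>s t. b * tail_unit n s t = tail_unit n s t * b"
  proof (intro allI ell2_bop_eqI ell2_eqI)
    fix s t i j :: "nat \<Rightarrow> 'a"
    note ent = b[unfolded tensor_algebra_entries, rule_format]
    have e1: "coeff (app b (ket (splice n j s))) i =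
        (if agree n i s then coeff (app b (ket (restrict j {..<n}))) (restrict i {..<n}) else 0)"
      by (subst ent) simp
    have e2: "coeff (app b (ket j)) (splice n i t) =
        (if agree n j t then coeff (app b (ket (restrict j {..<n}))) (restrict i {..<n}) else 0)"
      by (subst ent) (simp add: agree_sym[of n j])
    show "coeff (app (b * tail_unit n s t) (ket j)) i = coeff (app (tail_unit n s t * b) (ket j)) i"
      by (simp add: app_times tail_unit_ket coeff_tail_unit e1 e2)
  qed
next
  assume c: "\<forall>s t. b * tail_unit n s t = tail_unit n s t * b"
  have e: "coeff (app b (app (tail_unit n s t) (ket j))) i =
      (if agree n i s then coeff (app b (ket j)) (splice n i t) else 0)" for s t i j
    by (metis app_times c coeff_tail_unit)
  show "b \<in> tensor_algebra n" unfolding tensor_algebra_entries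
  proof (intro allI)
    fix i j :: "nat \<Rightarrow> 'a"
    show "coeff (app b (ket j)) i = (if agree n i j
       then coeff (app b (ket (restrict j {..<n}))) (restrict i {..<n}) else 0)"
    proof (cases "agree n i j")
      case False
      then show ?thesis using e[of j j j i] by (simp add: tail_unit_ket splice_eq)
    next
      case True
      have "agree n (restrict i {..<n}) (\<lambda>_. undefined)" by (simp add: agree_def)
      then show ?thesis
        using e[of "\<lambda>_. undefined" j j "restrict i {..<n}"] True
        by (simp add: tail_unit_ket splice_eq flip: restrict_eq_splice)
    qed
  qed
qed

lemma tensor_algebra_closed:
  assumes "a \<in> tensor_algebra n" "b \<in> tensor_algebra n"
  shows "a * b \<in> tensor_algebra n" "a - b \<in> tensor_algebra n" "a + b \<in> tensor_algebra n"
  using assms unfolding tensor_algebra_commutant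
  by (simp_all add: algebra_simps) (metis mult.assoc)

lemma tensor_algebra_adj:
  assumes "a \<in> tensor_algebra n" shows "adj a \<in> tensor_algebra n"
  using assms unfolding tensor_algebra_commutant by (metis adj_times adj_tail_unit)

lemma tensor_algebra_one: "1 \<in> tensor_algebra n"
  unfolding tensor_algebra_commutant by simp

lemma tensor_algebra_scaleC:
  assumes "a \<in> tensor_algebra n" shows "c *\<^sub>C a \<in> tensor_algebra n"
  unfolding tensor_algebra_commutant
proof (intro allI bop_eqI)
  fix s t x
  have "app a (app (tail_unit n s t) x) = app (tail_unit n s t) (app a x)"
    using assms unfolding tensor_algebra_commutant by (metis app_times)
  then show "app (c *\<^sub>C a * tail_unit n s t) x = app (tail_unit n s t * c *\<^sub>C a) x"
    by (simp add: app_times app_scale app_scaleC)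
qed

lemma tensor_algebra_sum:
  "(\<And>x. x \<in> S \<Longrightarrow> f x \<in> tensor_algebra n) \<Longrightarrow> sum f S \<in> tensor_algebra n"
proof (induct S rule: infinite_finite_induct)
  case (insert x S) then show ?case by (simp add: tensor_algebra_closed)
qed (simp_all add: tensor_algebra_commutant)

lemma tensor_algebra_mono:
  assumes b: "b \<in> tensor_algebra n" and nm: "n \<le> m"
  shows "b \<in> tensor_algebra m"
  unfolding tensor_algebra_entries
proof (intro allI)
  fix i j :: "nat \<Rightarrow> 'a"
  note ent = b[unfolded tensor_algebra_entries, rule_format]
  have r: "restrict (restrict k {..<m}) {..<n} = restrict k {..<n}" for k :: "nat \<Rightarrow> 'a"
    using nm by (auto simp: restrict_def)
  have "agree n (restrict i {..<m}) (restrict j {..<m}) \<longleftrightarrow> agree n i j" if "agree m i j"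
    using that by (auto simp: restrict_def agree_def) (metis leI)
  moreover have "agree m i j" if "agree n i j" using that nm by (auto simp: agree_def)
  ultimately show "coeff (app b (ket j)) i = (if agree m i j
       then coeff (app b (ket (restrict j {..<m}))) (restrict i {..<m}) else 0)"
    using ent[of j i] ent[of "restrict j {..<m}" "restrict i {..<m}"] unfolding r by auto
qed

lemma splice_upd: "k < n \<Longrightarrow> splice n (i(k := s)) t = (splice n i t)(k := s)"
  by (auto simp: splice_def fun_eq_iff)

lemma site_unit_in:
  assumes k: "k < n" shows "site_unit k s t \<in> tensor_algebra n"
  unfolding tensor_algebra_commutant
proof (intro allI bop_eq_coeffI)
  fix s' t' x i
  have "agree n (i(k := t)) s' \<longleftrightarrow> agree n i s'" using k by (auto simp: agree_def)
  moreover have "splice n i t' k = i k" using k by (simp add: splice_def)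
  ultimately show "coeff (app (site_unit k s t * tail_unit n s' t') x) i =
      coeff (app (tail_unit n s' t' * site_unit k s t) x) i"
    by (simp add: app_times coeff_site_unit coeff_tail_unit splice_upd[OF k])
qed

subsection \<open>Finitary permutations\<close>

lemma affected_times_subset: "affected p \<subseteq> S \<Longrightarrow> affected q \<subseteq> S \<Longrightarrow> affected (p * q) \<subseteq> S"
  using affected_times[of p q] by blast

lemma apply_inverse_apply [simp]: "apply (inverse p) (apply p x) = x" "apply p (apply (inverse p) x) = x"
  by (simp_all add: apply_sequence)

lemma image_apply_eq: "apply p ` N = {y. apply (inverse p) y \<in> N}"
  by (auto simp: image_iff) (metis apply_inverse_apply(2))

lemma affected_bounded: "\<exists>n. affected (p :: nat perm) \<subseteq> {..<n}"
  using finite_nat_bounded[OF finite_affected[of p]] .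

lemma apply_lessThan:
  assumes "affected (p :: nat perm) \<subseteq> {..<n}" shows "apply p x < n \<longleftrightarrow> x < n"
proof (cases "x \<in> affected p")
  case True
  then have "apply p x \<in> affected p" by simp
  then show ?thesis using True assms by blast
next
  case False then show ?thesis by (simp add: in_affected)
qed

lemma cycle_outside: "x \<notin> set ns \<Longrightarrow> apply (cycle ns) x = x"
  by (induct ns rule: cycle.induct) (auto simp: apply_times)

lemma affected_cycle_subset: "affected (cycle ns) \<subseteq> set ns"
  by (metis cycle_outside in_affected subsetI)

lemma cycle_apply:
  "distinct ns \<Longrightarrow> m < length ns \<Longrightarrow> apply (cycle ns) (ns ! m) = ns ! (Suc m mod length ns)"
proof (induct ns arbitrary: m rule: cycle.induct)
  case (3 a b as)
  consider "m = 0" | "m = 1" | k where "m = Suc (Suc k)" by (metis One_nat_def not0_implies_Suc)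
  then show ?case
  proof cases
    case 1
    then show ?thesis using 3(2) cycle_outside[of b "a # as"] by (auto simp: apply_times)
  next
    case 2
    then show ?thesis using 3(1)[of 0] 3(2) by (cases as) (auto simp: apply_times)
  next
    case k: 3
    then have "as ! k \<in> set as" using 3(3) by simp
    then have "as ! k \<noteq> a" "as ! k \<noteq> b" using 3(2) by auto
    then show ?thesis using 3(1)[of "Suc k"] 3(2,3) k by (auto simp: apply_times mod_Suc)
  qed
qed simp_all

lemma cycle_moves:
  assumes "distinct ns" "2 \<le> length ns" "x \<in> set ns"
  shows "apply (cycle ns) x \<noteq> x"
proof -
  obtain m where m: "m < length ns" "x = ns ! m" using assms(3) by (metis in_set_conv_nth)
  have "Suc m mod length ns \<noteq> m" using m assms(2) by (auto simp: mod_Suc)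
  moreover have "Suc m mod length ns < length ns" using m(1) by (intro mod_less_divisor) auto
  ultimately show ?thesis
    using m assms(1) by (simp add: cycle_apply nth_eq_iff_index_eq)
qed

text \<open>Applied later to three functions along a cycle: the parity of a factor, its basis index,
  and whether \<open>v\<close> vanishes at that index.\<close>

lemma cycle_constant:
  assumes "distinct ns" and eq: "\<And>x. x \<in> set ns \<Longrightarrow> f (apply (cycle ns) x) = f x"
    and "x \<in> set ns" "y \<in> set ns"
  shows "f x = f y"
proof -
  have "f (ns ! m) = f (ns ! 0)" if "m < length ns" for m
    using that
  proof (induct m)
    case (Suc m)
    then show ?case using eq[of "ns ! m"] assms(1) by (simp add: cycle_apply)
  qed simp
  then show ?thesis using assms(3,4) by (metis in_set_conv_nth)
qed

lemma conj_swap: "w * swap a b * inverse w = swap (apply w a) (apply w b)"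
proof (rule perm_eqI)
  fix x
  obtain y where x: "x = apply w y" by (metis apply_inverse_apply(2))
  show "apply (w * swap a b * inverse w) x = apply (swap (apply w a) (apply w b)) x"
    unfolding x by (cases "y = a"; cases "y = b") (simp_all add: apply_times apply_inj)
qed

lemma conj_cycle: "w * cycle ns * inverse w = cycle (map (apply w) ns)"
proof (induct ns rule: cycle.induct)
  case (3 a b as)
  have "w * cycle (a # b # as) * inverse w = (w * cycle (a # as) * inverse w) * (w * swap a b * inverse w)"
    by (simp add: mult.assoc) (simp flip: mult.assoc)
  then show ?case using 3 by (simp add: conj_swap)
qed simp_all

text \<open>The orbit of one moved point is split off as a cycle, and the remaining permutation
  fixes it. The containment in \<open>affected p\<close> keeps the decomposition local, which the
  multiplicativity of the character needs.\<close>

lemma cycle_decomposition: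
  "\<exists>cs. p = prod_list (map cycle cs) \<and> distinct (concat cs) \<and> (\<forall>c\<in>set cs. 2 \<le> length c) \<and>
    set (concat cs) \<subseteq> affected p"
proof (induct "card (affected p)" arbitrary: p rule: less_induct)
  case less
  show ?case
  proof (cases "p = 1")
    case True
    then show ?thesis by (intro exI[of _ "[]"]) simp
  next
    case False
    then obtain a where a: "a \<in> affected p" by (metis affected_empty_iff all_not_in_conv)
    define n where "n = order p a"
    define ns where "ns = map (\<lambda>m. apply (p ^ m) a) [0..<n]"
    have n2: "2 \<le> n" unfolding n_def by (rule affected_order_greater_eq_two[OF a])
    have d: "distinct ns"
      unfolding ns_def distinct_map using inj_on_apply_range[of p a]
      by (simp add: n_def atLeast0LessThan)
    have set_ns: "set ns = orbit p a"
      unfolding ns_def orbit_unfold_image by (simp add: n_def atLeast0LessThan)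
    have on: "apply (cycle ns) x = apply p x" if "x \<in> set ns" for x
    proof -
      have "x \<in> (\<lambda>m. apply (p ^ m) a) ` {..<n}" using that by (simp add: ns_def atLeast0LessThan)
      then obtain m where m: "m < n" "x = apply (p ^ m) a" by blast
      then have "apply (cycle ns) x = ns ! (Suc m mod n)"
        using cycle_apply[OF d, of m] by (simp add: ns_def)
      also have "\<dots> = apply (p ^ (Suc m mod n)) a" using n2 by (simp add: ns_def)
      also have "\<dots> = apply (p ^ Suc m) a" unfolding n_def by (rule apply_power_mod_order_eq)
      finally show ?thesis by (simp add: m apply_times)
    qed
    define r where "r = inverse (cycle ns) * p"
    have r1: "apply r x = x" if "x \<in> set ns" for x
      using on[OF that] apply_inverse_apply(1)[of "cycle ns" x] by (simp add: r_def apply_times)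
    have r2: "apply r x = apply p x" if "x \<notin> set ns" for x
    proof -
      have "apply p x \<notin> set ns" using that unfolding set_ns
        by (metis apply_inverse_apply(1) apply_inverse_self_in_orbit orbit_apply_inverse orbit_equiv in_orbit_self)
      then show ?thesis
        by (simp add: r_def apply_times) (metis apply_inverse_apply(1) cycle_outside)
    qed
    have ar: "affected r \<subseteq> affected p - set ns"
      using r1 r2 by (auto simp: in_affected) metis
    have "a \<in> set ns" unfolding set_ns by simp
    then have "affected r \<subset> affected p" using ar a by blast
    then have "card (affected r) < card (affected p)" by (simp add: psubset_card_mono)
    from less[OF this] obtain cs where cs: "r = prod_list (map cycle cs)" "distinct (concat cs)"
      "\<forall>c\<in>set cs. 2 \<le> length c" "set (concat cs) \<subseteq> affected r" by blast
    have "p = cycle ns * r" by (simp add: r_def flip: mult.assoc)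
    moreover have "set ns \<subseteq> affected p" unfolding set_ns by (rule orbit_subset_eq_affected[OF a])
    moreover have "length ns = n" by (simp add: ns_def)
    moreover have "set ns \<inter> set (concat cs) = {}" using cs(4) ar by blast
    moreover have "set (concat cs) \<subseteq> affected p" using cs(4) ar by blast
    ultimately show ?thesis
      using cs(1-3) d n2 by (intro exI[of _ "ns # cs"]) auto
  qed
qed

text \<open>Only transpositions inside \<open>affected p\<close> have to be treated; the absorption
  argument in \<open>Tp_absorb\<close> has control over no others.\<close>

lemma perm_swap_induct [case_names one swap mult]:
  assumes one: "P 1" and sw: "\<And>a b. a \<in> affected p \<Longrightarrow> b \<in> affected p \<Longrightarrow> P (swap a b)"
    and mult: "\<And>p q. P p \<Longrightarrow> P q \<Longrightarrow> P (p * q)"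
  shows "P p"
proof -
  obtain cs where cs: "p = prod_list (map cycle cs)" "set (concat cs) \<subseteq> affected p"
    using cycle_decomposition[of p] by blast
  have "P (cycle ns)" if "set ns \<subseteq> affected p" for ns
    using that by (induct ns rule: cycle.induct) (simp_all add: one sw mult)
  then have "P (prod_list (map cycle cs))" using cs(2)
    by (induct cs) (simp_all add: one mult)
  then show ?thesis using cs(1) by simp
qed

lemma perm_adjacent_induct [case_names one adj mult]:
  assumes one: "P 1" and ad: "\<And>k. P (swap k (Suc k))"
    and mult: "\<And>p q. P p \<Longrightarrow> P q \<Longrightarrow> P (p * q)"
  shows "P (p :: nat perm)"
proof (rule perm_swap_induct)
  have sw: "P (swap a (a + d))" for a d
  proof (induct d)
    case (Suc d)
    \<comment> \<open>Conjugation by an adjacent transposition moves the right endpoint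
      \<open>a + d\<close> one step further. For \<open>d = 0\<close> it moves the left endpoint as
      well, and the desired transposition is itself adjacent.\<close>
    have "P (swap (a + d) (Suc (a + d)) * swap a (a + d) * inverse (swap (a + d) (Suc (a + d))))"
      using Suc ad[of "a + d"] by (simp only: inverse_swap mult)
    then show ?case unfolding conj_swap by (cases "d = 0") (use ad in auto)
  qed (simp add: one)
  show "P (swap a b)" for a b
    using sw[of a "b - a"] sw[of b "a - b"] by (cases "a \<le> b") (simp_all add: swap_sym[of a b])
qed (simp_all only: one mult)

subsection \<open>A sign cocycle\<close>

text \<open>The sign picked up when \<open>p\<close> permutes tensor factors of which those at the sites in \<open>N\<close> are
  odd: the parity of the number of inversions of \<open>p\<close> between sites in \<open>N\<close>.\<close>

definition inverted :: "nat perm \<Rightarrow> nat set \<Rightarrow> bool" where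
  "inverted p e \<longleftrightarrow> (\<exists>x\<in>e. \<exists>y\<in>e. x < y \<and> apply p y < apply p x)"

definition psign :: "nat perm \<Rightarrow> nat set \<Rightarrow> complex" where
  "psign p N = (-1) ^ card {e. e \<subseteq> N \<and> card e = 2 \<and> inverted p e}"

lemma psign_cmod [simp]: "cmod (psign p N) = 1"
  by (simp add: psign_def norm_power)

lemma psign_square: "psign p N * psign p N = 1"
  by (simp add: psign_def flip: power_add mult_2)

lemma psign_cnj [simp]: "cnj (psign p N) = psign p N"
  by (simp add: psign_def)

lemma inverted_pair: "x < y \<Longrightarrow> inverted p {x, y} \<longleftrightarrow> apply p y < apply p x"
  by (auto simp: inverted_def)

lemma pair_cases:
  assumes "card e = 2" obtains x y :: nat where "x < y" "e = {x, y}"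
  using assms by (metis card_2_iff insert_commute nat_neq_iff)

lemma inverted_bounded:
  assumes p: "affected p \<subseteq> {..<n}" and e: "card e = 2" "inverted p e"
  shows "e \<subseteq> {..<n}"
proof -
  obtain x y where xy: "x < y" "e = {x, y}" using e(1) by (rule pair_cases)
  then have lt: "apply p y < apply p x" using e(2) inverted_pair by simp
  have "y < n"
  proof (rule ccontr)
    assume "\<not> y < n"
    then have y: "apply p y = y" using p by (auto simp: in_affected)
    have "\<not> apply p x < n" using lt y \<open>\<not> y < n\<close> by simp
    then have "\<not> x < n" using apply_lessThan[OF p] by simp
    then have "apply p x = x" using p by (auto simp: in_affected)
    then show False using lt y xy by simp
  qed
  then show ?thesis using xy by auto
qed

text \<open>Inverted pairs lie below any bound of \<open>affected p\<close>, so the count is finite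
  even for infinite \<open>N\<close>. The resulting product runs over a set of pairs that depends on
  \<open>p\<close> only through the bound, hence can be compared factor by factor for different
  permutations.\<close>

lemma psign_prod:
  assumes p: "affected p \<subseteq> {..<n}"
  shows "psign p N = (\<Prod>e\<in>{e. e \<subseteq> N \<inter> {..<n} \<and> card e = 2}. if inverted p e then -1 else 1)"
proof -
  let ?S = "{e. e \<subseteq> N \<inter> {..<n} \<and> card e = 2}"
  have fin: "finite ?S" by (rule finite_subset[of _ "Pow {..<n}"]) auto
  have "{e. e \<subseteq> N \<and> card e = 2 \<and> inverted p e} = {e\<in>?S. inverted p e}"
    using inverted_bounded[OF p] by auto
  then show ?thesis using fin by (simp add: psign_def prod.If_cases Int_def)
qed

text \<open>A pair is inverted by \<open>p * q\<close> iff exactly one of two things happens: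
  \<open>q\<close> inverts it, or \<open>p\<close> inverts its image under \<open>q\<close>.\<close>

lemma psign_mult: "psign (p * q) N = psign p (apply q ` N) * psign q N"
proof -
  obtain n1 n2 where "affected p \<subseteq> {..<n1}" "affected q \<subseteq> {..<n2}" using affected_bounded by metis
  then have p: "affected p \<subseteq> {..<max n1 n2}" and q: "affected q \<subseteq> {..<max n1 n2}" by auto
  define n where "n = max n1 n2"
  note p = p[folded n_def] and q = q[folded n_def]
  let ?S = "\<lambda>N. {e. e \<subseteq> N \<inter> {..<n} \<and> card e = 2}"
  let ?e = "\<lambda>p e. if inverted p e then -1 else 1 :: complex"
  have inj: "inj_on (apply q) e" for e by (auto simp: inj_on_def apply_inj)
  have e: "?e (p * q) e = ?e p (apply q ` e) * ?e q e" if "card e = 2" for e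
  proof -
    obtain x y where xy: "x < y" "e = {x, y}" using \<open>card e = 2\<close> by (rule pair_cases)
    have ne: "apply q x \<noteq> apply q y" "apply p (apply q x) \<noteq> apply p (apply q y)"
      using xy by (simp_all add: apply_inj)
    consider "apply q x < apply q y" | "apply q y < apply q x" using ne by linarith
    then show ?thesis
    proof cases
      case 1
      then show ?thesis using xy by (simp add: inverted_pair apply_times)
    next
      case 2
      have "inverted p {apply q x, apply q y} \<longleftrightarrow> apply p (apply q x) < apply p (apply q y)"
        using inverted_pair[OF 2, of p] by (simp add: insert_commute)
      then show ?thesis using xy ne 2 by (auto simp: inverted_pair apply_times)
    qed
  qed
  have bij: "bij_betw (\<lambda>e. apply q ` e) (?S N) (?S (apply q ` N))"
    by (rule bij_betwI[of _ _ _ "\<lambda>e. apply (inverse q) ` e"])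
      (auto simp: card_image[OF inj] image_image apply_lessThan[OF q] apply_lessThan[of "inverse q" n] q
        card_image inj_on_def apply_inj)
  have "psign (p * q) N = (\<Prod>e\<in>?S N. ?e (p * q) e)"
    by (rule psign_prod[OF affected_times_subset[OF p q]])
  also have "\<dots> = (\<Prod>e\<in>?S N. ?e p (apply q ` e) * ?e q e)"
    by (rule prod.cong) (use e in auto)
  also have "\<dots> = (\<Prod>e\<in>?S N. ?e p (apply q ` e)) * psign q N"
    unfolding psign_prod[OF q] by (rule prod.distrib)
  also have "(\<Prod>e\<in>?S N. ?e p (apply q ` e)) = psign p (apply q ` N)"
    unfolding psign_prod[OF p] by (rule prod.reindex_bij_betw[OF bij])
  finally show ?thesis .
qed

lemma psign_fixed:
  assumes "N \<inter> affected p = {}" shows "psign p N = 1"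
proof -
  have "\<not> inverted p e" if "e \<subseteq> N" for e
    using that assms unfolding inverted_def in_affected disjoint_iff by (metis not_less_iff_gr_or_eq subsetD)
  then have "{e. e \<subseteq> N \<and> card e = 2 \<and> inverted p e} = {}" by blast
  then show ?thesis unfolding psign_def by (simp only: card.empty power_0)
qed

lemma psign_one [simp]: "psign 1 N = 1"
  by (rule psign_fixed) simp

lemma psign_inverse: "psign (inverse p) (apply p ` N) = psign p N"
proof -
  have "psign (inverse p) (apply p ` N) * psign p N = 1"
    by (simp flip: psign_mult)
  then show ?thesis by (metis psign_square mult.assoc mult.right_neutral mult.left_neutral)
qed

lemma psign_adjacent:
  "psign (swap k (Suc k)) N = (if k \<in> N \<and> Suc k \<in> N then -1 else 1)"
proof -
  have "inverted (swap k (Suc k)) e \<longleftrightarrow> e = {k, Suc k}" if "card e = 2" for e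
  proof -
    obtain x y where xy: "x < y" "e = {x, y}" using \<open>card e = 2\<close> by (rule pair_cases)
    have "apply (swap k (Suc k)) y < apply (swap k (Suc k)) x \<longleftrightarrow> x = k \<and> y = Suc k"
      using xy(1) by (cases "x = k"; cases "y = k"; cases "x = Suc k"; cases "y = Suc k") auto
    then show ?thesis using xy by (auto simp: inverted_pair doubleton_eq_iff)
  qed
  then have "{e. e \<subseteq> N \<and> card e = 2 \<and> inverted (swap k (Suc k)) e} = {e. e \<subseteq> N \<and> e = {k, Suc k}}"
    by (auto simp: card_insert_if)
  also have "\<dots> = (if k \<in> N \<and> Suc k \<in> N then {{k, Suc k}} else {})" by auto
  finally show ?thesis by (simp add: psign_def)
qed

text \<open>The inverted pairs are \<open>{x, y}\<close> and, for each site \<open>z\<close> of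
  \<open>N\<close> strictly between, the two pairs \<open>{x, z}\<close> and \<open>{z, y}\<close>:
  an odd number.\<close>

lemma psign_swap:
  assumes "x \<in> N" "y \<in> N" "x < y"
  shows "psign (swap x y) N = -1"
proof -
  define Z where "Z = {z\<in>N. x < z \<and> z < y}"
  have Z: "finite Z" "x \<notin> Z" "y \<notin> Z" by (auto simp: Z_def)
  have "{e. e \<subseteq> N \<and> card e = 2 \<and> inverted (swap x y) e} =
      insert {x, y} ((\<lambda>z. {x, z}) ` Z \<union> (\<lambda>z. {z, y}) ` Z)" (is "?L = ?R")
  proof (rule set_eqI)
    fix e
    show "e \<in> ?L \<longleftrightarrow> e \<in> ?R"
    proof (cases "card e = 2")
      case True
      then obtain a b where ab: "a < b" "e = {a, b}" by (rule pair_cases)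
      have "apply (swap x y) b < apply (swap x y) a \<longleftrightarrow>
          (a = x \<and> b = y) \<or> (a = x \<and> b < y) \<or> (x < a \<and> b = y)"
        using ab(1) assms(3)
        by (cases "a = x"; cases "b = x"; cases "a = y"; cases "b = y") auto
      then show ?thesis
        using ab assms True by (auto simp: inverted_pair doubleton_eq_iff Z_def image_iff)
    next
      case False
      then show ?thesis using Z assms by (auto simp: card_insert_if split: if_splits)
    qed
  qed
  moreover have "{x, y} \<notin> (\<lambda>z. {x, z}) ` Z \<union> (\<lambda>z. {z, y}) ` Z"
    using Z assms by (auto simp: doubleton_eq_iff)
  moreover have "(\<lambda>z. {x, z}) ` Z \<inter> (\<lambda>z. {z, y}) ` Z = {}"
    using Z assms by (auto simp: doubleton_eq_iff)
  moreover have "card ((\<lambda>z. {x, z}) ` Z) = card Z" "card ((\<lambda>z. {z, y}) ` Z) = card Z"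
    using Z by (auto intro!: card_image inj_onI simp: doubleton_eq_iff)
  ultimately have "card {e. e \<subseteq> N \<and> card e = 2 \<and> inverted (swap x y) e} = Suc (card Z + card Z)"
    using Z by (simp add: card_Un_disjoint)
  then show ?thesis by (simp add: psign_def flip: mult_2)
qed

text \<open>The cycle is a product of \<open>length ns - 1\<close> transpositions of sites in
  \<open>N\<close>; each maps \<open>N\<close> to itself, so the cocycle is multiplicative here.
  Other odd sites may lie between the entries of the cycle.\<close>

lemma psign_cycle:
  assumes "distinct ns" "set ns \<subseteq> N"
  shows "psign (cycle ns) N = (-1) ^ (length ns - 1)"
  using assms
proof (induct ns rule: cycle.induct)
  case (3 a b as)
  have "apply (swap a b) ` N = N"
  proof -
    have "apply (swap a b) x \<in> N" if "x \<in> N" for x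
      using that 3(3) by (cases "x = a"; cases "x = b") auto
    moreover have "apply (swap a b) (apply (swap a b) x) = x" for x
      by (simp add: apply_sequence)
    ultimately show ?thesis by (auto simp: image_iff) metis
  qed
  moreover have "psign (swap a b) N = -1"
    using 3(2,3) psign_swap[of a N b] psign_swap[of b N a] by (cases "a < b") (auto simp: swap_sym[of a b])
  ultimately show ?case using 3 by (simp add: psign_mult)
qed simp_all

subsection \<open>Rook matrices\<close>

lemma entry_01: "entry r i j = 0 \<or> entry r i j = 1"
  using entry[of r] unfolding rook_matrix_def mem_Collect_eq by blast

text \<open>Seen as a relation, a rook matrix multiplies by relational composition.\<close>

definition hits :: "rook \<Rightarrow> nat \<Rightarrow> nat \<Rightarrow> bool" where
  "hits r i j \<longleftrightarrow> entry r i j = 1"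

lemma rook_eqI:
  assumes "\<And>i j. hits r i j \<longleftrightarrow> hits s i j" shows "r = s"
proof -
  have "entry r = entry s" using assms entry_01 unfolding hits_def by (intro ext) metis
  then show ?thesis by (simp add: entry_inject)
qed

lemma entry_times_iff: "hits (r * s) i j \<longleftrightarrow> (\<exists>k. hits r i k \<and> hits s k j)"
  unfolding hits_def using entry[of r] entry[of s] by (simp add: times_rook.rep_eq rook_mult_eq)

lemma entry_one_iff: "hits 1 i j \<longleftrightarrow> i = j"
  by (auto simp: hits_def one_rook.rep_eq)

lemma entry_perm_iff: "hits (perm_rook p) i j \<longleftrightarrow> i = apply p j"
  by (auto simp: hits_def perm_rook.rep_eq)

lemma entry_eps_iff: "finite M \<Longrightarrow> hits (eps M) i j \<longleftrightarrow> i = j \<and> i \<notin> M"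
  by (auto simp: hits_def eps.rep_eq)

lemma entry_transpose: "hits (rook_transpose r) i j \<longleftrightarrow> hits r j i"
  by (simp add: hits_def rook_transpose.rep_eq)

lemma entry_perm_eps_iff:
  "finite M \<Longrightarrow> hits (perm_rook p * eps M) i j \<longleftrightarrow> i = apply p j \<and> j \<notin> M"
  by (auto simp: entry_times_iff entry_perm_iff entry_eps_iff)

lemma perm_rook_mult: "perm_rook (p * q) = perm_rook p * perm_rook q"
  by (rule rook_eqI) (auto simp: entry_times_iff entry_perm_iff apply_times)

lemma perm_rook_one [simp]: "perm_rook 1 = 1"
  by (rule rook_eqI) (simp add: entry_perm_iff entry_one_iff)

lemma eps_empty [simp]: "eps {} = 1"
  by (rule rook_eqI) (simp add: entry_eps_iff entry_one_iff)

lemma eps_Un: "finite M \<Longrightarrow> finite N \<Longrightarrow> eps (M \<union> N) = eps M * eps N"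
  by (rule rook_eqI) (auto simp: entry_times_iff entry_eps_iff)

lemma eps_perm_rook:
  "finite M \<Longrightarrow> eps M * perm_rook p = perm_rook p * eps (apply (inverse p) ` M)"
  by (rule rook_eqI) (auto simp: entry_times_iff entry_eps_iff entry_perm_iff image_iff)

lemma transpose_times: "rook_transpose (r * s) = rook_transpose s * rook_transpose r"
  by (rule rook_eqI) (auto simp: entry_times_iff entry_transpose)

lemma transpose_perm_rook: "rook_transpose (perm_rook p) = perm_rook (inverse p)"
  by (rule rook_eqI) (auto simp: entry_perm_iff entry_transpose)

lemma transpose_eps: "finite M \<Longrightarrow> rook_transpose (eps M) = eps M"
  by (rule rook_eqI) (auto simp: entry_eps_iff entry_transpose)

text \<open>Let the matrix be diagonal from \<open>n\<close> on. The nonempty columns below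
  \<open>n\<close> then hit rows below \<open>n\<close>, so as many empty rows as empty columns
  remain there; any bijection \<open>g\<close> between these completes the partial injection to a
  permutation, and \<open>eps\<close> erases the columns that were filled in.\<close>

lemma rook_decomposition:
  obtains p M where "finite M" "r = perm_rook p * eps M"
proof -
  have R: "rook_matrix (entry r)" using entry[of r] by simp
  then obtain n where n: "\<And>k. k \<ge> n \<Longrightarrow> hits r k k"
    unfolding hits_def rook_matrix_def eventually_sequentially by blast
  have row: "j = j'" if "hits r i j" "hits r i j'" for i j j'
    using R that unfolding hits_def rook_matrix_def by blast
  have col: "i = i'" if "hits r i j" "hits r i' j" for i i' j
    using R that unfolding hits_def rook_matrix_def by blast
  define C where "C = {j. \<exists>i. hits r i j} \<inter> {..<n}"
  define f where "f j = (THE i. hits r i j)" for j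
  have f: "hits r (f j) j" if "j \<in> C" for j
  proof -
    obtain i where i: "hits r i j" using \<open>j \<in> C\<close> unfolding C_def by blast
    show ?thesis unfolding f_def using i by (rule theI) (rule col[OF _ i])
  qed
  have fn: "f j < n" if "j \<in> C" for j
  proof (rule ccontr)
    assume "\<not> f j < n"
    then have "j = f j" using row[OF f[OF that] n] by simp
    then show False using \<open>\<not> f j < n\<close> that by (simp add: C_def)
  qed
  have inj: "inj_on f C" by (rule inj_onI) (metis f row)
  have "card ({..<n} - C) = card ({..<n} - f ` C)"
  proof -
    have "C \<subseteq> {..<n}" "f ` C \<subseteq> {..<n}" using fn by (auto simp: C_def)
    then show ?thesis
      by (simp add: card_Diff_subset finite_subset[OF _ finite_lessThan] card_image[OF inj])
  qed
  then obtain g where g: "bij_betw g ({..<n} - C) ({..<n} - f ` C)"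
    by (metis finite_Diff finite_lessThan finite_same_card_bij)
  define P where "P x = (if x \<in> C then f x else if x < n then g x else x)" for x
  have "bij_betw P (C \<union> (({..<n} - C) \<union> {n..})) (f ` C \<union> (({..<n} - f ` C) \<union> {n..}))"
  proof (intro bij_betw_combine)
    show "bij_betw P C (f ` C)"
      using inj by (auto simp: bij_betw_def P_def inj_on_def)
    show "bij_betw P ({..<n} - C) ({..<n} - f ` C)"
      by (rule bij_betw_cong[THEN iffD1, OF _ g]) (simp add: P_def)
    show "bij_betw P {n..} {n..}"
      by (rule bij_betw_cong[THEN iffD1, OF _ bij_betw_id]) (auto simp: P_def C_def)
  qed (auto dest: fn)
  moreover have "C \<union> (({..<n} - C) \<union> {n..}) = UNIV" by auto
  moreover have "f ` C \<union> (({..<n} - f ` C) \<union> {n..}) = UNIV" by auto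
  ultimately have bij: "bij P" by simp
  have "finite {x. P x \<noteq> x}"
    by (rule finite_subset[of _ "{..<n}"]) (auto simp: P_def C_def)
  then have ap: "apply (Perm P) = P" using bij by (simp add: Perm_inverse)
  have "r = perm_rook (Perm P) * eps ({..<n} - C)"
  proof (rule rook_eqI)
    fix i j
    have "hits r i j \<longleftrightarrow> i = P j \<and> j \<notin> {..<n} - C"
    proof (cases "j < n")
      case True
      show ?thesis
      proof (cases "j \<in> C")
        case True then show ?thesis using f[OF True] col by (auto simp: P_def)
      next
        case False then show ?thesis using \<open>j < n\<close> by (auto simp: C_def)
      qed
    next
      case False
      then have "P j = j" "hits r j j" using n by (auto simp: P_def C_def)
      then show ?thesis using col False by auto
    qed
    then show "hits r i j \<longleftrightarrow> hits (perm_rook (Perm P) * eps ({..<n} - C)) i j"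
      by (simp add: entry_perm_eps_iff ap)
  qed
  then show ?thesis using that by blast
qed

subsection \<open>The representation on the infinite tensor power\<close>

text \<open>\<open>neg\<close> singles out the odd basis vectors and \<open>v\<close> is the coordinate vector of a unit vector
  spanning the range of \<open>q\<close>, or zero.\<close>

locale twisted =
  fixes neg :: "'s \<Rightarrow> bool" and v :: "'s \<Rightarrow> complex"
  assumes fin: "finite {s. v s \<noteq> 0}"
    and v_even: "\<And>s. v s \<noteq> 0 \<Longrightarrow> \<not> neg s"
    and v_unit: "\<And>s. v s * (\<Sum>t | v t \<noteq> 0. cnj (v t) * v t) = v s"
begin

abbreviation V where "V \<equiv> {s. v s \<noteq> 0}"

definition odd_sites :: "(nat \<Rightarrow> 's) \<Rightarrow> nat set" where
  "odd_sites i = {k. neg (i k)}"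

lemma odd_sites_comp: "apply p ` odd_sites (i \<circ> apply p) = odd_sites i"
  by (auto simp: odd_sites_def image_apply_eq)

text \<open>The index \<open>i o apply p\<close> is the one whose ket is sent to a multiple of
  \<open>ket i\<close>. The sign is therefore taken at its odd sites, which \<open>p\<close> carries
  to those of \<open>i\<close>; this is the form in which \<open>psign_mult\<close> matches
  composition.\<close>

definition Tp :: "nat perm \<Rightarrow> (nat \<Rightarrow> 's) ell2 bop" where
  "Tp p = wcomp (\<lambda>i. psign p (odd_sites (i \<circ> apply p))) (\<lambda>i. i \<circ> apply p)"

lemma coeff_Tp:
  "coeff (app (Tp p) x) i = psign p (odd_sites (i \<circ> apply p)) * coeff x (i \<circ> apply p)"
proof -
  have "inj (\<lambda>i :: nat \<Rightarrow> 's. i \<circ> apply p)"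
  proof (rule injI)
    fix i j :: "nat \<Rightarrow> 's" assume "i \<circ> apply p = j \<circ> apply p"
    then have "(i \<circ> apply p) (apply (inverse p) x) = (j \<circ> apply p) (apply (inverse p) x)" for x by simp
    then show "i = j" by (simp add: fun_eq_iff)
  qed
  then have "weight_ok (\<lambda>i. psign p (odd_sites (i \<circ> apply p))) (\<lambda>i. i \<circ> apply p)"
    by (auto simp: weight_ok_def intro: inj_on_subset)
  then show ?thesis unfolding Tp_def by (rule coeff_wcomp)
qed

lemma Tp_mult: "Tp (p * q) = Tp p * Tp q"
proof (rule bop_eq_coeffI)
  fix x :: "(nat \<Rightarrow> 's) ell2" and i :: "nat \<Rightarrow> 's"
  have "psign (p * q) (odd_sites (i \<circ> apply p \<circ> apply q)) =
      psign p (odd_sites (i \<circ> apply p)) * psign q (odd_sites (i \<circ> apply p \<circ> apply q))"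
    unfolding psign_mult odd_sites_comp ..
  then show "coeff (app (Tp (p * q)) x) i = coeff (app (Tp p * Tp q) x) i"
    by (simp add: app_times coeff_Tp apply_times o_assoc mult.assoc)
qed

lemma Tp_one [simp]: "Tp 1 = 1"
  by (rule bop_eq_coeffI) (simp add: coeff_Tp)

lemma coeff_adj: "coeff (app (adj b) (ket j)) i = cnj (coeff (app b (ket i)) j)"
  unfolding cinner_ket[symmetric] by (metis cinner_adj' cinner_commute)

lemma adj_Tp: "adj (Tp p) = Tp (inverse p)"
proof (rule ell2_bop_eqI, rule ell2_eqI)
  fix i j :: "nat \<Rightarrow> 's"
  have iff: "i = j \<circ> apply p \<longleftrightarrow> j = i \<circ> apply (inverse p)" by (auto simp: fun_eq_iff)
  have "psign (inverse p) (odd_sites j) = psign p (odd_sites (j \<circ> apply p))"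
    by (metis odd_sites_comp psign_inverse)
  then show "coeff (app (adj (Tp p)) (ket j)) i = coeff (app (Tp (inverse p)) (ket j)) i"
    using iff by (auto simp: coeff_adj coeff_Tp coeff_ket)
qed

text \<open>The operator \<open>q\<close> in factor \<open>k\<close>, with matrix entries
  \<open>v s * cnj (v t)\<close>.\<close>

definition Q :: "nat \<Rightarrow> (nat \<Rightarrow> 's) ell2 bop" where
  "Q k = (\<Sum>s\<in>V. \<Sum>t\<in>V. (v s * cnj (v t)) *\<^sub>C site_unit k s t)"

lemma coeff_Q: "coeff (app (Q k) x) i = v (i k) * (\<Sum>t\<in>V. cnj (v t) * coeff x (i(k := t)))"
proof -
  have "coeff (app (Q k) x) i = (\<Sum>s\<in>V. if s = i k then v s * (\<Sum>t\<in>V. cnj (v t) * coeff x (i(k := t))) else 0)"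
    unfolding Q_def
    by (auto simp: app_sum_op app_scale coeff_sum coeff_site_unit sum_distrib_left mult.assoc intro!: sum.cong)
  then show ?thesis using fin by (simp add: sum.delta)
qed

lemma coeff_Q_ket:
  "coeff (app (Q k) (ket j)) i = (if i(k := j k) = j then v (i k) * cnj (v (j k)) else 0)"
proof -
  have "(\<Sum>t\<in>V. cnj (v t) * coeff (ket j) (i(k := t))) =
      (\<Sum>t\<in>V. if t = j k then (if i(k := j k) = j then cnj (v t) else 0) else 0)"
    by (rule sum.cong) (auto simp: coeff_ket fun_eq_iff)
  then show ?thesis using fin by (simp add: coeff_Q sum.delta)
qed

lemma adj_Q: "adj (Q k) = Q k"
proof (rule ell2_bop_eqI, rule ell2_eqI)
  fix i j :: "nat \<Rightarrow> 's"
  have "j(k := i k) = i \<longleftrightarrow> i(k := j k) = j" by (auto simp: fun_eq_iff)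
  then show "coeff (app (adj (Q k)) (ket j)) i = coeff (app (Q k) (ket j)) i"
    by (simp add: coeff_adj coeff_Q_ket)
qed

lemma Q_idem: "Q k * Q k = Q k"
proof (rule bop_eq_coeffI)
  fix x :: "(nat \<Rightarrow> 's) ell2" and i :: "nat \<Rightarrow> 's"
  define z where "z = (\<Sum>t\<in>V. cnj (v t) * coeff x (i(k := t)))"
  have "coeff (app (Q k * Q k) x) i = v (i k) * (\<Sum>t\<in>V. cnj (v t) * (v t * z))"
    by (simp add: app_times coeff_Q z_def)
  also have "\<dots> = (v (i k) * (\<Sum>t\<in>V. cnj (v t) * v t)) * z"
    by (simp add: sum_distrib_left sum_distrib_right mult_ac)
  finally show "coeff (app (Q k * Q k) x) i = coeff (app (Q k) x) i"
    unfolding v_unit by (simp add: coeff_Q z_def)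
qed

lemma coeff_QQ:
  assumes "k \<noteq> l"
  shows "coeff (app (Q k * Q l) x) i =
    v (i k) * v (i l) * (\<Sum>t\<in>V. \<Sum>u\<in>V. cnj (v t) * cnj (v u) * coeff x (i(k := t, l := u)))"
  using assms by (simp add: app_times coeff_Q sum_distrib_left sum_distrib_right mult_ac)

lemma Q_commute: "Q k * Q l = Q l * Q k"
proof (cases "k = l")
  case False
  show ?thesis
  proof (rule bop_eq_coeffI)
    fix x :: "(nat \<Rightarrow> 's) ell2" and i :: "nat \<Rightarrow> 's"
    have "(\<Sum>t\<in>V. \<Sum>u\<in>V. cnj (v t) * cnj (v u) * coeff x (i(k := t, l := u))) =
        (\<Sum>u\<in>V. \<Sum>t\<in>V. cnj (v u) * cnj (v t) * coeff x (i(l := u, k := t)))"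
      by (subst sum.swap) (simp add: fun_upd_twist[OF False] mult.commute)
    then show "coeff (app (Q k * Q l) x) i = coeff (app (Q l * Q k) x) i"
      using False by (simp add: coeff_QQ mult.commute)
  qed
qed simp

text \<open>Where the coefficients of \<open>Q\<close> do not vanish, an even basis index is
  replaced by another even one; the odd sites and hence the sign stay the same.\<close>

lemma Q_Tp: "Q k * Tp p = Tp p * Q (apply (inverse p) k)"
proof (rule bop_eq_coeffI)
  fix x :: "(nat \<Rightarrow> 's) ell2" and i :: "nat \<Rightarrow> 's"
  let ?l = "apply (inverse p) k"
  have c: "i(k := t) \<circ> apply p = (i \<circ> apply p)(?l := t)" for t
    by (auto simp: fun_eq_iff)
  have s: "psign p (odd_sites ((i \<circ> apply p)(?l := t))) = psign p (odd_sites (i \<circ> apply p))"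
    if "v (i k) \<noteq> 0" "v t \<noteq> 0" for t
  proof -
    have "odd_sites ((i \<circ> apply p)(?l := t)) = odd_sites (i \<circ> apply p)"
      using v_even[OF that(1)] v_even[OF that(2)] by (auto simp: odd_sites_def)
    then show ?thesis by simp
  qed
  show "coeff (app (Q k * Tp p) x) i = coeff (app (Tp p * Q ?l) x) i"
  proof (cases "v (i k) = 0")
    case True
    then show ?thesis by (simp add: app_times coeff_Q coeff_Tp)
  next
    case False
    have "(\<Sum>t\<in>V. cnj (v t) * coeff (app (Tp p) x) (i(k := t))) =
        psign p (odd_sites (i \<circ> apply p)) * (\<Sum>t\<in>V. cnj (v t) * coeff x ((i \<circ> apply p)(?l := t)))"
      unfolding sum_distrib_left
      by (rule sum.cong) (use s[OF False] in \<open>auto simp: coeff_Tp c\<close>)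
    then show ?thesis by (simp add: app_times coeff_Q coeff_Tp)
  qed
qed

lemma swap_absorb:
  assumes "a \<noteq> b" shows "Tp (swap a b) * (Q a * Q b) = Q a * Q b"
proof (rule bop_eq_coeffI)
  fix x :: "(nat \<Rightarrow> 's) ell2" and i :: "nat \<Rightarrow> 's"
  let ?j = "i \<circ> apply (swap a b)"
  have j: "?j(a := t, b := u) = i(a := t, b := u)" for t u
    using assms by (auto simp: fun_eq_iff)
  have s: "psign (swap a b) (odd_sites ?j) = 1" if "v (i a) \<noteq> 0" "v (i b) \<noteq> 0"
    using v_even[OF that(1)] v_even[OF that(2)]
    by (intro psign_fixed) (auto simp: odd_sites_def affected_swap[OF assms])
  show "coeff (app (Tp (swap a b) * (Q a * Q b)) x) i = coeff (app (Q a * Q b) x) i"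
    unfolding app_times[of "Tp (swap a b)"] coeff_Tp coeff_QQ[OF assms] j
    using s by (cases "v (i a) = 0 \<or> v (i b) = 0") auto
qed

text \<open>A fold replaces a product because the operators form no commutative monoid. The factors
  commute and are idempotent, so inserting a site that is already in \<open>M\<close> is
  harmless.\<close>

definition QM :: "nat set \<Rightarrow> (nat \<Rightarrow> 's) ell2 bop" where
  "QM M = Finite_Set.fold (\<lambda>k b. Q k * b) 1 M"

lemma QM_empty [simp]: "QM {} = 1"
  by (simp add: QM_def)

lemma QM_insert: "finite M \<Longrightarrow> QM (insert k M) = Q k * QM M"
proof -
  interpret comp_fun_idem "\<lambda>k b. Q k * b"
  proof
    show "(\<lambda>b. Q x * b) \<circ> (\<lambda>b. Q y * b) = (\<lambda>b. Q y * b) \<circ> (\<lambda>b. Q x * b)" for x y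
      by (rule ext) (simp add: Q_commute[of x y] flip: mult.assoc)
    show "(\<lambda>b. Q x * b) \<circ> (\<lambda>b. Q x * b) = (\<lambda>b. Q x * b)" for x
      by (rule ext) (simp add: Q_idem flip: mult.assoc)
  qed
  assume "finite M" then show ?thesis unfolding QM_def by (rule fold_insert_idem)
qed

lemma QM_Un: "finite M \<Longrightarrow> finite N \<Longrightarrow> QM (M \<union> N) = QM M * QM N"
  by (induct M rule: finite_induct) (simp_all add: QM_insert mult.assoc)

lemma adj_QM: "finite M \<Longrightarrow> adj (QM M) = QM M"
proof (induct M rule: finite_induct)
  case (insert k M)
  have "QM M * Q k = QM (M \<union> {k})" using QM_Un[of M "{k}"] insert by (simp add: QM_insert)
  then show ?case using insert by (simp add: QM_insert adj_times adj_Q)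
qed simp

lemma QM_Tp: "finite M \<Longrightarrow> QM M * Tp p = Tp p * QM (apply (inverse p) ` M)"
proof (induct M rule: finite_induct)
  case (insert k M)
  have "QM (insert k M) * Tp p = Q k * (Tp p * QM (apply (inverse p) ` M))"
    using insert by (simp add: QM_insert mult.assoc)
  also have "\<dots> = Tp p * (Q (apply (inverse p) k) * QM (apply (inverse p) ` M))"
    by (simp add: Q_Tp flip: mult.assoc)
  finally show ?case using insert by (simp add: QM_insert)
qed simp

text \<open>This makes \<open>Th\<close> well defined: a rook matrix determines its permutation only
  up to permutations supported in the set of erased columns.\<close>

lemma Tp_absorb:
  assumes M: "finite M" "affected w \<subseteq> M"
  shows "Tp w * QM M = QM M"
proof (rule perm_swap_induct[where p = w and P = "\<lambda>w. Tp w * QM M = QM M"])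
  fix a b assume "a \<in> affected w" "b \<in> affected w"
  then have "QM M = Q a * (Q b * QM M)"
    using M by (metis QM_insert finite_insert insert_absorb subsetD)
  then have e: "QM M = Q a * Q b * QM M" by (simp add: mult.assoc)
  show "Tp (swap a b) * QM M = QM M"
  proof (cases "a = b")
    case False
    then show ?thesis using swap_absorb[OF False] by (metis e mult.assoc)
  qed simp
qed (simp_all add: Tp_mult mult.assoc)

text \<open>The choice is harmless: \<open>M\<close> is the set of empty columns of
  \<open>r\<close>, and two admissible permutations differ by one that \<open>QM M\<close>
  absorbs.\<close>

definition Th :: "rook \<Rightarrow> (nat \<Rightarrow> 's) ell2 bop" where
  "Th r = (SOME b. \<exists>p M. finite M \<and> r = perm_rook p * eps M \<and> b = Tp p * QM M)"

lemma Th_perm_eps: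
  assumes "finite M"
  shows "Th (perm_rook p * eps M) = Tp p * QM M"
proof -
  let ?r = "perm_rook p * eps M"
  have "Tp p' * QM M' = Tp p * QM M" if M': "finite M'" "?r = perm_rook p' * eps M'" for p' M'
  proof -
    have e: "i = apply p j \<and> j \<notin> M \<longleftrightarrow> i = apply p' j \<and> j \<notin> M'" for i j
      using entry_perm_eps_iff[OF assms, of p i j] entry_perm_eps_iff[OF M'(1), of p' i j] M'(2) by simp
    then have MM: "M' = M" by blast
    have "affected (inverse p * p') \<subseteq> M"
    proof
      fix x assume x: "x \<in> affected (inverse p * p')"
      show "x \<in> M"
      proof (rule ccontr)
        assume "x \<notin> M"
        then have "apply p' x = apply p x" using e[of "apply p x" x] by simp
        then show False using x by (simp add: in_affected apply_times)
      qed
    qed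
    then have "Tp p * (Tp (inverse p * p') * QM M) = Tp p * QM M"
      using Tp_absorb[OF assms] by simp
    then show ?thesis by (simp add: MM flip: mult.assoc Tp_mult)
  qed
  then show ?thesis
    unfolding Th_def using assms by (intro some_equality) blast+
qed

lemma Th_perm: "Th (perm_rook p) = Tp p"
  using Th_perm_eps[of "{}" p] by simp

lemma Th_eps: "finite M \<Longrightarrow> Th (eps M) = QM M"
  using Th_perm_eps[of M 1] by simp

lemma Th_mult: "Th (r * s) = Th r * Th s"
proof -
  obtain p M where r: "finite M" "r = perm_rook p * eps M" by (rule rook_decomposition)
  obtain p' M' where s: "finite M'" "s = perm_rook p' * eps M'" by (rule rook_decomposition)
  let ?N = "apply (inverse p') ` M"
  have "r * s = perm_rook p * (eps M * perm_rook p') * eps M'"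
    by (simp add: r(2) s(2) mult.assoc)
  also have "\<dots> = perm_rook (p * p') * eps (?N \<union> M')"
    unfolding eps_perm_rook[OF r(1)] using r(1) s(1) by (simp add: perm_rook_mult eps_Un mult.assoc)
  finally have "Th (r * s) = Tp (p * p') * QM (?N \<union> M')"
    using r(1) s(1) Th_perm_eps by simp
  also have "\<dots> = Tp p * (Tp p' * QM ?N) * QM M'"
    using r(1) s(1) by (simp add: Tp_mult QM_Un mult.assoc)
  also have "\<dots> = Tp p * QM M * (Tp p' * QM M')"
    unfolding QM_Tp[OF r(1), symmetric] by (simp add: mult.assoc)
  finally show ?thesis using r s by (simp add: Th_perm_eps)
qed

lemma Th_transpose: "Th (rook_transpose r) = adj (Th r)"
proof -
  obtain p M where r: "finite M" "r = perm_rook p * eps M" by (rule rook_decomposition)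
  have "Th (rook_transpose r) = Th (eps M) * Th (perm_rook (inverse p))"
    by (simp add: r transpose_times transpose_perm_rook transpose_eps Th_mult)
  then show ?thesis using r by (simp add: Th_perm_eps Th_perm Th_eps adj_times adj_Tp adj_QM)
qed

lemma Tp_in:
  assumes p: "affected p \<subseteq> {..<n}" shows "Tp p \<in> tensor_algebra n"
  unfolding tensor_algebra_commutant
proof (intro allI bop_eq_coeffI)
  fix s t :: "nat \<Rightarrow> 's" and x :: "(nat \<Rightarrow> 's) ell2" and i :: "nat \<Rightarrow> 's"
  have fx: "apply p l = l" if "\<not> l < n" for l using p that by (auto simp: in_affected)
  have sp: "splice n (i \<circ> apply p) t = splice n i t \<circ> apply p"
    using apply_lessThan[OF p] fx by (auto simp: splice_def fun_eq_iff)
  have ag: "agree n (i \<circ> apply p) s \<longleftrightarrow> agree n i s"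
    using fx by (auto simp: agree_def)
  have "odd_sites (splice n i t \<circ> apply p) \<inter> {..<n} = odd_sites (i \<circ> apply p) \<inter> {..<n}"
    using apply_lessThan[OF p] by (auto simp: odd_sites_def splice_def)
  then have "psign p (odd_sites (splice n i t \<circ> apply p)) = psign p (odd_sites (i \<circ> apply p))"
    by (simp only: psign_prod[OF p])
  then show "coeff (app (Tp p * tail_unit n s t) x) i = coeff (app (tail_unit n s t * Tp p) x) i"
    by (simp add: app_times coeff_Tp coeff_tail_unit sp ag)
qed

lemma Q_in: "k < n \<Longrightarrow> Q k \<in> tensor_algebra n"
  unfolding Q_def by (intro tensor_algebra_sum tensor_algebra_scaleC site_unit_in)

lemma QM_in: "finite M \<Longrightarrow> M \<subseteq> {..<n} \<Longrightarrow> QM M \<in> tensor_algebra n"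
  by (induct M rule: finite_induct) (auto simp: QM_insert tensor_algebra_one intro!: tensor_algebra_closed Q_in)

lemma Th_in: "\<exists>n. Th r \<in> tensor_algebra n"
proof -
  obtain p M where r: "finite M" "r = perm_rook p * eps M" by (rule rook_decomposition)
  obtain n where n: "affected p \<subseteq> {..<n}" using affected_bounded by blast
  obtain m where m: "M \<subseteq> {..<m}" using finite_nat_bounded[OF r(1)] by blast
  have "affected p \<subseteq> {..<max n m}" "M \<subseteq> {..<max n m}" using n m by auto
  then show ?thesis using r by (metis Th_perm_eps Tp_in QM_in tensor_algebra_closed(1))
qed

end

text \<open>Adjacent transpositions generate the permutations, conjugation by a transposition
  carries \<open>eps {0}\<close> to \<open>eps {k}\<close>, and these multiply to all
  \<open>eps M\<close>.\<close>

lemma rook_hom_unique: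
  assumes T: "\<And>r s. T (r * s) = T r * (T s :: 'a::monoid_mult)" and T': "\<And>r s. T' (r * s) = T' r * T' s"
    and eq: "\<And>k. T (perm_rook (swap k (Suc k))) = T' (perm_rook (swap k (Suc k)))"
    and eps0: "T (eps {0}) = T' (eps {0})"
  shows "T = T'"
proof
  fix r
  obtain p M where r: "finite M" "r = perm_rook p * eps M" by (rule rook_decomposition)
  \<comment> \<open>Preservation of the unit is not among the conditions on \<open>T\<close>; it
    follows from writing 1 as the square of a generator.\<close>
  have one: "T 1 = T' 1"
  proof -
    have "1 = perm_rook (swap 0 (Suc 0)) * perm_rook (swap 0 (Suc 0))"
      by (simp flip: perm_rook_mult)
    then show ?thesis by (metis T T' eq)
  qed
  have p: "T (perm_rook p) = T' (perm_rook p)" for p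
    by (induct p rule: perm_adjacent_induct) (simp_all add: one eq perm_rook_mult T T')
  have ek: "T (eps {k}) = T' (eps {k})" for k
  proof -
    have "eps {k} * perm_rook (swap 0 k) = perm_rook (swap 0 k) * eps {0}"
      by (simp add: eps_perm_rook)
    then have "eps {k} = perm_rook (swap 0 k) * eps {0} * perm_rook (swap 0 k)"
      by (metis (no_types) mult.assoc mult.right_neutral perm_rook_mult perm_rook_one swap_self)
    then show ?thesis by (simp add: T T' p eps0)
  qed
  have "T (eps M) = T' (eps M)"
    using r(1)
  proof (induct M rule: finite_induct)
    case (insert k M)
    then show ?case using eps_Un[of "{k}" M] by (simp add: T T' ek)
  qed (simp add: one)
  then show "T r = T' r" by (simp add: r T T' p)
qed

lemma (in twisted) rook_hom_eq:
  fixes h :: "'s \<Rightarrow> 'h::chilbert_space"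
  assumes h: "ONB h"
    and E: "\<And>s. app (spectral_projection A {-1..<0}) (h s) = (if neg s then h s else 0)"
    and q: "\<And>s t. cinner (app q (h t)) (h s) = v s * cnj (v t)"
  shows "rook_hom h A q = Th"
proof -
  let ?E = "spectral_projection A {-1..<0}"
  have sE: "site h k ?E = diag_weight (\<lambda>i. if neg (i k) then 1 else 0)"
    and sE': "site h k (1 - ?E) = diag_weight (\<lambda>i. if neg (i k) then 0 else 1)" for k
    by (rule site_diag[OF h]; simp add: E app_minus scaleC_one scaleC_0_left)+
  have sign: "sign_op h A k * flip_op h k = Tp (swap k (Suc k))" for k
  proof (rule bop_eq_coeffI)
    fix x :: "(nat \<Rightarrow> 's) ell2" and i :: "nat \<Rightarrow> 's"
    have i: "i(k := i (Suc k), Suc k := i k) = i \<circ> apply (swap k (Suc k))"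
    proof
      fix l show "(i(k := i (Suc k), Suc k := i k)) l = (i \<circ> apply (swap k (Suc k))) l"
        by (cases "l = k"; cases "l = Suc k") simp_all
    qed
    have "coeff (app (sign_op h A k) x) i = (if neg (i k) \<and> neg (i (Suc k)) then -1 else 1) * coeff x i" for x i
      by (simp add: sign_op_def Let_def sE sE' app_simps coeff_diag_weight)
    then show "coeff (app (sign_op h A k * flip_op h k) x) i = coeff (app (Tp (swap k (Suc k))) x) i"
      by (simp add: app_times flip_op_eq[OF h] coeff_flip i coeff_Tp psign_adjacent)
        (auto simp: odd_sites_def)
  qed
  have s0: "site h 0 q = Q 0"
  proof (rule site_eqI)
    fix i j :: "nat \<Rightarrow> 's"
    have "i(0 := j 0) = j \<longleftrightarrow> (\<forall>l. l \<noteq> 0 \<longrightarrow> i l = j l)" by (auto simp: fun_eq_iff)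
    then show "coeff (app (Q 0) (ket j)) i =
        (if \<forall>l. l \<noteq> 0 \<longrightarrow> i l = j l then cinner (app q (h (j 0))) (h (i 0)) else 0)"
      by (auto simp: coeff_Q_ket q)
  qed
  show ?thesis unfolding rook_hom_def
  proof (rule the_equality)
    show "(\<forall>r. Th r \<in> tensor_algebra_inf) \<and> (\<forall>r s. Th (r * s) = Th r * Th s) \<and>
      (\<forall>r. Th (rook_transpose r) = adj (Th r)) \<and>
      (\<forall>k. Th (perm_rook (cycle [k, Suc k])) = sign_op h A k * flip_op h k) \<and>
      Th (eps {0}) = site h 0 q"
      using Th_in by (simp add: tensor_algebra_inf_def Th_mult Th_transpose Th_perm sign s0 Th_eps QM_insert)
  next
    fix T assume T: "(\<forall>r. T r \<in> tensor_algebra_inf) \<and> (\<forall>r s. T (r * s) = T r * T s) \<and>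
      (\<forall>r. T (rook_transpose r) = adj (T r)) \<and>
      (\<forall>k. T (perm_rook (cycle [k, Suc k])) = sign_op h A k * flip_op h k) \<and>
      T (eps {0}) = site h 0 q"
    show "T = Th"
      by (rule rook_hom_unique) (use T in \<open>simp_all add: Th_mult Th_perm sign s0 Th_eps QM_insert\<close>)
  qed
qed

subsection \<open>The product state and its GNS space\<close>

lemma infsum_diff_complex:
  fixes f g :: "'a \<Rightarrow> complex"
  assumes "f summable_on S" "g summable_on S"
  shows "infsum (\<lambda>x. f x - g x) S = infsum f S - infsum g S"
  using infsum_add[OF assms(1), of "\<lambda>x. - g x"] assms(2)
  by (simp add: infsum_uminus summable_on_uminus)

text \<open>The states are diagonal on the matrix units, so the product state sees only diagonal
  entries of an operator and averages them with the probability weights \<open>w l\<close> at the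
  sites \<open>l\<close>.\<close>

locale weighted =
  fixes h :: "'s::wellorder \<Rightarrow> 'h::chilbert_space" and A :: "'h bop" and w :: "nat \<Rightarrow> 's \<Rightarrow> real"
  assumes psi_unit: "\<And>l s t. psi h A l (matrix_unit h s t) = (if s = t then complex_of_real (w l s) else 0)"
    and w_nonneg: "\<And>l s. 0 \<le> w l s" and w_sum: "\<And>l. (w l has_sum 1) UNIV"
begin

definition W :: "nat \<Rightarrow> (nat \<Rightarrow> 's) \<Rightarrow> real" where
  "W n i = (\<Prod>l<n. w l (i l))"

abbreviation Conf :: "nat \<Rightarrow> (nat \<Rightarrow> 's) set" where
  "Conf n \<equiv> {..<n} \<rightarrow>\<^sub>E UNIV"

definition mean :: "nat \<Rightarrow> ((nat \<Rightarrow> 's) \<Rightarrow> complex) \<Rightarrow> complex" where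
  "mean n F = (\<Sum>\<^sub>\<infinity>i\<in>Conf n. F i * complex_of_real (W n i))"

definition phi :: "nat \<Rightarrow> (nat \<Rightarrow> 's) ell2 bop \<Rightarrow> complex" where
  "phi n b = mean n (\<lambda>i. coeff (app b (ket i)) i)"

lemma W_nonneg: "0 \<le> W n i"
  unfolding W_def by (intro prod_nonneg) (simp add: w_nonneg)

lemma W_sum: "(W n has_sum 1) (Conf n)"
proof -
  have "infsum (W n) (Conf n) = (\<Prod>l<n. infsum (w l) UNIV)"
    unfolding W_def
    using infsum_prod_PiE_abs[of "{..<n}" w "\<lambda>_. UNIV"] w_sum
      summable_on_iff_abs_summable_on_real by (force simp: has_sum_iff)
  also have "\<dots> = 1" using w_sum by (simp add: has_sum_iff)
  finally have 1: "infsum (W n) (Conf n) = 1" .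
  then have "W n summable_on Conf n" by (metis infsum_not_exists zero_neq_one)
  then show ?thesis using 1 by (simp add: has_sum_iff)
qed

lemma bounded_summable:
  fixes F :: "(nat \<Rightarrow> 's) \<Rightarrow> complex"
  assumes "\<And>i. i \<in> Conf n \<Longrightarrow> cmod (F i) \<le> C"
  shows "(\<lambda>i. norm (F i * complex_of_real (W n i))) summable_on Conf n"
    "(\<lambda>i. F i * complex_of_real (W n i)) summable_on Conf n"
proof -
  show "(\<lambda>i. norm (F i * complex_of_real (W n i))) summable_on Conf n"
  proof (rule summable_on_comparison_test)
    show "(\<lambda>i. C * W n i) summable_on Conf n"
      using W_sum by (intro summable_on_cmult_right) (auto simp: has_sum_iff)
    show "norm (F i * complex_of_real (W n i)) \<le> C * W n i" if "i \<in> Conf n" for i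
      using assms[OF that] W_nonneg[of n i] by (simp add: norm_mult mult_right_mono)
  qed simp
  then show "(\<lambda>i. F i * complex_of_real (W n i)) summable_on Conf n"
    by (rule abs_summable_summable)
qed

lemma norm_ket [simp]: "norm (ket i) = 1"
  by (rule ONB_norm_1[OF ONB_ket])

lemma norm_app_ket: "norm (app b (ket i)) \<le> onorm (app b)"
  using norm_app[of b "ket i"] by simp

lemma norm_coeff_le: "cmod (coeff x i) \<le> norm x"
  using norm_cinner[of x "ket i"] by (simp add: cinner_ket)

lemma product_state_eq: "product_state h A n b = phi n b"
proof -
  let ?F = "\<lambda>(i, j). cinner (app b (ket j)) (ket i) * (\<Prod>l<n. psi h A l (matrix_unit h (i l) (j l)))"
  have p: "(\<Prod>l<n. psi h A l (matrix_unit h (i l) (j l))) = (if i = j then complex_of_real (W n i) else 0)"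
    if "i \<in> Conf n" "j \<in> Conf n" for i j
  proof (cases "i = j")
    case True then show ?thesis by (simp add: W_def psi_unit)
  next
    case False
    have "\<exists>l<n. i l \<noteq> j l"
    proof (rule ccontr)
      assume "\<not> (\<exists>l<n. i l \<noteq> j l)"
      then have "i = j" by (intro PiE_ext[OF that]) auto
      then show False using False by simp
    qed
    then obtain l where l: "l < n" "i l \<noteq> j l" by blast
    have "(\<Prod>l<n. psi h A l (matrix_unit h (i l) (j l))) = 0"
      by (rule prod_zero) (use l in \<open>auto simp: psi_unit\<close>)
    then show ?thesis using False by simp
  qed
  have "product_state h A n b = infsum ?F (Conf n \<times> Conf n)" by (simp add: product_state_def)
  also have "\<dots> = infsum ?F ((\<lambda>i. (i, i)) ` Conf n)"
    by (rule infsum_cong_neutral) (auto simp: p)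
  also have "\<dots> = infsum (?F \<circ> (\<lambda>i. (i, i))) (Conf n)"
    by (rule infsum_reindex) (simp add: inj_on_def)
  also have "\<dots> = phi n b"
    unfolding phi_def mean_def by (rule infsum_cong) (simp add: p cinner_ket)
  finally show ?thesis .
qed

lemma Conf_Suc: "Conf (Suc n) = (\<lambda>(g, y). g(n := y)) ` (Conf n \<times> UNIV)"
  by (auto simp: lessThan_Suc PiE_insert_eq image_iff)

lemma Conf_inj: "inj_on (\<lambda>(g, y). g(n := y)) (Conf n \<times> (UNIV :: 's set))"
  using inj_combinator'[of n "{..<n}" "\<lambda>_. UNIV"] by simp

text \<open>Fubini in the last coordinate; the bound on \<open>F\<close> makes the family absolutely
  summable.\<close>

lemma mean_Suc:
  assumes F: "\<And>i. cmod (F i) \<le> C"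
  shows "mean (Suc n) F = mean n (\<lambda>g. \<Sum>\<^sub>\<infinity>y. F (g(n := y)) * complex_of_real (w n y))"
proof -
  define G where "G i = F i * complex_of_real (W (Suc n) i)" for i
  have Fs: "G (g(n := y)) = F (g(n := y)) * complex_of_real (w n y) * complex_of_real (W n g)" for g y
    by (simp add: W_def G_def)
  have "G summable_on Conf (Suc n)" unfolding G_def[abs_def] by (rule bounded_summable) (rule F)
  then have s: "(G \<circ> (\<lambda>(g, y). g(n := y))) summable_on (Conf n \<times> UNIV)"
    unfolding Conf_Suc by (simp add: summable_on_reindex[OF Conf_inj])
  have "mean (Suc n) F = infsum G (Conf (Suc n))" by (simp add: mean_def G_def[abs_def])
  also have "\<dots> = infsum (G \<circ> (\<lambda>(g, y). g(n := y))) (Conf n \<times> UNIV)"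
    unfolding Conf_Suc by (rule infsum_reindex[OF Conf_inj])
  also have "\<dots> = (\<Sum>\<^sub>\<infinity>g\<in>Conf n. \<Sum>\<^sub>\<infinity>y. G (g(n := y)))"
    using infsum_Sigma_banach[OF s] by simp
  finally show ?thesis unfolding mean_def Fs infsum_cmult_left' .
qed

lemma w_has_sum: "((\<lambda>y. complex_of_real (w n y)) has_sum 1) UNIV"
proof -
  have "((\<lambda>y. complex_of_real (w n y)) has_sum complex_of_real 1) UNIV"
    using w_sum by (simp only: has_sum_of_real_iff)
  then show ?thesis by simp
qed

lemma mean_cong: "(\<And>i. i \<in> Conf n \<Longrightarrow> F i = G i) \<Longrightarrow> mean n F = mean n G"
  unfolding mean_def by (rule infsum_cong) simp

lemma coeff_bound: "cmod (coeff (app b (ket j)) i) \<le> onorm (app b)"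
  by (rule order_trans[OF norm_coeff_le norm_app_ket])

text \<open>The diagonal entries do not depend on the additional factor, which contributes only its
  total mass 1. Thus the choice of the least \<open>n\<close> in \<open>product_state_inf\<close> is
  immaterial.\<close>

lemma phi_Suc:
  assumes b: "b \<in> tensor_algebra n" shows "phi (Suc n) b = phi n b"
  unfolding phi_def mean_Suc[OF coeff_bound]
proof (rule mean_cong)
  fix g assume g: "g \<in> Conf n"
  have c: "coeff (app b (ket (g(n := y)))) (g(n := y)) = coeff (app b (ket g)) g" for y
  proof -
    have "restrict (g(n := y)) {..<n} = g" using g by (auto simp: fun_eq_iff PiE_def extensional_def)
    then show ?thesis using b[unfolded tensor_algebra_entries, rule_format, of "g(n := y)" "g(n := y)"] by simp
  qed
  show "(\<Sum>\<^sub>\<infinity>y. coeff (app b (ket (g(n := y)))) (g(n := y)) * complex_of_real (w n y)) = coeff (app b (ket g)) g"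
    unfolding c infsum_cmult_right' using infsumI[OF w_has_sum] by simp
qed

lemma phi_mono:
  assumes "b \<in> tensor_algebra n" "n \<le> m" shows "phi m b = phi n b"
  using assms(2)
proof (induct m rule: dec_induct)
  case (step k)
  then show ?case using phi_Suc[of b k] tensor_algebra_mono[OF assms(1)] by simp
qed simp

lemma product_state_inf_eq:
  assumes "b \<in> tensor_algebra n" shows "product_state_inf h A b = phi n b"
  unfolding product_state_inf_def product_state_eq
  by (rule phi_mono[symmetric]) (auto intro: LeastI Least_le assms)

text \<open>The form becomes an average of ordinary inner products of the images of kets, so
  positivity, Hermitian symmetry and operator bounds can all be checked term by term.\<close>

lemma gns_eq:
  assumes "u \<in> tensor_algebra n" "v \<in> tensor_algebra n"
  shows "gns_form h A v u = (\<Sum>\<^sub>\<infinity>i\<in>Conf n. cinner (app v (ket i)) (app u (ket i)) * complex_of_real (W n i))"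
proof -
  have "adj u * v \<in> tensor_algebra n" by (intro tensor_algebra_closed tensor_algebra_adj assms)
  then show ?thesis
    unfolding gns_form_def product_state_inf_eq phi_def
    by (simp add: product_state_inf_eq phi_def mean_def app_times cinner_adj' flip: cinner_ket)
qed

lemma gns_summable:
  "(\<lambda>i. norm (cinner (app v (ket i)) (app u (ket i)) * complex_of_real (W n i))) summable_on Conf n"
  "(\<lambda>i. cinner (app v (ket i)) (app u (ket i)) * complex_of_real (W n i)) summable_on Conf n"
proof -
  have "cmod (cinner (app v (ket i)) (app u (ket i))) \<le> onorm (app v) * onorm (app u)" for i
    by (rule order_trans[OF norm_cinner])
      (intro mult_mono norm_app_ket onorm_pos_le bounded_linear_app norm_ge_zero)
  then show "(\<lambda>i. norm (cinner (app v (ket i)) (app u (ket i)) * complex_of_real (W n i))) summable_on Conf n"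
    "(\<lambda>i. cinner (app v (ket i)) (app u (ket i)) * complex_of_real (W n i)) summable_on Conf n"
    by (rule bounded_summable(1), rule bounded_summable(2))
qed

section \<open>The semidefinite form on the union of the tensor powers\<close>

abbreviation TA :: "(nat \<Rightarrow> 's) ell2 bop set" where "TA \<equiv> tensor_algebra_inf"

lemma TA_common:
  assumes "u \<in> TA" "v \<in> TA" obtains n where "u \<in> tensor_algebra n" "v \<in> tensor_algebra n"
proof -
  obtain k l where "u \<in> tensor_algebra k" "v \<in> tensor_algebra l"
    using assms by (auto simp: tensor_algebra_inf_def)
  then have "u \<in> tensor_algebra (max k l)" "v \<in> tensor_algebra (max k l)"
    using tensor_algebra_mono by (metis max.cobounded1, metis max.cobounded2)
  then show ?thesis using that by blast
qed

lemma TA_I: "u \<in> tensor_algebra n \<Longrightarrow> u \<in> TA"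
  by (auto simp: tensor_algebra_inf_def)

lemma TA_diff: "u \<in> TA \<Longrightarrow> v \<in> TA \<Longrightarrow> u - v \<in> TA"
  by (metis TA_common TA_I tensor_algebra_closed(2))

lemma TA_times: "u \<in> TA \<Longrightarrow> v \<in> TA \<Longrightarrow> u * v \<in> TA"
  by (metis TA_common TA_I tensor_algebra_closed(1))

lemma TA_one: "1 \<in> TA"
  using TA_I tensor_algebra_one by blast

lemma gns_diff_left:
  assumes "u \<in> TA" "v \<in> TA" "x \<in> TA"
  shows "gns_form h A (u - v) x = gns_form h A u x - gns_form h A v x"
proof -
  obtain k where k: "u \<in> tensor_algebra k" "v \<in> tensor_algebra k" using assms TA_common by metis
  obtain l where l: "x \<in> tensor_algebra l" using assms(3) by (auto simp: tensor_algebra_inf_def)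
  define n where "n = max k l"
  have n: "u \<in> tensor_algebra n" "v \<in> tensor_algebra n" "x \<in> tensor_algebra n"
    using k l tensor_algebra_mono unfolding n_def by (metis max.cobounded1 max.cobounded2)+
  show ?thesis
    unfolding gns_eq[OF n(3) n(1)] gns_eq[OF n(3) n(2)] gns_eq[OF n(3) tensor_algebra_closed(2)[OF n(1,2)]]
      infsum_diff_complex[OF gns_summable(2) gns_summable(2), symmetric]
    by (intro infsum_cong) (simp add: app_minus cinner_diff_left algebra_simps)
qed

lemma gns_commute:
  assumes "u \<in> TA" "v \<in> TA" shows "gns_form h A u v = cnj (gns_form h A v u)"
proof -
  obtain n where n: "u \<in> tensor_algebra n" "v \<in> tensor_algebra n" using assms TA_common by metis
  show ?thesis
    unfolding gns_eq[OF n] gns_eq[OF n(2,1)] infsum_cnj[symmetric]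
    by (intro infsum_cong) (simp flip: cinner_commute)
qed

lemma gns_diff_right:
  assumes "u \<in> TA" "v \<in> TA" "x \<in> TA"
  shows "gns_form h A x (u - v) = gns_form h A x u - gns_form h A x v"
  using gns_diff_left[OF assms] assms gns_commute TA_diff by (metis complex_cnj_diff)

text \<open>The squared GNS seminorm; null vectors are possible, so it is handled as a real-valued
  function and not as a norm on a type.\<close>

definition N2 :: "(nat \<Rightarrow> 's) ell2 bop \<Rightarrow> real" where
  "N2 u = Re (gns_form h A u u)"

lemma N2_has_sum:
  assumes n: "u \<in> tensor_algebra n"
  shows "((\<lambda>i. (norm (app u (ket i)))\<^sup>2 * W n i) has_sum N2 u) (Conf n)"
    "gns_form h A u u = complex_of_real (N2 u)"
proof -
  have e: "cinner (app u (ket i)) (app u (ket i)) * complex_of_real (W n i) =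
      complex_of_real ((norm (app u (ket i)))\<^sup>2 * W n i)" for i
    by (simp add: cinner_same)
  have H: "((\<lambda>i. complex_of_real ((norm (app u (ket i)))\<^sup>2 * W n i)) has_sum gns_form h A u u) (Conf n)"
    unfolding gns_eq[OF n n] e using gns_summable(2)[of u u n] by (simp only: e has_sum_infsum)
  show 1: "((\<lambda>i. (norm (app u (ket i)))\<^sup>2 * W n i) has_sum N2 u) (Conf n)"
    using has_sum_Re[OF H] by (simp only: N2_def Re_complex_of_real)
  then have "((\<lambda>i. complex_of_real ((norm (app u (ket i)))\<^sup>2 * W n i)) has_sum complex_of_real (N2 u)) (Conf n)"
    by (simp only: has_sum_of_real_iff)
  from has_sum_unique[OF H this] show "gns_form h A u u = complex_of_real (N2 u)" .
qed

lemma TA_E: "u \<in> TA \<Longrightarrow> (\<And>n. u \<in> tensor_algebra n \<Longrightarrow> P) \<Longrightarrow> P"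
  unfolding tensor_algebra_inf_def by blast

lemma N2_nonneg: "u \<in> TA \<Longrightarrow> 0 \<le> N2 u"
  by (erule TA_E, rule has_sum_nonneg[OF N2_has_sum(1)], assumption) (simp add: W_nonneg)

lemma gns_self: "u \<in> TA \<Longrightarrow> gns_form h A u u = complex_of_real (N2 u)"
  by (erule TA_E, rule N2_has_sum(2))

lemma N2_zero [simp]: "N2 0 = 0"
proof -
  have "(0 :: (nat \<Rightarrow> 's) ell2 bop) \<in> TA" using TA_diff[OF TA_one TA_one] by simp
  then have "gns_form h A (0 - 0) 0 = 0" using gns_diff_left[of 0 0 0] by simp
  then show ?thesis by (simp add: N2_def)
qed

text \<open>The weighted form of the arithmetic-geometric inequality, summed over all
  configurations. The free parameter \<open>d\<close> lets it play the part of Cauchy-Schwarz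
  without square roots of \<open>N2\<close>.\<close>

lemma gns_bound:
  assumes "u \<in> TA" "v \<in> TA" "0 < d"
  shows "2 * cmod (gns_form h A v u) \<le> d * N2 v + N2 u / d"
proof -
  obtain n where n: "u \<in> tensor_algebra n" "v \<in> tensor_algebra n" using assms TA_common by metis
  let ?c = "\<lambda>i. cinner (app v (ket i)) (app u (ket i)) * complex_of_real (W n i)"
  let ?r = "\<lambda>i. d * ((norm (app v (ket i)))\<^sup>2 * W n i) + (norm (app u (ket i)))\<^sup>2 * W n i / d"
  have R: "(?r has_sum (d * N2 v + N2 u / d)) (Conf n)"
    unfolding divide_inverse
    by (intro has_sum_add has_sum_cmult_right has_sum_cmult_left N2_has_sum n)
  have le: "2 * norm (?c i) \<le> ?r i" for i
  proof -
    let ?a = "norm (app v (ket i))" and ?b = "norm (app u (ket i))"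
    have "0 \<le> (sqrt d * ?a - ?b / sqrt d)\<^sup>2" by simp
    also have "\<dots> = d * ?a\<^sup>2 + ?b\<^sup>2 / d - 2 * (?a * ?b)"
      using assms(3) by (simp add: power2_diff power_mult_distrib power_divide)
    finally have "2 * cmod (cinner (app v (ket i)) (app u (ket i))) \<le> d * ?a\<^sup>2 + ?b\<^sup>2 / d"
      using norm_cinner[of "app v (ket i)" "app u (ket i)"] by linarith
    from mult_right_mono[OF this W_nonneg[of n i]]
    show ?thesis using W_nonneg[of n i] by (simp add: norm_mult algebra_simps)
  qed
  have "2 * cmod (gns_form h A v u) \<le> 2 * (\<Sum>\<^sub>\<infinity>i\<in>Conf n. norm (?c i))"
    unfolding gns_eq[OF n] using norm_infsum_bound[OF gns_summable(1)] by simp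
  also have "\<dots> = (\<Sum>\<^sub>\<infinity>i\<in>Conf n. 2 * norm (?c i))" by (simp add: infsum_cmult_right')
  also have "\<dots> \<le> infsum ?r (Conf n)"
    by (intro infsum_mono le summable_on_cmult_right gns_summable) (use R in \<open>simp add: has_sum_iff\<close>)
  also have "\<dots> = d * N2 v + N2 u / d" using R by (rule infsumI)
  finally show ?thesis .
qed

lemma N2_triangle:
  assumes "u \<in> TA" "v \<in> TA" "x \<in> TA"
  shows "N2 (u - v) \<le> 2 * N2 (u - x) + 2 * N2 (x - v)"
proof -
  let ?a = "u - x" and ?b = "v - x"
  have ab: "?a \<in> TA" "?b \<in> TA" using assms TA_diff by blast+
  have "gns_form h A (?a - ?b) (?a - ?b) =
      gns_form h A ?a ?a - gns_form h A ?a ?b - (gns_form h A ?b ?a - gns_form h A ?b ?b)"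
    using ab by (simp only: gns_diff_left gns_diff_right TA_diff) simp
  then have "N2 (?a - ?b) = N2 ?a + N2 ?b - Re (gns_form h A ?a ?b) - Re (gns_form h A ?b ?a)"
    by (simp add: N2_def)
  moreover have "- Re (gns_form h A ?a ?b) \<le> cmod (gns_form h A ?a ?b)"
    "- Re (gns_form h A ?b ?a) \<le> cmod (gns_form h A ?b ?a)"
    using abs_Re_le_cmod[of "gns_form h A ?a ?b"] abs_Re_le_cmod[of "gns_form h A ?b ?a"] by linarith+
  moreover have "2 * cmod (gns_form h A ?a ?b) \<le> N2 ?a + N2 ?b" "2 * cmod (gns_form h A ?b ?a) \<le> N2 ?b + N2 ?a"
    using gns_bound[OF ab(2,1), of 1] gns_bound[OF ab(1,2), of 1] by simp_all
  moreover have "N2 (x - v) = N2 ?b"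
    using gns_diff_left gns_diff_right assms TA_diff by (simp add: N2_def)
  ultimately show ?thesis by simp
qed

lemma N2_swap:
  assumes "u \<in> TA" "v \<in> TA" shows "N2 (u - v) = N2 (v - u)"
  using assms by (simp add: N2_def gns_diff_left gns_diff_right TA_diff)

lemma N2_left_mult:
  assumes "b \<in> TA" "u \<in> TA"
  shows "N2 (b * u) \<le> (onorm (app b))\<^sup>2 * N2 u"
proof -
  obtain n where n: "b \<in> tensor_algebra n" "u \<in> tensor_algebra n" using assms TA_common by metis
  show ?thesis
  proof (rule has_sum_mono[OF N2_has_sum(1)[OF tensor_algebra_closed(1)[OF n]]
        has_sum_cmult_right[OF N2_has_sum(1)[OF n(2)]]])
    fix i
    have "(norm (app (b * u) (ket i)))\<^sup>2 \<le> (onorm (app b) * norm (app u (ket i)))\<^sup>2"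
      unfolding app_times by (intro power_mono norm_app) simp
    then show "(norm (app (b * u) (ket i)))\<^sup>2 * W n i \<le> (onorm (app b))\<^sup>2 * ((norm (app u (ket i)))\<^sup>2 * W n i)"
      using W_nonneg[of n i] by (simp add: power_mult_distrib mult_right_mono flip: mult.assoc)
  qed
qed

subsection \<open>Matrix coefficients of the cyclic vector\<close>

abbreviation nullrel where "nullrel \<equiv> null_rel TA (gns_form h A)"

lemma cauchy_TA: "x \<in> cauchy_seqs TA (gns_form h A) \<Longrightarrow> x n \<in> TA"
  by (simp add: cauchy_seqs_def)

lemma nullrel_iff:
  "(x, y) \<in> nullrel \<longleftrightarrow> x \<in> cauchy_seqs TA (gns_form h A) \<and> y \<in> cauchy_seqs TA (gns_form h A) \<and>
    (\<lambda>n. N2 (x n - y n)) \<longlonglongrightarrow> 0"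
proof -
  have "gns_form h A (x n - y n) (x n - y n) = complex_of_real (N2 (x n - y n))"
    if "x \<in> cauchy_seqs TA (gns_form h A)" "y \<in> cauchy_seqs TA (gns_form h A)" for n
    using that by (intro gns_self TA_diff cauchy_TA)
  moreover have "(\<lambda>n. complex_of_real (N2 (x n - y n))) \<longlonglongrightarrow> 0 \<longleftrightarrow> (\<lambda>n. N2 (x n - y n)) \<longlonglongrightarrow> 0"
    using tendsto_of_real_iff[of "\<lambda>n. N2 (x n - y n)" 0 sequentially, where 'a = complex] by simp
  ultimately show ?thesis unfolding null_rel_def by auto
qed

lemma const_cauchy: "u \<in> TA \<Longrightarrow> (\<lambda>_. u) \<in> cauchy_seqs TA (gns_form h A)"
  by (simp add: cauchy_seqs_def flip: N2_def)

lemma nullrel_refl: "x \<in> cauchy_seqs TA (gns_form h A) \<Longrightarrow> (x, x) \<in> nullrel"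
  by (simp add: nullrel_iff)

lemma nullrel_trans:
  assumes "(x, y) \<in> nullrel" "(y, z) \<in> nullrel" shows "(x, z) \<in> nullrel"
proof -
  have c: "x \<in> cauchy_seqs TA (gns_form h A)" "y \<in> cauchy_seqs TA (gns_form h A)"
    "z \<in> cauchy_seqs TA (gns_form h A)" using assms by (auto simp: nullrel_iff)
  have "(\<lambda>n. N2 (x n - z n)) \<longlonglongrightarrow> 0"
  proof (rule tendsto_sandwich[where f = "\<lambda>_. 0" and h = "\<lambda>n. 2 * N2 (x n - y n) + 2 * N2 (y n - z n)"])
    have "(\<lambda>n. 2 * N2 (x n - y n) + 2 * N2 (y n - z n)) \<longlonglongrightarrow> 2 * 0 + 2 * 0"
      using assms by (intro tendsto_intros) (auto simp: nullrel_iff)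
    then show "(\<lambda>n. 2 * N2 (x n - y n) + 2 * N2 (y n - z n)) \<longlonglongrightarrow> 0" by simp
    show "\<forall>\<^sub>F n in sequentially. 0 \<le> N2 (x n - z n)"
      by (intro always_eventually allI N2_nonneg TA_diff c[THEN cauchy_TA])
    show "\<forall>\<^sub>F n in sequentially. N2 (x n - z n) \<le> 2 * N2 (x n - y n) + 2 * N2 (y n - z n)"
      by (intro always_eventually allI N2_triangle c[THEN cauchy_TA])
  qed simp
  then show ?thesis using c by (simp add: nullrel_iff)
qed

lemma gns_null:
  assumes x: "\<And>n. x n \<in> TA" "(\<lambda>n. N2 (x n)) \<longlonglongrightarrow> 0" and y: "\<And>n. y n \<in> TA" "\<And>n. N2 (y n) \<le> B"
  shows "(\<lambda>n. gns_form h A (x n) (y n)) \<longlonglongrightarrow> 0"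
proof (rule LIMSEQ_I)
  fix r :: real assume r: "0 < r"
  have B: "0 \<le> B" using N2_nonneg[OF y(1)[of 0]] y(2)[of 0] by linarith
  \<comment> \<open>Chosen so that \<open>B / d\<close> stays below \<open>r\<close>, while
    \<open>d * N2 (x n)\<close> eventually does so too. The added 1 keeps \<open>d\<close> positive
    when \<open>B = 0\<close>.\<close>
  define d where "d = (B + 1) / r"
  have d: "d > 0" using r B by (simp add: d_def)
  have "r / d > 0" using r d by simp
  then obtain K where K: "\<And>n. n \<ge> K \<Longrightarrow> norm (N2 (x n) - 0) < r / d"
    using LIMSEQ_D[OF x(2)] by blast
  show "\<exists>K. \<forall>n\<ge>K. norm (gns_form h A (x n) (y n) - 0) < r"
  proof (intro exI allI impI)
    fix n assume "n \<ge> K"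
    then have "d * N2 (x n) < r" using K[of n] d N2_nonneg[OF x(1)[of n]] by (simp add: field_simps)
    moreover have "N2 (y n) / d \<le> B / d" using y(2) d by (simp add: divide_right_mono)
    moreover have "B / d \<le> r" unfolding d_def using r B by (simp add: field_simps)
    ultimately have "2 * cmod (gns_form h A (x n) (y n)) < 2 * r"
      using gns_bound[OF y(1)[of n] x(1)[of n] d] by linarith
    then show "norm (gns_form h A (x n) (y n) - 0) < r" by simp
  qed
qed

text \<open>The inner product of the completion is the common limit over all representatives, and
  \<open>left_mult\<close> itself involves a choice of representative. Every choice has to be
  compared with the constant sequences \<open>b\<close> and 1, which also pin down the
  limit.\<close>

lemma completion_inner_left_mult:
  assumes b: "b \<in> TA"
  shows "completion_inner (gns_form h A) (left_mult h A b (xi0 h A)) (xi0 h A) = gns_form h A b 1"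
proof -
  have xi: "x \<in> xi0 h A \<longleftrightarrow> ((\<lambda>_. 1), x) \<in> nullrel" for x
    by (simp add: xi0_def completion_embed_def)
  have X: "z \<in> left_mult h A b (xi0 h A) \<longleftrightarrow> (\<exists>x\<in>xi0 h A. ((\<lambda>n. b * x n), z) \<in> nullrel)" for z
    by (simp add: left_mult_def completion_map_def)
  have one: "(\<lambda>_. 1) \<in> xi0 h A" unfolding xi by (intro nullrel_refl const_cauchy TA_one)
  have bX: "(\<lambda>_. b) \<in> left_mult h A b (xi0 h A)"
    unfolding X using nullrel_refl[OF const_cauchy[OF b]] by (intro bexI[OF _ one]) simp
  have lim: "(\<lambda>n. gns_form h A (z n) (y n)) \<longlonglongrightarrow> gns_form h A b 1"
    if z: "z \<in> left_mult h A b (xi0 h A)" and y: "y \<in> xi0 h A" for z y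
  proof -
    obtain x where x: "x \<in> xi0 h A" "((\<lambda>n. b * x n), z) \<in> nullrel" using z X by blast
    have TA: "x n \<in> TA" "y n \<in> TA" "z n \<in> TA" for n
      using x y unfolding xi nullrel_iff by (auto intro: cauchy_TA)
    have "(\<lambda>n. N2 (b * x n - z n)) \<longlonglongrightarrow> 0"
      using x(2) by (simp add: nullrel_iff)
    then have n1: "(\<lambda>n. N2 (z n - b * x n)) \<longlonglongrightarrow> 0"
      unfolding N2_swap[OF TA_times[OF b TA(1)] TA(3)] .
    have "(\<lambda>n. N2 (1 - x n)) \<longlonglongrightarrow> 0" "(\<lambda>n. N2 (1 - y n)) \<longlonglongrightarrow> 0"
      using x(1) y unfolding xi by (simp_all add: nullrel_iff)
    then have n2: "(\<lambda>n. N2 (x n - 1)) \<longlonglongrightarrow> 0" and n3: "(\<lambda>n. N2 (y n - 1)) \<longlonglongrightarrow> 0"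
      unfolding N2_swap[OF TA_one TA(1)] N2_swap[OF TA_one TA(2)] .
    have n2': "(\<lambda>n. N2 (b * (x n - 1))) \<longlonglongrightarrow> 0"
    proof (rule tendsto_sandwich[where f = "\<lambda>_. 0" and h = "\<lambda>n. (onorm (app b))\<^sup>2 * N2 (x n - 1)"])
      show "(\<lambda>n. (onorm (app b))\<^sup>2 * N2 (x n - 1)) \<longlonglongrightarrow> 0"
        using tendsto_mult_right_zero[OF n2] by blast
    qed (use TA b in \<open>auto intro!: always_eventually N2_left_mult N2_nonneg TA_diff TA_times TA_one\<close>)
    obtain C where C: "\<And>n. \<bar>N2 (y n - 1)\<bar> \<le> C"
      using n3 Bseq_eq_bounded[of "\<lambda>n. N2 (y n - 1)"] convergent_imp_Bseq convergentI BseqE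
      by (metis real_norm_def)
    have yB: "N2 (y n) \<le> 2 * C + 2 * N2 1" for n
    proof -
      have "N2 (y n - 0) \<le> 2 * N2 (y n - 1) + 2 * N2 (1 - 0)"
        using TA TA_one TA_diff[OF TA_one TA_one] by (intro N2_triangle) auto
      then show ?thesis using C[of n] by simp
    qed
    have l1: "(\<lambda>n. gns_form h A (z n - b * x n) (y n)) \<longlonglongrightarrow> 0"
      by (rule gns_null[OF _ n1 TA(2) yB]) (use TA b in \<open>auto intro: TA_diff TA_times\<close>)
    have l2: "(\<lambda>n. gns_form h A (b * (x n - 1)) (y n)) \<longlonglongrightarrow> 0"
      by (rule gns_null[OF _ n2' TA(2) yB]) (use TA b in \<open>auto intro: TA_diff TA_times TA_one\<close>)
    have "(\<lambda>n. gns_form h A (y n - 1) b) \<longlonglongrightarrow> 0"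
      by (rule gns_null[OF _ n3 b order_refl]) (use TA in \<open>auto intro: TA_diff TA_one\<close>)
    then have "(\<lambda>n. cnj (gns_form h A (y n - 1) b)) \<longlonglongrightarrow> cnj 0" by (rule tendsto_cnj)
    then have l3: "(\<lambda>n. gns_form h A b (y n - 1)) \<longlonglongrightarrow> 0"
      using gns_commute[OF b TA_diff[OF TA(2) TA_one]] by simp
    \<comment> \<open>The telescoping sum exchanges one sequence at a time: \<open>z\<close> for
      \<open>b * x\<close>, then \<open>x\<close> for 1, then \<open>y\<close> for 1.\<close>
    have "gns_form h A (z n) (y n) = gns_form h A (z n - b * x n) (y n) +
        gns_form h A (b * (x n - 1)) (y n) + gns_form h A b (y n - 1) + gns_form h A b 1" for n
      using TA b by (simp add: right_diff_distrib gns_diff_left gns_diff_right TA_diff TA_times TA_one)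
    then show ?thesis
      using tendsto_add[OF tendsto_add[OF tendsto_add[OF l1 l2] l3] tendsto_const[of "gns_form h A b 1"]]
      by simp
  qed
  show ?thesis unfolding completion_inner_def
  proof (rule the_equality)
    fix c assume "\<forall>x\<in>left_mult h A b (xi0 h A). \<forall>y\<in>xi0 h A. (\<lambda>n. gns_form h A (x n) (y n)) \<longlonglongrightarrow> c"
    then show "c = gns_form h A b 1" using bX one lim LIMSEQ_unique by blast
  qed (use lim in blast)
qed

text \<open>It places the cyclic vector in the closed span. This matters because \<open>pi0\<close>
  is a restriction and takes an arbitrary value off that span.\<close>

lemma left_mult_one: "left_mult h A 1 (xi0 h A) = xi0 h A"
proof -
  have xi: "x \<in> xi0 h A \<longleftrightarrow> ((\<lambda>_. 1), x) \<in> nullrel" for x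
    by (simp add: xi0_def completion_embed_def)
  have X: "z \<in> left_mult h A 1 (xi0 h A) \<longleftrightarrow> (\<exists>x\<in>xi0 h A. (x, z) \<in> nullrel)" for z
    by (simp add: left_mult_def completion_map_def)
  have "(z, z) \<in> nullrel" if "z \<in> xi0 h A" for z
    using that unfolding xi by (intro nullrel_refl) (simp add: nullrel_iff)
  then show ?thesis using X xi nullrel_trans by blast
qed

lemma rook_function_eq:
  assumes T: "rook_hom h A q = T" and one: "T 1 = 1" and b: "T r \<in> tensor_algebra n"
  shows "rook_function h A q r = phi n (T r)"
proof -
  have "xi0 h A \<in> range (\<lambda>r. Pi_rep h A q r (xi0 h A))"
    using left_mult_one by (intro range_eqI[of _ _ 1]) (simp add: Pi_rep_def T one)
  then have "xi0 h A \<in> pi0_space h A q"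
    unfolding pi0_space_def closed_span_def by blast
  then have "rook_function h A q r =
      completion_inner (gns_form h A) (left_mult h A (T r) (xi0 h A)) (xi0 h A)"
    by (simp add: rook_function_def pi0_def Pi_rep_def T)
  also have "\<dots> = gns_form h A (T r) 1" by (rule completion_inner_left_mult[OF TA_I[OF b]])
  also have "\<dots> = phi n (T r)"
    unfolding gns_eq[OF tensor_algebra_one b] phi_def mean_def by (simp add: cinner_ket)
  finally show ?thesis .
qed

end

subsection \<open>Independence of operators with disjoint supports\<close>

lemma (in weighted) mean_one [simp]: "mean n (\<lambda>_. 1) = 1"
proof -
  have "((\<lambda>i. complex_of_real (W n i)) has_sum complex_of_real 1) (Conf n)"
    using W_sum by (simp only: has_sum_of_real_iff)
  then show ?thesis unfolding mean_def by (simp add: infsumI)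
qed

definition depends_on :: "nat set \<Rightarrow> ((nat \<Rightarrow> 's) \<Rightarrow> complex) \<Rightarrow> bool" where
  "depends_on S F \<longleftrightarrow> (\<forall>i j. (\<forall>k\<in>S. i k = j k) \<longrightarrow> F i = F j)"

lemma depends_on_upd: "depends_on S F \<Longrightarrow> k \<notin> S \<Longrightarrow> F (i(k := y)) = F i"
  unfolding depends_on_def by (metis fun_upd_other)

lemma depends_on_mono: "depends_on S F \<Longrightarrow> S \<subseteq> S' \<Longrightarrow> depends_on S' F"
  unfolding depends_on_def by blast

lemma depends_on_mult: "depends_on S F \<Longrightarrow> depends_on S' G \<Longrightarrow> depends_on (S \<union> S') (\<lambda>i. F i * G i)"
  unfolding depends_on_def by (metis UnCI)

text \<open>Integrate out the last site: at most one of the two functions depends on it, so the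
  other passes through the sum. What remains depends on the same sites with the same bounds.\<close>

lemma (in weighted) mean_mult:
  assumes "S \<inter> S' = {}" "depends_on S F" "depends_on S' G"
    and "\<And>i. cmod (F i) \<le> C" "\<And>i. cmod (G i) \<le> C'"
  shows "mean n (\<lambda>i. F i * G i) = mean n F * mean n G"
  using assms(2-5)
proof (induct n arbitrary: F G)
  case 0
  then show ?case by (simp add: mean_def W_def)
next
  case (Suc n)
  define I where "I H g = (\<Sum>\<^sub>\<infinity>y. H (g(n := y)) * complex_of_real (w n y))" for H :: "(nat \<Rightarrow> 's) \<Rightarrow> complex" and g
  have const: "I H g = H g" if "depends_on R H" "n \<notin> R" for H g R
    unfolding I_def using depends_on_upd[OF that] infsumI[OF w_has_sum[of n]]
    by (simp add: infsum_cmult_right')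
  have dep: "depends_on R (I H)" if "depends_on R H" for H R
    unfolding depends_on_def
  proof (intro allI impI)
    fix i j :: "nat \<Rightarrow> 's" assume "\<forall>k\<in>R. i k = j k"
    then have "H (i(n := y)) = H (j(n := y))" for y using that unfolding depends_on_def by (metis fun_upd_apply)
    then show "I H i = I H j" by (simp add: I_def)
  qed
  have bd: "cmod (I H g) \<le> K" if H: "\<And>i. cmod (H i) \<le> K" for H g K
  proof -
    have s: "(\<lambda>y. norm (H (g(n := y)) * complex_of_real (w n y))) summable_on UNIV"
    proof (rule summable_on_comparison_test)
      show "(\<lambda>y. K * w n y) summable_on UNIV"
        using w_sum by (intro summable_on_cmult_right) (auto simp: has_sum_iff)
    qed (auto simp: norm_mult H w_nonneg intro!: mult_right_mono)
    have "cmod (I H g) \<le> (\<Sum>\<^sub>\<infinity>y. norm (H (g(n := y)) * complex_of_real (w n y)))"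
      unfolding I_def by (rule norm_infsum_bound[OF s])
    also have "\<dots> \<le> (\<Sum>\<^sub>\<infinity>y. K * w n y)"
      using w_sum
      by (intro infsum_mono s summable_on_cmult_right) (auto simp: has_sum_iff norm_mult H w_nonneg intro!: mult_right_mono)
    also have "\<dots> = K" using w_sum by (simp add: infsum_cmult_right' has_sum_iff)
    finally show ?thesis .
  qed
  have prod: "I (\<lambda>i. F i * G i) g = I F g * I G g" for g
  proof (cases "n \<in> S")
    case True
    then have n: "n \<notin> S'" using assms(1) by blast
    have "I (\<lambda>i. F i * G i) g = (\<Sum>\<^sub>\<infinity>y. F (g(n := y)) * complex_of_real (w n y) * G g)"
      unfolding I_def depends_on_upd[OF Suc(3) n] by (simp add: mult_ac)
    then show ?thesis unfolding const[OF Suc(3) n] by (simp add: infsum_cmult_left' I_def)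
  next
    case False
    have "I (\<lambda>i. F i * G i) g = (\<Sum>\<^sub>\<infinity>y. F g * (G (g(n := y)) * complex_of_real (w n y)))"
      unfolding I_def depends_on_upd[OF Suc(2) False] by (simp add: mult_ac)
    then show ?thesis unfolding const[OF Suc(2) False] by (simp add: infsum_cmult_right' I_def)
  qed
  have "cmod (F i * G i) \<le> C * C'" for i
    unfolding norm_mult using Suc(4,5) by (intro mult_mono) (auto intro: order_trans[OF norm_ge_zero])
  then have "mean (Suc n) (\<lambda>i. F i * G i) = mean n (I (\<lambda>i. F i * G i))"
    by (subst mean_Suc) (auto simp: I_def[abs_def])
  also have "\<dots> = mean n (\<lambda>g. I F g * I G g)" by (rule mean_cong) (rule prod)
  also have "\<dots> = mean n (I F) * mean n (I G)"
    by (rule Suc(1)) (intro dep bd Suc)+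
  also have "mean n (I F) = mean (Suc n) F"
    unfolding I_def[abs_def] by (rule mean_Suc[OF Suc(4), symmetric])
  also have "mean n (I G) = mean (Suc n) G"
    unfolding I_def[abs_def] by (rule mean_Suc[OF Suc(5), symmetric])
  finally show ?case .
qed

section \<open>Locality of rook elements and multiplicativity of the function\<close>

locale rook_state = twisted neg v + weighted h A w
  for neg :: "'s::wellorder \<Rightarrow> bool" and v and h :: "'s \<Rightarrow> 'h::chilbert_space" and A w +
  fixes q :: "'h bop"
  assumes hom: "rook_hom h A q = Th"
begin

abbreviation f where "f \<equiv> rook_function h A q"

lemma Th_one: "Th 1 = 1"
  using Th_eps[of "{}"] by simp

lemma f_eq: "Th r \<in> tensor_algebra n \<Longrightarrow> f r = phi n (Th r)"
  by (rule rook_function_eq[OF hom Th_one])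

definition diag :: "rook \<Rightarrow> (nat \<Rightarrow> 's) \<Rightarrow> complex" where
  "diag r i = coeff (app (Th r) (ket i)) i"

lemma f_mean: "Th r \<in> tensor_algebra n \<Longrightarrow> f r = mean n (diag r)"
  by (simp add: f_eq phi_def diag_def[abs_def])

lemma diag_bound: "cmod (diag r i) \<le> onorm (app (Th r))"
  unfolding diag_def by (rule coeff_bound)

text \<open>Only diagonal entries are required to depend on \<open>S\<close> alone. A general entry
  does not: the sign of a permutation also counts inversions with odd sites lying between those of
  \<open>S\<close>. For the mean only the diagonal matters, and in a product of two local elements
  no other entries reach it.\<close>

definition local_rook :: "nat set \<Rightarrow> rook \<Rightarrow> bool" where
  "local_rook S r \<longleftrightarrow> (\<forall>i j k. k \<notin> S \<longrightarrow> i k \<noteq> j k \<longrightarrow> coeff (app (Th r) (ket j)) i = 0) \<and> depends_on S (diag r)"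

lemma local_rook_mono: "local_rook S r \<Longrightarrow> S \<subseteq> S' \<Longrightarrow> local_rook S' r"
  unfolding local_rook_def using depends_on_mono by blast

lemma local_rook_one: "local_rook {} 1"
  by (auto simp: local_rook_def depends_on_def diag_def Th_one coeff_ket)

lemma coeff_times:
  "coeff (app (a * b) (ket j)) i = (\<Sum>\<^sub>\<infinity>m. coeff (app b (ket j)) m * coeff (app a (ket m)) i)"
proof -
  have "coeff (app (a * b) (ket j)) i = cinner (app b (ket j)) (app (adj a) (ket i))"
    by (simp add: app_times cinner_adj flip: cinner_ket)
  then show ?thesis by (simp add: cinner_ell2 coeff_adj)
qed

text \<open>An intermediate basis vector in the product must agree with \<open>i\<close> off both supports.\<close>

lemma diag_mult:
  assumes r: "local_rook S r" and s: "local_rook S' s" and disj: "S \<inter> S' = {}"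
  shows "diag (r * s) i = diag r i * diag s i"
proof -
  have "diag (r * s) i = (\<Sum>\<^sub>\<infinity>m. coeff (app (Th s) (ket i)) m * coeff (app (Th r) (ket m)) i)"
    by (simp add: diag_def Th_mult coeff_times)
  also have "\<dots> = (\<Sum>\<^sub>\<infinity>m\<in>{i}. coeff (app (Th s) (ket i)) m * coeff (app (Th r) (ket m)) i)"
  proof (rule infsum_cong_neutral)
    fix m assume "m \<in> UNIV - {i}"
    then obtain k where k: "m k \<noteq> i k" by auto
    show "coeff (app (Th s) (ket i)) m * coeff (app (Th r) (ket m)) i = 0"
    proof (cases "k \<in> S")
      case True
      then have "k \<notin> S'" using disj by blast
      then have "coeff (app (Th s) (ket i)) m = 0" using s k unfolding local_rook_def by blast
      then show ?thesis by simp
    next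
      case False
      then have "coeff (app (Th r) (ket m)) i = 0" using r k unfolding local_rook_def by metis
      then show ?thesis by simp
    qed
  qed auto
  finally show ?thesis by (simp add: diag_def mult.commute)
qed

lemma local_rook_mult:
  assumes r: "local_rook S r" and s: "local_rook S' s" and disj: "S \<inter> S' = {}"
  shows "local_rook (S \<union> S') (r * s)"
  unfolding local_rook_def
proof (intro conjI allI impI)
  have "diag (r * s) = (\<lambda>i. diag r i * diag s i)" using diag_mult[OF assms] by blast
  then show "depends_on (S \<union> S') (diag (r * s))"
    using depends_on_mult r s unfolding local_rook_def by metis
next
  fix i j :: "nat \<Rightarrow> 's" and k assume k: "k \<notin> S \<union> S'" "i k \<noteq> j k"
  have "coeff (app (Th s) (ket j)) m * coeff (app (Th r) (ket m)) i = 0" for m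
  proof (cases "m k = j k")
    case True
    then have "coeff (app (Th r) (ket m)) i = 0" using r k unfolding local_rook_def by (metis UnI1)
    then show ?thesis by simp
  next
    case False
    then have "coeff (app (Th s) (ket j)) m = 0" using s k unfolding local_rook_def by blast
    then show ?thesis by simp
  qed
  then show "coeff (app (Th (r * s)) (ket j)) i = 0" unfolding Th_mult coeff_times by (simp only: infsum_0_simp)
qed

lemma f_mult:
  assumes r: "local_rook S r" and s: "local_rook S' s" and disj: "S \<inter> S' = {}"
  shows "f (r * s) = f r * f s"
proof -
  obtain k l where "Th r \<in> tensor_algebra k" "Th s \<in> tensor_algebra l" using Th_in by metis
  then have n: "Th r \<in> tensor_algebra (max k l)" "Th s \<in> tensor_algebra (max k l)"
    using tensor_algebra_mono by (metis max.cobounded1, metis max.cobounded2)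
  have "f (r * s) = mean (max k l) (\<lambda>i. diag r i * diag s i)"
    using f_mean[of "r * s" "max k l"] tensor_algebra_closed(1)[OF n] diag_mult[OF assms]
    by (simp add: Th_mult diag_def[abs_def])
  also have "\<dots> = mean (max k l) (diag r) * mean (max k l) (diag s)"
    by (rule mean_mult[OF disj _ _ diag_bound diag_bound]) (use r s in \<open>simp_all add: local_rook_def\<close>)
  finally show ?thesis by (simp only: f_mean[OF n(1)] f_mean[OF n(2)])
qed

lemma f_one: "f 1 = 1"
  using f_eq[of 1 0] by (simp add: Th_one tensor_algebra_one phi_def coeff_ket)

lemma local_prod:
  assumes "\<And>r. r \<in> set rs \<Longrightarrow> local_rook (\<sigma> r) r" "sorted_wrt (\<lambda>r s. \<sigma> r \<inter> \<sigma> s = {}) rs"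
  shows "f (prod_list rs) = prod_list (map f rs) \<and> local_rook (\<Union>r\<in>set rs. \<sigma> r) (prod_list rs)"
  using assms
proof (induct rs)
  case Nil then show ?case by (simp add: f_one local_rook_one)
next
  case (Cons r rs)
  have IH: "f (prod_list rs) = prod_list (map f rs)" "local_rook (\<Union>r\<in>set rs. \<sigma> r) (prod_list rs)"
    using Cons by simp_all
  have d: "\<sigma> r \<inter> (\<Union>r\<in>set rs. \<sigma> r) = {}" using Cons(3) by auto
  have r: "local_rook (\<sigma> r) r" using Cons(2) by simp
  show ?case using f_mult[OF r IH(2) d] local_rook_mult[OF r IH(2) d] IH(1) by simp
qed

subsection \<open>Quasicycles\<close>

lemma coeff_QM_ket:
  "finite M \<Longrightarrow> coeff (app (QM M) (ket j)) i =
    (if \<forall>k. k \<notin> M \<longrightarrow> i k = j k then \<Prod>k\<in>M. v (i k) * cnj (v (j k)) else 0)"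
proof (induct M arbitrary: i rule: finite_induct)
  case empty
  then show ?case by (auto simp: coeff_ket fun_eq_iff)
next
  case (insert k M)
  let ?P = "\<forall>l. l \<notin> insert k M \<longrightarrow> i l = j l"
  let ?R = "\<Prod>l\<in>M. v (i l) * cnj (v (j l))"
  have e: "coeff (app (QM M) (ket j)) (i(k := t)) = (if t = j k then (if ?P then ?R else 0) else 0)" for t
  proof -
    have "(\<forall>l. l \<notin> M \<longrightarrow> (i(k := t)) l = j l) \<longleftrightarrow> t = j k \<and> ?P" using insert(2) by auto
    moreover have "(\<Prod>l\<in>M. v ((i(k := t)) l) * cnj (v (j l))) = ?R"
      by (rule prod.cong) (use insert(2) in auto)
    ultimately show ?thesis unfolding insert(3) by (simp only: if_split) auto
  qed
  have "(\<Sum>t\<in>V. cnj (v t) * coeff (app (QM M) (ket j)) (i(k := t))) = cnj (v (j k)) * (if ?P then ?R else 0)"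
  proof -
    have "(\<Sum>t\<in>V. cnj (v t) * coeff (app (QM M) (ket j)) (i(k := t))) =
        (\<Sum>t\<in>V. if t = j k then cnj (v t) * (if ?P then ?R else 0) else 0)"
      by (rule sum.cong) (auto simp: e)
    then show ?thesis using fin by (simp add: sum.delta)
  qed
  then have eq: "coeff (app (QM (insert k M)) (ket j)) i =
      v (i k) * (cnj (v (j k)) * (if ?P then ?R else 0))"
    by (simp only: QM_insert[OF insert(1)] app_times coeff_Q)
  show ?case
  proof (cases ?P)
    case True
    show ?thesis unfolding eq if_P[OF True] prod.insert[OF insert(1,2)] mult.assoc ..
  next
    case False
    show ?thesis unfolding eq if_not_P[OF False] by simp
  qed
qed

lemma coeff_perm_eps:
  assumes "finite M"
  shows "coeff (app (Th (perm_rook p * eps M)) (ket j)) i =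
    psign p (odd_sites (i \<circ> apply p)) *
    (if \<forall>k. k \<notin> M \<longrightarrow> i (apply p k) = j k then \<Prod>k\<in>M. v (i (apply p k)) * cnj (v (j k)) else 0)"
  by (simp only: Th_perm_eps[OF assms] app_times coeff_Tp coeff_QM_ket[OF assms] comp_apply)

text \<open>A nonzero diagonal entry forces all factors of the cycle to have the same parity.\<close>

lemma diag_quasicycle:
  assumes d: "distinct ns" and M: "M \<subseteq> set ns"
  defines "p \<equiv> cycle ns"
  shows "diag (perm_rook p * eps M) i =
    (if \<exists>x\<in>set ns. neg (i x) then (-1) ^ (length ns - 1) else 1) *
    (\<Prod>k\<in>set ns. if k \<in> M then v (i (apply p k)) * cnj (v (i k)) else if i (apply p k) = i k then 1 else 0)"
    (is "_ = ?s * ?P")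
proof -
  have fM: "finite M" using M finite_subset by blast
  let ?c = "\<forall>k. k \<notin> M \<longrightarrow> i (apply p k) = i k"
  let ?Q = "\<Prod>k\<in>M. v (i (apply p k)) * cnj (v (i k))"
  have out: "apply p k = k" if "k \<notin> set ns" for k unfolding p_def by (rule cycle_outside[OF that])
  have P: "?P = (if ?c then ?Q else 0)"
  proof (cases "?c")
    case True
    have "?P = (\<Prod>k\<in>set ns. if k \<in> M then v (i (apply p k)) * cnj (v (i k)) else 1)"
      by (rule prod.cong) (use True in auto)
    also have "\<dots> = ?Q" using M by (simp add: prod.inter_restrict[symmetric] Int_absorb1)
    finally show ?thesis using True by simp
  next
    case False
    then obtain k where k: "k \<notin> M" "i (apply p k) \<noteq> i k" by blast
    then have "k \<in> set ns" using out by metis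
    then show ?thesis using False k by (auto intro!: prod_zero bexI[of _ k])
  qed
  have "diag (perm_rook p * eps M) i = psign p (odd_sites (i \<circ> apply p)) * (if ?c then ?Q else 0)"
    unfolding diag_def by (rule coeff_perm_eps[OF fM])
  also have "\<dots> = ?s * (if ?c then ?Q else 0)"
  proof (cases "?c \<and> ?Q \<noteq> 0")
    case True
    have c: "neg (i (apply p x)) = neg (i x)" for x
    proof (cases "x \<in> M")
      case xM: True
      then have "v (i (apply p x)) \<noteq> 0 \<and> v (i x) \<noteq> 0" using True fM by auto
      then show ?thesis using v_even by blast
    qed (use True in simp)
    then have odd: "odd_sites (i \<circ> apply p) = {x. neg (i x)}" by (simp add: odd_sites_def)
    have const: "neg (i x) = neg (i y)" if "x \<in> set ns" "y \<in> set ns" for x y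
      by (rule cycle_constant[OF d _ that, where f = "\<lambda>x. neg (i x)"]) (use c in \<open>simp add: p_def\<close>)
    \<comment> \<open>By \<open>const\<close> the cycle is entirely odd or entirely even. Odd sites
      off the cycle may be interleaved with it; they change neither of the two signs.\<close>
    have "psign p {x. neg (i x)} = ?s"
    proof (cases "\<exists>x\<in>set ns. neg (i x)")
      case True
      then have "set ns \<subseteq> {x. neg (i x)}" using const by blast
      then show ?thesis using True psign_cycle[OF d] by (simp add: p_def)
    next
      case False
      then have "{x. neg (i x)} \<inter> affected p = {}" using affected_cycle_subset[of ns] by (auto simp: p_def)
      then show ?thesis using False psign_fixed by simp
    qed
    then show ?thesis by (simp add: odd)
  next
    case False
    then have "(if ?c then ?Q else 0) = 0" by auto
    then show ?thesis by (simp only: mult_zero_right)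
  qed
  finally show ?thesis unfolding P .
qed

lemma local_quasicycle:
  assumes d: "distinct ns" and M: "M \<subseteq> set ns"
  shows "local_rook (set ns) (perm_rook (cycle ns) * eps M)"
  unfolding local_rook_def
proof (intro conjI allI impI)
  have fM: "finite M" using M finite_subset by blast
  fix i j :: "nat \<Rightarrow> 's" and k assume k: "k \<notin> set ns" "i k \<noteq> j k"
  then have "\<not> (\<forall>k. k \<notin> M \<longrightarrow> i (apply (cycle ns) k) = j k)" using M cycle_outside[OF k(1)] by auto
  then show "coeff (app (Th (perm_rook (cycle ns) * eps M)) (ket j)) i = 0"
    unfolding coeff_perm_eps[OF fM] by (simp only: if_False mult_zero_right)
next
  show "depends_on (set ns) (diag (perm_rook (cycle ns) * eps M))"
    unfolding depends_on_def diag_quasicycle[OF d M]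
  proof (intro allI impI)
    fix i j :: "nat \<Rightarrow> 's" assume eq: "\<forall>k\<in>set ns. i k = j k"
    have "apply (cycle ns) k \<in> set ns" if "k \<in> set ns" for k
    proof (cases "k \<in> affected (cycle ns)")
      case True
      then show ?thesis using affected_cycle_subset[of ns] apply_affected[of "cycle ns" k] by blast
    next
      case False
      then show ?thesis using that by (simp add: in_affected)
    qed
    then show "(if \<exists>x\<in>set ns. neg (i x) then (-1) ^ (length ns - 1) else 1) *
        (\<Prod>k\<in>set ns. if k \<in> M then v (i (apply (cycle ns) k)) * cnj (v (i k)) else if i (apply (cycle ns) k) = i k then 1 else 0) =
      (if \<exists>x\<in>set ns. neg (j x) then (-1) ^ (length ns - 1) else 1) *
        (\<Prod>k\<in>set ns. if k \<in> M then v (j (apply (cycle ns) k)) * cnj (v (j k)) else if j (apply (cycle ns) k) = j k then 1 else 0)"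
      using eq by (intro arg_cong2[where f = "(*)"] prod.cong if_cong) auto
  qed
qed

lemma rook_supp_cycle:
  assumes "distinct ns" "2 \<le> length ns" "M \<subseteq> set ns"
  shows "rook_supp (perm_rook (cycle ns) * eps M) = set ns"
proof -
  have fM: "finite M" using assms(3) finite_subset by blast
  have "entry (perm_rook (cycle ns) * eps M) n n = 1 \<longleftrightarrow> n \<notin> set ns" for n
    using entry_perm_eps_iff[OF fM, of "cycle ns" n n] cycle_moves[OF assms(1,2), of n]
      cycle_outside[of n ns] assms(3) unfolding hits_def by (cases "n \<in> set ns") auto
  then show ?thesis by (auto simp: rook_supp_def)
qed

lemma quasicycle_local:
  assumes "quasicycle r" shows "local_rook (rook_supp r) r"
proof -
  consider ns M where "distinct ns" "2 \<le> length ns" "M \<subseteq> set ns" "r = perm_rook (cycle ns) * eps M"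
    | k where "r = eps {k}" using assms unfolding quasicycle_def by blast
  then show ?thesis
  proof cases
    case 1
    then show ?thesis using local_quasicycle rook_supp_cycle by simp
  next
    case 2
    have "entry (eps {k}) n n = 1 \<longleftrightarrow> n \<noteq> k" for n
      using entry_eps_iff[of "{k}" n n] unfolding hits_def by simp
    then have "rook_supp r = {k}" using 2 by (auto simp: rook_supp_def)
    \<comment> \<open>\<open>eps {k}\<close> is treated as a quasicycle on the one-entry list
      \<open>[k]\<close>, whose cycle is the identity.\<close>
    then show ?thesis using local_quasicycle[of "[k]" "{k}"] 2 by simp
  qed
qed

lemma independent_sorted: "independent qs \<Longrightarrow> sorted_wrt (\<lambda>r s. rook_supp r \<inter> rook_supp s = {}) qs"
  unfolding independent_def pairwise_def sorted_wrt_iff_nth_less by auto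

lemma f_independent:
  assumes "\<And>r. r \<in> set qs \<Longrightarrow> quasicycle r" "independent qs"
  shows "f (prod_list qs) = prod_list (map f qs)"
  using local_prod[of qs rook_supp] assms quasicycle_local independent_sorted by blast

lemma perm_prod_list: "perm_rook (prod_list ps) = prod_list (map perm_rook ps)"
  by (induct ps) (simp_all add: perm_rook_mult)

lemma f_cycles:
  assumes "distinct (concat cs)" "\<And>c. c \<in> set cs \<Longrightarrow> 2 \<le> length c"
  shows "f (perm_rook (prod_list (map cycle cs))) = (\<Prod>c\<leftarrow>cs. f (perm_rook (cycle c)))"
    "local_rook (set (concat cs)) (perm_rook (prod_list (map cycle cs)))"
proof -
  let ?rs = "map (\<lambda>c. perm_rook (cycle c)) cs"
  have supp: "rook_supp (perm_rook (cycle c)) = set c" if "c \<in> set cs" for c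
    using rook_supp_cycle[of c "{}"] assms that by (auto simp: distinct_concat_iff)
  have loc: "local_rook (rook_supp r) r" if "r \<in> set ?rs" for r
    using that local_quasicycle[of _ "{}"] supp assms(1) by (auto simp: distinct_concat_iff)
  have "sorted_wrt (\<lambda>c d. set c \<inter> set d = {}) cs"
    using assms(1) by (induct cs) auto
  then have srt: "sorted_wrt (\<lambda>r s. rook_supp r \<inter> rook_supp s = {}) ?rs"
    unfolding sorted_wrt_map
    by (rule sorted_wrt_mono_rel[rotated]) (simp add: supp)
  have "perm_rook (prod_list (map cycle cs)) = prod_list ?rs"
    by (simp add: perm_prod_list o_def)
  then show "f (perm_rook (prod_list (map cycle cs))) = (\<Prod>c\<leftarrow>cs. f (perm_rook (cycle c)))"
    "local_rook (set (concat cs)) (perm_rook (prod_list (map cycle cs)))"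
    using local_prod[OF loc srt] supp by (simp_all add: o_def)
qed

lemma local_perm: "local_rook (affected p) (perm_rook p)"
proof -
  obtain cs where cs: "p = prod_list (map cycle cs)" "distinct (concat cs)"
    "\<forall>c\<in>set cs. 2 \<le> length c" "set (concat cs) \<subseteq> affected p" using cycle_decomposition[of p] by blast
  show ?thesis
    using f_cycles(2)[of cs] cs local_rook_mono[OF _ cs(4)] by metis
qed

end

subsection \<open>Decreasing rearrangements\<close>

text \<open>Used twice: for the finite multiplicity of a positive eigenvalue, and for the finiteness
  of ranks in the decreasing rearrangement.\<close>

lemma summable_finite_ge:
  fixes g :: "'s \<Rightarrow> real"
  assumes sm: "g summable_on UNIV" and nn: "\<And>s. 0 \<le> g s" and c: "0 < c"
  shows "finite {s. c \<le> g s}"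
proof -
  obtain F where F: "finite F" "dist (sum g F) (infsum g UNIV) \<le> c / 2"
    using infsum_finite_approximation[OF sm, of "c / 2"] c by auto
  have "t \<in> F" if "c \<le> g t" for t
  proof (rule ccontr)
    assume "t \<notin> F"
    then have "sum g F + g t = sum g (insert t F)" using F(1) by simp
    also have "\<dots> \<le> infsum g UNIV" using F(1) nn by (intro finite_sum_le_infsum sm) auto
    finally have "c \<le> infsum g UNIV - sum g F" using that by linarith
    then show False using F(2) c unfolding dist_real_def by linarith
  qed
  then show ?thesis by (intro finite_subset[OF _ F(1)]) auto
qed

lemma summable_power:
  fixes g :: "'s \<Rightarrow> real"
  assumes nn: "\<And>s. 0 \<le> g s" and sm: "g summable_on UNIV" and l: "l \<ge> 1"
  shows "(\<lambda>s. g s ^ l) summable_on UNIV"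
proof (rule summable_on_comparison_test)
  show "(\<lambda>s. infsum g UNIV ^ (l - 1) * g s) summable_on UNIV"
    by (rule summable_on_cmult_right[OF sm])
  show "g s ^ l \<le> infsum g UNIV ^ (l - 1) * g s" for s
  proof -
    have "g s \<le> infsum g UNIV"
      using finite_sum_le_infsum[OF sm, of "{s}"] nn by simp
    moreover have "g s ^ l = g s ^ (l - 1) * g s" using l by (metis Suc_diff_1 less_eq_Suc_le One_nat_def power_Suc2)
    ultimately show ?thesis using nn by (simp add: mult_right_mono power_mono)
  qed
qed (simp add: nn)

text \<open>The positive values are ordered by decreasing size, ties by index, and an index is
  placed at the number of its predecessors. By \<open>down\<close> the ranks form an initial
  segment, so padding with zeros preserves monotonicity; it does not affect the power sums because
  \<open>l \<ge> 1\<close>.\<close>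

lemma decreasing_rearrangement:
  fixes g :: "'s::linorder \<Rightarrow> real"
  assumes nn: "\<And>s. 0 \<le> g s" and sm: "g summable_on UNIV"
  shows "\<exists>\<alpha>. antimono \<alpha> \<and> (\<forall>n. 0 \<le> \<alpha> n) \<and> (\<forall>l\<ge>1. (\<lambda>n. \<alpha> n ^ l) sums (\<Sum>\<^sub>\<infinity>s. g s ^ l))"
proof -
  define P where "P = {s. 0 < g s}"
  define pre where "pre s = {t. g s < g t \<or> g t = g s \<and> t < s}" for s
  define rank where "rank s = card (pre s)" for s
  have fin: "finite (pre s)" if "s \<in> P" for s
    by (rule finite_subset[OF _ summable_finite_ge[OF sm nn, of "g s"]]) (use that in \<open>auto simp: pre_def P_def\<close>)
  have preP: "pre s \<subseteq> P" if "s \<in> P" for s using that by (auto simp: pre_def P_def)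
  have tot: "s \<in> pre t \<or> s = t \<or> t \<in> pre s" for s t by (auto simp: pre_def)
  have trans: "pre s \<subset> pre t" if "s \<in> pre t" for s t
    using that by (force simp: pre_def)
  have rank_less: "rank s < rank t" if "s \<in> pre t" "t \<in> P" for s t
    unfolding rank_def by (rule psubset_card_mono[OF fin[OF that(2)] trans[OF that(1)]])
  have inj: "inj_on rank P"
  proof (rule inj_onI)
    fix s t assume "s \<in> P" "t \<in> P" "rank s = rank t"
    then show "s = t" using tot[of s t] rank_less[of s t] rank_less[of t s] by auto
  qed
  have down: "\<exists>t\<in>pre s. rank t = n" if "s \<in> P" "n < rank s" for s n
  proof -
    have "inj_on rank (pre s)" using inj preP[OF that(1)] inj_on_subset by blast
    then have "card (rank ` pre s) = card {..<rank s}"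
      by (simp only: card_image card_lessThan rank_def[symmetric, of s])
    moreover have "rank ` pre s \<subseteq> {..<rank s}" using rank_less that(1) by auto
    ultimately have "rank ` pre s = {..<rank s}" by (intro card_subset_eq) auto
    then show ?thesis using that(2) by (metis imageE lessThan_iff)
  qed
  define \<alpha> where "\<alpha> n = (if n \<in> rank ` P then g (the_inv_into P rank n) else 0)" for n
  have \<alpha>: "\<alpha> (rank s) = g s" if "s \<in> P" for s
    using that by (simp add: \<alpha>_def the_inv_into_f_f[OF inj])
  have \<alpha>0: "0 \<le> \<alpha> n" for n by (simp add: \<alpha>_def nn)
  have "antimono \<alpha>"
  proof (rule antimonoI)
    fix n m :: nat assume "n \<le> m"
    show "\<alpha> m \<le> \<alpha> n"
    proof (cases "m \<in> rank ` P \<and> n \<noteq> m")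
      case True
      then obtain s where s: "s \<in> P" "m = rank s" by blast
      then obtain t where t: "t \<in> pre s" "rank t = n" using down[OF s(1)] True \<open>n \<le> m\<close> by (metis le_neq_implies_less)
      then show ?thesis using \<alpha>[OF s(1)] \<alpha>[of t] preP[OF s(1)] s(2) by (auto simp: pre_def)
    next
      case False
      then have "n = m \<or> \<alpha> m = 0" by (auto simp: \<alpha>_def)
      then show ?thesis using \<alpha>0[of n] by auto
    qed
  qed
  moreover have "(\<lambda>n. \<alpha> n ^ l) sums (\<Sum>\<^sub>\<infinity>s. g s ^ l)" if l: "l \<ge> 1" for l
  proof -
    have "(\<lambda>s. g s ^ l) summable_on UNIV" by (rule summable_power[OF nn sm l])
    then have "((\<lambda>s. g s ^ l) has_sum (\<Sum>\<^sub>\<infinity>s. g s ^ l)) UNIV" by simp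
    also have "?this \<longleftrightarrow> ((\<lambda>s. g s ^ l) has_sum (\<Sum>\<^sub>\<infinity>s. g s ^ l)) P"
      by (rule has_sum_cong_neutral) (use l nn in \<open>auto simp: P_def less_le\<close>)
    also have "\<dots> \<longleftrightarrow> (((\<lambda>n. \<alpha> n ^ l) \<circ> rank) has_sum (\<Sum>\<^sub>\<infinity>s. g s ^ l)) P"
      by (rule has_sum_cong) (simp add: \<alpha>)
    also have "\<dots> \<longleftrightarrow> ((\<lambda>n. \<alpha> n ^ l) has_sum (\<Sum>\<^sub>\<infinity>s. g s ^ l)) (rank ` P)"
      by (rule has_sum_reindex[OF inj, symmetric])
    also have "\<dots> \<longleftrightarrow> ((\<lambda>n. \<alpha> n ^ l) has_sum (\<Sum>\<^sub>\<infinity>s. g s ^ l)) UNIV"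
      by (rule has_sum_cong_neutral) (use l in \<open>auto simp: \<alpha>_def\<close>)
    finally show ?thesis by (rule has_sum_imp_sums)
  qed
  ultimately show ?thesis using \<alpha>0 by blast
qed

subsection \<open>Sums over closed chains\<close>

lemma sum_PiE_Suc:
  fixes F :: "(nat \<Rightarrow> 's) \<Rightarrow> 'c::comm_monoid_add"
  shows "(\<Sum>i\<in>{..<Suc n} \<rightarrow>\<^sub>E V. F i) = (\<Sum>i\<in>{..<n} \<rightarrow>\<^sub>E V. \<Sum>y\<in>V. F (i(n := y)))"
proof -
  have "(\<Sum>i\<in>{..<Suc n} \<rightarrow>\<^sub>E V. F i) = (\<Sum>i\<in>(\<lambda>(g, y). g(n := y)) ` (({..<n} \<rightarrow>\<^sub>E V) \<times> V). F i)"
    by (rule sum.cong) (auto simp: lessThan_Suc PiE_insert_eq image_iff)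
  also have "\<dots> = (\<Sum>(g, y)\<in>({..<n} \<rightarrow>\<^sub>E V) \<times> V. F (g(n := y)))"
    using sum.reindex[OF inj_combinator'[of n "{..<n}" "\<lambda>_. V"], of F]
    by (simp add: case_prod_unfold o_def)
  finally show ?thesis by (simp add: sum.cartesian_product)
qed

text \<open>A product of matrices in disguise: \<open>K l\<close> is a rank-one projection for
  \<open>l\<close> in \<open>M\<close> and the identity otherwise, and summing over the inner
  indices multiplies them. Idempotence collapses the product to one projection or to the identity.
  The arbitrary function \<open>g\<close> of both end indices is what the induction changes.\<close>

lemma chain_sum:
  fixes v :: "'s \<Rightarrow> complex" and M :: "nat set" and g :: "'s \<Rightarrow> 's \<Rightarrow> complex"
  assumes V: "finite V" and unit: "(\<Sum>t\<in>V. cnj (v t) * v t) = 1"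
  defines "K l s t \<equiv> if l \<in> M then cnj (v s) * v t else if t = s then 1 else 0"
  shows "(\<Sum>i\<in>{..<Suc m} \<rightarrow>\<^sub>E V. (\<Prod>l<m. K l (i l) (i (Suc l))) * g (i 0) (i m)) =
    (if M \<inter> {..<m} = {} then \<Sum>s\<in>V. g s s else \<Sum>s\<in>V. \<Sum>t\<in>V. cnj (v s) * v t * g s t)"
proof (induct m arbitrary: g)
  case 0
  show ?case by (simp add: sum_PiE_Suc)
next
  case (Suc m)
  define g' where "g' s t = (\<Sum>u\<in>V. K m t u * g s u)" for s t
  have "(\<Sum>i\<in>{..<Suc (Suc m)} \<rightarrow>\<^sub>E V. (\<Prod>l<Suc m. K l (i l) (i (Suc l))) * g (i 0) (i (Suc m))) =
      (\<Sum>i\<in>{..<Suc m} \<rightarrow>\<^sub>E V. (\<Prod>l<m. K l (i l) (i (Suc l))) * g' (i 0) (i m))"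
    unfolding sum_PiE_Suc[of _ "Suc m"] g'_def sum_distrib_left
    by (intro sum.cong refl) (simp add: mult.assoc)
  also have "\<dots> = (if M \<inter> {..<m} = {} then \<Sum>s\<in>V. g' s s else \<Sum>s\<in>V. \<Sum>t\<in>V. cnj (v s) * v t * g' s t)"
    by (rule Suc)
  also have "\<dots> = (if M \<inter> {..<Suc m} = {} then \<Sum>s\<in>V. g s s else \<Sum>s\<in>V. \<Sum>t\<in>V. cnj (v s) * v t * g s t)"
  proof (cases "m \<in> M")
    case True
    define G where "G s = (\<Sum>u\<in>V. v u * g s u)" for s
    have g': "g' s t = cnj (v t) * G s" for s t
      using True by (simp add: g'_def K_def G_def sum_distrib_left mult.assoc)
    have R: "(\<Sum>s\<in>V. \<Sum>t\<in>V. cnj (v s) * v t * g s t) = (\<Sum>s\<in>V. cnj (v s) * G s)"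
      by (simp add: G_def sum_distrib_left mult.assoc)
    have "(\<Sum>t\<in>V. cnj (v s) * v t * (cnj (v t) * c)) = cnj (v s) * c" for s c
    proof -
      have "(\<Sum>t\<in>V. cnj (v s) * v t * (cnj (v t) * c)) = cnj (v s) * c * (\<Sum>t\<in>V. cnj (v t) * v t)"
        unfolding sum_distrib_left by (intro sum.cong) (simp_all add: mult_ac)
      then show ?thesis by (simp add: unit)
    qed
    then have "(\<Sum>s\<in>V. \<Sum>t\<in>V. cnj (v s) * v t * g' s t) = (\<Sum>s\<in>V. cnj (v s) * G s)"
      by (simp only: g')
    moreover have "M \<inter> {..<Suc m} \<noteq> {}" using True by auto
    ultimately show ?thesis by (simp only: g' R if_False if_cancel)
  next
    case False
    have "g' s t = g s t" if "t \<in> V" for s t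
    proof -
      have "g' s t = (\<Sum>u\<in>V. if u = t then g s u else 0)"
        unfolding g'_def by (rule sum.cong) (use False in \<open>auto simp: K_def\<close>)
      then show ?thesis using V that by (simp add: sum.delta)
    qed
    moreover have "M \<inter> {..<Suc m} = M \<inter> {..<m}" using False by (auto simp: lessThan_Suc)
    ultimately show ?thesis by (simp cong: sum.cong)
  qed
  finally show ?case .
qed

text \<open>Closing the chain takes the trace of the product, here the trace of a rank-one
  projection.\<close>

lemma closed_chain_sum:
  fixes v :: "'s \<Rightarrow> complex"
  assumes V: "finite V" and unit: "(\<Sum>t\<in>V. cnj (v t) * v t) = 1" and M: "M \<subseteq> {..m}" "M \<noteq> {}"
  defines "K l s t \<equiv> if l \<in> M then cnj (v s) * v t else if t = s then 1 else 0"
  shows "(\<Sum>i\<in>{..<Suc m} \<rightarrow>\<^sub>E V. (\<Prod>l<m. K l (i l) (i (Suc l))) * K m (i m) (i 0)) = 1"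
proof -
  have "(\<Sum>i\<in>{..<Suc m} \<rightarrow>\<^sub>E V. (\<Prod>l<m. K l (i l) (i (Suc l))) * K m (i m) (i 0)) =
      (if M \<inter> {..<m} = {} then \<Sum>s\<in>V. K m s s else \<Sum>s\<in>V. \<Sum>t\<in>V. cnj (v s) * v t * K m t s)"
    unfolding K_def using chain_sum[OF V unit, of M m "\<lambda>s t. if m \<in> M then cnj (v t) * v s else if s = t then 1 else 0"]
    by simp
  also have "\<dots> = 1"
  proof (cases "m \<in> M")
    case True
    have "(\<Sum>s\<in>V. \<Sum>t\<in>V. cnj (v s) * v t * K m t s) = (\<Sum>s\<in>V. \<Sum>t\<in>V. (cnj (v s) * v s) * (cnj (v t) * v t))"
      by (intro sum.cong refl) (simp add: K_def True mult_ac)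
    also have "\<dots> = 1" unfolding sum_distrib_left[symmetric] unit by (simp add: unit)
    finally show ?thesis using unit True by (simp add: K_def)
  next
    case False
    then have ne: "M \<inter> {..<m} \<noteq> {}" using M by (auto simp: atMost_def lessThan_def le_less)
    have "(\<Sum>s\<in>V. \<Sum>t\<in>V. cnj (v s) * v t * K m t s) = (\<Sum>s\<in>V. \<Sum>t\<in>V. if t = s then cnj (v s) * v t else 0)"
      by (intro sum.cong refl) (auto simp: K_def False)
    also have "\<dots> = 1" using V unit by (simp add: sum.delta)
    finally show ?thesis using ne by simp
  qed
  finally show ?thesis .
qed

subsection \<open>Multiplicative functions are indecomposable\<close>

lemma pd_Re:
  assumes "positive_definite \<phi>" "finite F"
  shows "0 \<le> Re (\<Sum>x\<in>F. \<Sum>y\<in>F. c x * cnj (c y) * \<phi> (inverse y * x))"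
  using assms unfolding positive_definite_def Let_def by blast

text \<open>On the two-point set \<open>{1, g}\<close> the quadratic form must be real for the
  coefficients \<open>(1, 1)\<close> and \<open>(1, \<i>)\<close>; this compares the imaginary and
  the real parts. For \<open>g = 1\<close> the set collapses.\<close>

lemma pd_inverse:
  assumes "normalized_central_pd (\<phi> :: 'a perm \<Rightarrow> complex)"
  shows "\<phi> (inverse g) = cnj (\<phi> g)"
proof (cases "g = 1")
  case True
  then show ?thesis using assms by (simp add: normalized_central_pd_def)
next
  case False
  have one: "\<phi> 1 = 1" using assms by (simp add: normalized_central_pd_def)
  have "Im (\<Sum>x\<in>{1, g}. \<Sum>y\<in>{1, g}. c x * cnj (c y) * \<phi> (inverse y * x)) = 0" for c
    using assms unfolding normalized_central_pd_def positive_definite_def Let_def by blast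
  note this[of "\<lambda>_. 1"] this[of "\<lambda>x. if x = 1 then 1 else \<i>"]
  then show ?thesis using False one by (simp add: complex_eq_iff)
qed

text \<open>It exchanges block 0 of length \<open>K\<close> with block \<open>n\<close> and fixes
  the rest. Being an involution it is a finitary permutation, which a plain translation would not
  be.\<close>

definition block_shift :: "nat \<Rightarrow> nat \<Rightarrow> nat perm" where
  "block_shift K n = Perm (\<lambda>x. if x < K then x + n * K else if n * K \<le> x \<and> x < n * K + K then x - n * K else x)"

lemma block_shift_apply:
  "apply (block_shift K n) = (\<lambda>x. if x < K then x + n * K else if n * K \<le> x \<and> x < n * K + K then x - n * K else x)"
  (is "_ = ?f")
proof -
  have "?f (?f x) = x" for x
  proof -
    define k where "k = n * K"
    have "k = 0 \<or> K \<le> k" by (cases n) (simp_all add: k_def)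
    then show ?thesis unfolding k_def[symmetric] by auto
  qed
  then have "bij ?f" by (rule involuntory_imp_bij)
  moreover have "finite {x. ?f x \<noteq> x}"
    by (rule finite_subset[of _ "{..<n * K + K}"]) (auto split: if_splits)
  ultimately show ?thesis unfolding block_shift_def by (intro Perm_inverse) simp
qed

lemma conj_block_shift_affected:
  assumes "affected g \<subseteq> {..<K}"
  shows "affected (block_shift K n * g * inverse (block_shift K n)) \<subseteq> {x. x div K = n}"
proof
  fix x assume x: "x \<in> affected (block_shift K n * g * inverse (block_shift K n))"
  define y where "y = apply (inverse (block_shift K n)) x"
  have xy: "x = apply (block_shift K n) y" by (simp add: y_def)
  have "apply g y \<noteq> y" using x by (auto simp: in_affected apply_times y_def)
  then have "y < K" using assms by (auto simp: in_affected)
  then show "x \<in> {x. x div K = n}" by (simp add: xy block_shift_apply)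
qed

text \<open>The mean of \<open>N\<close> disjoint conjugates of \<open>g\<close> converges to the scalar \<open>\<omega> g\<close> in the GNS space of a
  multiplicative \<open>\<omega>\<close>, hence also in that of every positive definite function dominated by \<open>\<omega>\<close>.\<close>

lemma multiplicative_extreme:
  fixes \<omega> \<phi> \<phi>' :: "nat perm \<Rightarrow> complex"
  assumes \<omega>: "normalized_central_pd \<omega>"
    and mult: "\<And>g h. affected g \<inter> affected h = {} \<Longrightarrow> \<omega> (g * h) = \<omega> g * \<omega> h"
    and \<phi>: "normalized_central_pd \<phi>" and \<phi>': "normalized_central_pd \<phi>'"
    and t: "0 < t" "t < 1"
    and dec: "\<And>g. \<omega> g = complex_of_real t * \<phi> g + complex_of_real (1 - t) * \<phi>' g"
  shows "\<phi> = \<omega>"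
proof
  fix g
  show "\<phi> g = \<omega> g"
  proof (cases "g = 1")
    case True
    then show ?thesis using \<omega> \<phi> by (simp add: normalized_central_pd_def)
  next
    case False
    obtain K where K: "affected g \<subseteq> {..<K}" using affected_bounded by blast
    define G where "G n = block_shift K n * g * inverse (block_shift K n)" for n
    have aff: "affected (G n) \<subseteq> {x. x div K = n}" for n
      unfolding G_def by (rule conj_block_shift_affected[OF K])
    then have disj: "affected (G n) \<inter> affected (G m) = {}" if "n \<noteq> m" for n m
      using that by blast
    have G1: "G n \<noteq> 1" for n
    proof
      assume "G n = 1"
      then have "inverse (block_shift K n) * G n * block_shift K n = 1" by simp
      moreover have "inverse (block_shift K n) * G n * block_shift K n = g"
        by (simp add: G_def mult.assoc) (simp flip: mult.assoc)
      ultimately show False using False by simp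
    qed
    have injG: "inj G"
    proof (rule injI)
      fix n m assume "G n = G m"
      then show "n = m" using disj[of n m] G1[of m] by (metis inf.idem affected_empty_iff)
    qed
    have inv_ne: "affected (inverse (G m)) \<inter> affected (G n) = {}" if "n \<noteq> m" for n m
      using disj[of m n] that by simp
    have central: "\<psi> (G n) = \<psi> g" if "normalized_central_pd \<psi>" for \<psi> :: "nat perm \<Rightarrow> complex" and n
    proof -
      have "\<psi> (G n) = \<psi> (inverse (block_shift K n) * (block_shift K n * g))"
        using that unfolding G_def normalized_central_pd_def by blast
      then show ?thesis by (simp flip: mult.assoc)
    qed
    define z where "z = \<omega> g"
    define S where "S \<psi> N = (\<Sum>n<N. \<Sum>m<N. \<psi> (inverse (G m) * G n))" for \<psi> :: "nat perm \<Rightarrow> complex" and N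
    \<comment> \<open>\<open>B \<psi> N y\<close> is the squared distance, in the GNS space of
      \<open>\<psi>\<close>, between the mean of the first \<open>N\<close> conjugates and the
      scalar \<open>y\<close>.\<close>
    define B where "B \<psi> N y = S \<psi> N / (of_nat N)\<^sup>2 - cnj y * \<psi> g - y * cnj (\<psi> g) + y * cnj y"
      for \<psi> :: "nat perm \<Rightarrow> complex" and N y
    have Bpos: "0 \<le> Re (B \<psi> N y)" if \<psi>: "normalized_central_pd \<psi>" and N: "0 < N" for \<psi> N y
    proof -
      define c where "c x = (if x = 1 then - y else 1 / of_nat N)" for x :: "nat perm"
      let ?F = "insert 1 (G ` {..<N})"
      have nin: "1 \<notin> G ` {..<N}" using G1 by (metis imageE)
      have c1: "c 1 = - y" and cG: "c (G n) = 1 / of_nat N" for n by (simp_all add: c_def G1)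
      have re: "(\<Sum>x\<in>G ` {..<N}. h x) = (\<Sum>n<N. h (G n))" for h :: "nat perm \<Rightarrow> complex"
        by (subst sum.reindex) (auto intro: inj_on_subset[OF injG])
      have s1: "\<psi> 1 = 1" using \<psi> by (simp add: normalized_central_pd_def)
      have "(\<Sum>x\<in>?F. \<Sum>w\<in>?F. c x * cnj (c w) * \<psi> (inverse w * x)) =
          y * cnj y - (\<Sum>n<N. y * (1 / of_nat N) * \<psi> (inverse (G n))) +
          (\<Sum>n<N. (1 / of_nat N) * - cnj y * \<psi> (G n) +
            (\<Sum>m<N. (1 / of_nat N) * (1 / of_nat N) * \<psi> (inverse (G m) * G n)))"
        using nin by (simp add: re c1 cG s1 sum_negf)
      also have "\<dots> = B \<psi> N y"
        using N
        by (simp add: pd_inverse[OF \<psi>] central[OF \<psi>] sum.distrib sum_negf sum_subtractf B_def S_def power2_eq_square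
            flip: sum_divide_distrib sum_distrib_left)
      finally have "(\<Sum>x\<in>?F. \<Sum>w\<in>?F. c x * cnj (c w) * \<psi> (inverse w * x)) = B \<psi> N y" .
      moreover have "0 \<le> Re (\<Sum>x\<in>?F. \<Sum>w\<in>?F. c x * cnj (c w) * \<psi> (inverse w * x))"
        using \<psi> unfolding normalized_central_pd_def by (intro pd_Re) auto
      ultimately show ?thesis by simp
    qed
    \<comment> \<open>Of the \<open>N^2\<close> terms of the double sum the off-diagonal ones are
      \<open>|z|^2\<close> by multiplicativity and the \<open>N\<close> diagonal ones are 1, so the
      distance at \<open>y = z\<close> is \<open>(1 - |z|^2) / N\<close>.\<close>
    have B\<omega>: "Re (B \<omega> N z) \<le> 1 / real N" if N: "0 < N" for N
    proof -
      have "\<omega> (inverse (G m) * G n) = cnj z * z + (if m = n then 1 - cnj z * z else 0)" for m n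
        using mult[OF inv_ne[of n m]] \<omega>
        by (auto simp: pd_inverse[OF \<omega>] central[OF \<omega>] z_def normalized_central_pd_def)
      then have "S \<omega> N = of_nat N * (of_nat N * (cnj z * z)) + of_nat N * (1 - cnj z * z)"
        by (simp add: S_def sum.distrib distrib_left)
      then have "B \<omega> N z = (1 - cnj z * z) / of_nat N"
        using N by (simp add: B_def z_def[symmetric] add_divide_distrib power2_eq_square mult.commute)
      also have "cnj z * z = complex_of_real ((cmod z)\<^sup>2)"
        by (metis complex_norm_square mult.commute)
      also have "(1 - complex_of_real ((cmod z)\<^sup>2)) / of_nat N = complex_of_real ((1 - (cmod z)\<^sup>2) / real N)"
        by simp
      finally show ?thesis using N by (simp add: divide_right_mono)
    qed
    define u where "u = \<phi> g"
    have "t * (cmod (u - z))\<^sup>2 \<le> 1 / real N" if N: "0 < N" for N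
    proof -
      have "B \<omega> N z = complex_of_real t * B \<phi> N z + complex_of_real (1 - t) * B \<phi>' N z"
      proof -
        have eq: "S \<omega> N = complex_of_real t * S \<phi> N + complex_of_real (1 - t) * S \<phi>' N"
          by (simp add: S_def dec sum.distrib sum_distrib_left)
        show ?thesis unfolding B_def dec[of g] eq
          by (simp add: algebra_simps add_divide_distrib diff_divide_distrib)
      qed
      then have "t * Re (B \<phi> N z) + (1 - t) * Re (B \<phi>' N z) \<le> 1 / real N"
        using B\<omega>[OF N] by simp
      moreover have "0 \<le> (1 - t) * Re (B \<phi>' N z)" using Bpos[OF \<phi>' N] t by simp
      ultimately have "t * Re (B \<phi> N z) \<le> 1 / real N" by linarith
      \<comment> \<open>Pythagoras: for \<open>\<phi>\<close> the scalar part of the mean is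
        \<open>u\<close>, so moving the comparison point from \<open>u\<close> to \<open>z\<close>
        adds \<open>|u - z|^2\<close>.\<close>
      moreover have "(cmod (u - z))\<^sup>2 \<le> Re (B \<phi> N z)"
      proof -
        have "complex_of_real ((cmod (u - z))\<^sup>2) = (u - z) * cnj (u - z)"
          by (rule complex_norm_square)
        moreover have "B \<phi> N z = B \<phi> N u + (u - z) * cnj (u - z)"
          by (simp add: B_def u_def algebra_simps)
        ultimately have "Re (B \<phi> N z) = Re (B \<phi> N u) + (cmod (u - z))\<^sup>2"
          by (metis Re_complex_of_real plus_complex.simps(1))
        then show ?thesis using Bpos[OF \<phi> N, of u] by simp
      qed
      ultimately show ?thesis using t by (meson less_imp_le mult_left_mono order_trans)
    qed
    then have "t * (cmod (u - z))\<^sup>2 \<le> 1 / real (Suc N)" for N by blast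
    moreover have "(\<lambda>N. 1 / real (Suc N)) \<longlonglongrightarrow> 0"
      using LIMSEQ_inverse_real_of_nat by (simp add: inverse_eq_divide)
    ultimately have "t * (cmod (u - z))\<^sup>2 \<le> 0"
      using LIMSEQ_le_const by blast
    then show ?thesis using t by (simp add: mult_le_0_iff u_def z_def)
  qed
qed

lemma multiplicative_group_character:
  fixes \<omega> :: "nat perm \<Rightarrow> complex"
  assumes \<omega>: "normalized_central_pd \<omega>"
    and mult: "\<And>g h. affected g \<inter> affected h = {} \<Longrightarrow> \<omega> (g * h) = \<omega> g * \<omega> h"
  shows "group_character \<omega>"
  unfolding group_character_def
proof (intro conjI allI impI \<omega>)
  fix \<phi>1 \<phi>2 t
  assume a: "normalized_central_pd \<phi>1 \<and> normalized_central_pd \<phi>2 \<and> 0 < t \<and> t < 1 \<and>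
    (\<forall>g. \<omega> g = complex_of_real t * \<phi>1 g + complex_of_real (1 - t) * \<phi>2 g)"
  show "\<phi>1 = \<omega>"
    by (rule multiplicative_extreme[OF \<omega> mult, of \<phi>1 \<phi>2 t]) (use a in auto)
  show "\<phi>2 = \<omega>"
    by (rule multiplicative_extreme[OF \<omega> mult, of \<phi>2 \<phi>1 "1 - t"]) (use a in auto)
qed

subsection \<open>Values on quasicycles\<close>

lemma infsum_of_real: "(\<Sum>\<^sub>\<infinity>x\<in>S. complex_of_real (f x)) = complex_of_real (infsum f S)"
proof (cases "f summable_on S")
  case True
  then have "((\<lambda>x. complex_of_real (f x)) has_sum complex_of_real (infsum f S)) S"
    by (simp only: has_sum_of_real_iff has_sum_infsum)
  then show ?thesis by (rule infsumI)
next
  case False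
  then have "\<not> (\<lambda>x. complex_of_real (f x)) summable_on S"
    using summable_on_Re[of "\<lambda>x. complex_of_real (f x)" S] by auto
  then show ?thesis using False by (simp add: infsum_not_exists)
qed

text \<open>Conditioning on the basis index at one site prepares for cycles, where only
  configurations with the same index at all sites of the cycle contribute.\<close>

lemma (in weighted) mean_disintegrate:
  assumes F: "\<And>i. cmod (F i) \<le> C"
  shows "mean n F = (\<Sum>\<^sub>\<infinity>s. mean n (\<lambda>i. if i x = s then F i else 0))"
proof -
  define G where "G i = F i * complex_of_real (W n i)" for i
  let ?H = "\<lambda>(s, i). if i x = s then G i else 0"
  let ?e = "\<lambda>i :: nat \<Rightarrow> 's. (i x, i)"
  have inj: "inj_on ?e (Conf n)" by (simp add: inj_on_def)
  have "G summable_on Conf n" unfolding G_def[abs_def] by (rule bounded_summable) (rule F)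
  then have "(?H \<circ> ?e) summable_on Conf n" by (simp add: o_def)
  then have "?H summable_on ?e ` Conf n" by (simp add: summable_on_reindex[OF inj])
  also have "?this \<longleftrightarrow> ?H summable_on UNIV \<times> Conf n"
    by (rule summable_on_cong_neutral) auto
  finally have s: "?H summable_on UNIV \<times> Conf n" .
  have "mean n F = infsum (?H \<circ> ?e) (Conf n)" by (simp add: mean_def G_def o_def)
  also have "\<dots> = infsum ?H (?e ` Conf n)" by (rule infsum_reindex[OF inj, symmetric])
  also have "\<dots> = infsum ?H (UNIV \<times> Conf n)" by (rule infsum_cong_neutral) auto
  also have "\<dots> = (\<Sum>\<^sub>\<infinity>s. \<Sum>\<^sub>\<infinity>i\<in>Conf n. ?H (s, i))" by (rule infsum_Sigma_banach[OF s, symmetric])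
  also have "\<dots> = (\<Sum>\<^sub>\<infinity>s. mean n (\<lambda>i. if i x = s then F i else 0))"
    unfolding mean_def by (intro infsum_cong) (auto simp: G_def)
  finally show ?thesis .
qed

lemma (in weighted) mean_fixed:
  assumes S: "S \<subseteq> {..<n}"
  shows "mean n (\<lambda>i. c * (\<Prod>k\<in>S. if i k = s then 1 else 0)) = c * complex_of_real (\<Prod>k\<in>S. w k s)"
proof -
  \<comment> \<open>The indicator of index \<open>s\<close> at the sites of \<open>S\<close> is
    absorbed into the weights, so that the sum over configurations remains a product of sums over
    single sites.\<close>
  define u where "u k y = (if k \<in> S then if y = s then w k y else 0 else w k y)" for k y
  have u: "infsum (u k) UNIV = (if k \<in> S then w k s else 1)" for k
  proof (cases "k \<in> S")
    case True
    have "infsum (u k) UNIV = infsum (w k) {s}"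
      by (rule infsum_cong_neutral) (use True in \<open>auto simp: u_def\<close>)
    then show ?thesis using True by simp
  next
    case False
    then show ?thesis using w_sum by (simp add: u_def[abs_def] has_sum_iff)
  qed
  have su: "(\<lambda>y. norm (u k y)) summable_on UNIV" for k
    by (rule summable_on_comparison_test[of "w k"]) (use w_sum w_nonneg in \<open>auto simp: u_def has_sum_iff\<close>)
  have e: "c * (\<Prod>k\<in>S. if i k = s then 1 else 0) * complex_of_real (W n i) =
      c * complex_of_real (\<Prod>k<n. u k (i k))" for i
  proof -
    have "(\<Prod>k<n. u k (i k)) = (\<Prod>k<n. (if k \<in> S then if i k = s then 1 else 0 else 1) * w k (i k))"
      by (rule prod.cong) (auto simp: u_def)
    also have "\<dots> = (\<Prod>k<n. if k \<in> S then if i k = s then 1 else 0 else 1) * W n i"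
      by (simp add: prod.distrib W_def)
    also have "(\<Prod>k<n. if k \<in> S then if i k = s then 1 else 0 else 1) = (\<Prod>k\<in>S. if i k = s then 1 else (0::real))"
      using S by (simp add: prod.inter_restrict[symmetric] Int_absorb1)
    finally show ?thesis by (simp add: of_real_prod if_distrib[of complex_of_real] cong: if_cong)
  qed
  have "infsum (\<lambda>i. \<Prod>k<n. u k (i k)) (Conf n) = (\<Prod>k<n. infsum (u k) UNIV)"
    by (rule infsum_prod_PiE_abs) (use su in simp_all)
  also have "\<dots> = (\<Prod>k\<in>S. w k s)"
    unfolding u using S by (simp add: prod.inter_restrict[symmetric] Int_absorb1)
  finally have i: "infsum (\<lambda>i. \<Prod>k<n. u k (i k)) (Conf n) = (\<Prod>k\<in>S. w k s)" .
  have "infsum (\<lambda>i. complex_of_real (\<Prod>k<n. u k (i k))) (Conf n) = complex_of_real (\<Prod>k\<in>S. w k s)"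
    unfolding i[symmetric] by (rule infsum_of_real)
  then show ?thesis unfolding mean_def e infsum_cmult_right' by simp
qed

locale thoma_state = rook_state "\<lambda>s. a s < 0" v h A w q
  for a :: "'s::wellorder \<Rightarrow> real" and v and h :: "'s \<Rightarrow> 'h::chilbert_space" and A w q +
  fixes lam :: real
  assumes lam: "0 < lam" and v_eigen: "\<And>s. v s \<noteq> 0 \<Longrightarrow> a s = lam"
    and w_a: "\<And>l s. a s \<noteq> 0 \<Longrightarrow> w l s = \<bar>a s\<bar>"
    and w_ker: "\<And>l k s. a s = 0 \<Longrightarrow> l \<noteq> k \<Longrightarrow> w l s * w k s = 0"
    and a_summable: "(\<lambda>s. \<bar>a s\<bar>) summable_on UNIV" and a_le: "(\<Sum>\<^sub>\<infinity>s. \<bar>a s\<bar>) \<le> 1"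
begin

text \<open>This is \<open>Tr (|A| A^(l-1))\<close> in the eigenbasis.\<close>

definition cycle_value :: "nat \<Rightarrow> real" where
  "cycle_value l = (\<Sum>\<^sub>\<infinity>s. \<bar>a s\<bar> * a s ^ (l - 1))"

text \<open>A nonzero diagonal entry forces one index \<open>s\<close> on the whole cycle. Its
  weight is \<open>|a s|\<close> to the power of the length, and the sign of an odd cycle turns all
  but one of these factors into \<open>a s\<close>.\<close>

lemma f_cycle:
  assumes d: "distinct ns" and l: "2 \<le> length ns"
  shows "f (perm_rook (cycle ns)) = complex_of_real (cycle_value (length ns))"
proof -
  obtain n where n: "set ns \<subseteq> {..<n}" using finite_nat_bounded[of "set ns"] by blast
  have TA: "Th (perm_rook (cycle ns)) \<in> tensor_algebra n"
    unfolding Th_perm by (rule Tp_in) (use n affected_cycle_subset[of ns] in blast)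
  obtain x where x: "x \<in> set ns" using l by (cases ns) auto
  define c :: "'s \<Rightarrow> complex" where "c s = (if a s < 0 then (-1) ^ (length ns - 1) else 1)" for s
  have e: "(if i x = s then diag (perm_rook (cycle ns)) i else 0) = c s * (\<Prod>k\<in>set ns. if i k = s then 1 else 0)" for i s
  proof -
    let ?p = "cycle ns"
    have D: "diag (perm_rook ?p) i = (if \<exists>x\<in>set ns. a (i x) < 0 then (-1) ^ (length ns - 1) else 1) *
        (\<Prod>k\<in>set ns. if i (apply ?p k) = i k then 1 else 0)"
      using diag_quasicycle[OF d, of "{}" i] by simp
    have closed: "apply ?p k \<in> set ns" if "k \<in> set ns" for k
      using that affected_cycle_subset[of ns] apply_affected[of ?p k] by (metis in_affected subsetD)
    show ?thesis
    proof (cases "\<forall>k\<in>set ns. i k = s")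
      case True
      then have "(\<Prod>k\<in>set ns. if i (apply ?p k) = i k then 1 else (0::complex)) = 1"
        using closed by (intro prod.neutral) simp
      then show ?thesis using True x D by (auto simp: c_def)
    next
      case False
      have "i x \<noteq> s \<or> (\<exists>k\<in>set ns. i (apply ?p k) \<noteq> i k)"
        using cycle_constant[OF d, of i _ x] False x by metis
      then have "(if i x = s then diag (perm_rook ?p) i else 0) = 0"
        unfolding D by (auto intro!: prod_zero)
      moreover have "(\<Prod>k\<in>set ns. if i k = s then 1 else (0::complex)) = 0"
        using False by (intro prod_zero) auto
      ultimately show ?thesis by simp
    qed
  qed
  have w: "(\<Prod>k\<in>set ns. w k s) = \<bar>a s\<bar> ^ length ns" for s
  proof (cases "a s = 0")
    case False
    then show ?thesis by (simp add: w_a distinct_card[OF d])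
  next
    case True
    \<comment> \<open>The cycle has two distinct sites, and the kernel mass of at most one of them
      can sit at \<open>s\<close>.\<close>
    have "0 < length ns" "1 < length ns" using l by linarith+
    then have "ns ! 0 \<noteq> ns ! 1" using nth_eq_iff_index_eq[OF d, of 0 1] by simp
    then have "w (ns ! 0) s * w (ns ! 1) s = 0" by (rule w_ker[OF True])
    moreover have "ns ! 0 \<in> set ns" "ns ! 1 \<in> set ns" using l by (auto intro!: nth_mem)
    ultimately have "\<exists>k\<in>set ns. w k s = 0" unfolding mult_eq_0_iff by blast
    then have z: "(\<Prod>k\<in>set ns. w k s) = 0" by (auto intro: prod_zero)
    show ?thesis unfolding z True using l by (auto simp: power_0_left)
  qed
  have "f (perm_rook (cycle ns)) = (\<Sum>\<^sub>\<infinity>s. mean n (\<lambda>i. if i x = s then diag (perm_rook (cycle ns)) i else 0))"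
    unfolding f_mean[OF TA] by (rule mean_disintegrate[OF diag_bound])
  also have "\<dots> = (\<Sum>\<^sub>\<infinity>s. complex_of_real (\<bar>a s\<bar> * a s ^ (length ns - 1)))"
  proof (rule infsum_cong)
    fix s
    have "c s * complex_of_real (\<bar>a s\<bar> ^ length ns) = complex_of_real (\<bar>a s\<bar> * a s ^ (length ns - 1))"
    proof (cases "a s < 0")
      case True
      have "\<bar>a s\<bar> ^ length ns = \<bar>a s\<bar> * ((-1) ^ (length ns - 1) * a s ^ (length ns - 1))"
        using True l by (cases "length ns") (auto simp flip: power_mult_distrib)
      then show ?thesis using True by (simp add: c_def mult_ac flip: power_mult_distrib)
    next
      case False
      then show ?thesis using l by (cases "length ns") (auto simp: c_def)
    qed
    then show "mean n (\<lambda>i. if i x = s then diag (perm_rook (cycle ns)) i else 0) =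
        complex_of_real (\<bar>a s\<bar> * a s ^ (length ns - 1))"
      unfolding e mean_fixed[OF n] w .
  qed
  also have "\<dots> = complex_of_real (cycle_value (length ns))"
    unfolding cycle_value_def by (rule infsum_of_real)
  finally show ?thesis .
qed

lemma cycle_upt_apply: "l < Suc m \<Longrightarrow> apply (cycle [0..<Suc m]) l = (if l = m then 0 else Suc l)"
  using cycle_apply[of "[0..<Suc m]" l] by (auto simp del: upt_Suc)

text \<open>A site of \<open>M\<close> forces its index into the support of \<open>v\<close>, and
  nonvanishing of the factors propagates this around the cycle. On such configurations all
  eigenvalues equal \<open>lam\<close>, so weights and signs are constant and a closed chain
  remains. An empty support is the case \<open>q = 0\<close>.\<close>

lemma f_cycle_eps:
  assumes M: "M \<subseteq> {..<k}" "M \<noteq> {}"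
  shows "f (perm_rook (cycle [0..<k]) * eps M) = (if V = {} then 0 else complex_of_real (lam ^ k))"
proof -
  obtain m where k: "k = Suc m" using M by (cases k) auto
  have fM: "finite M" using M(1) finite_subset by blast
  let ?p = "cycle [0..<k]"
  have sk: "set [0..<k] = {..<k}" by (simp add: atLeast0LessThan)
  have M': "M \<subseteq> set [0..<k]" using M(1) sk by simp
  have TA: "Th (perm_rook ?p * eps M) \<in> tensor_algebra k"
    unfolding Th_perm_eps[OF fM]
    by (intro tensor_algebra_closed Tp_in QM_in fM M(1)) (use affected_cycle_subset[of "[0..<k]"] sk in blast)
  define K where "K l s t = (if l \<in> M then cnj (v s) * v t else if t = s then 1 else 0)" for l s t
  have D: "diag (perm_rook ?p * eps M) i =
      (if \<exists>x\<in>{..<k}. a (i x) < 0 then (-1) ^ (k - 1) else 1) * (\<Prod>l<k. K l (i l) (i (apply ?p l)))" for i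
  proof -
    have "K l (i l) (i (apply ?p l)) =
        (if l \<in> M then v (i (apply ?p l)) * cnj (v (i l)) else if i (apply ?p l) = i l then 1 else 0)" for l
      by (simp add: K_def)
    then show ?thesis
      using diag_quasicycle[OF distinct_upt M', of i] by (simp only: sk length_upt diff_zero)
  qed
  have zero: "diag (perm_rook ?p * eps M) i = 0" if i: "\<exists>x<k. v (i x) = 0" for i
  proof -
    have "\<exists>l<k. K l (i l) (i (apply ?p l)) = 0"
    proof (rule ccontr)
      assume "\<not> ?thesis"
      then have ne: "K l (i l) (i (apply ?p l)) \<noteq> 0" if "l < k" for l using that by blast
      have c: "(v (i (apply ?p l)) = 0) = (v (i l) = 0)" if "l < k" for l
        using ne[OF that] by (auto simp: K_def split: if_splits)
      obtain y where y: "y \<in> M" using M(2) by blast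
      then have "v (i y) \<noteq> 0" using ne[of y] M(1) by (auto simp: K_def)
      moreover have "(v (i x) = 0) = (v (i y) = 0)" if "x < k" for x
        by (rule cycle_constant[OF distinct_upt, of 0 k "\<lambda>x. v (i x) = 0"]) (use c that y M(1) in auto)
      ultimately show False using i by blast
    qed
    then show ?thesis unfolding D by (auto intro!: prod_zero)
  qed
  show ?thesis
  proof (cases "V = {}")
    case True
    then have "diag (perm_rook ?p * eps M) i = 0" for i using zero[of i] k by auto
    then show ?thesis using True by (simp add: f_mean[OF TA] mean_def)
  next
    case False
    then obtain s0 where s0: "v s0 \<noteq> 0" by blast
    have unit: "(\<Sum>t\<in>V. cnj (v t) * v t) = 1" using v_unit[of s0] s0 by simp
    have "mean k (diag (perm_rook ?p * eps M)) =
        (\<Sum>\<^sub>\<infinity>i\<in>{..<k} \<rightarrow>\<^sub>E V. diag (perm_rook ?p * eps M) i * complex_of_real (W k i))"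
      unfolding mean_def
    proof (rule infsum_cong_neutral)
      fix i assume "i \<in> Conf k - ({..<k} \<rightarrow>\<^sub>E V)"
      then have "\<exists>x<k. v (i x) = 0" by (auto simp: PiE_iff)
      then show "diag (perm_rook ?p * eps M) i * complex_of_real (W k i) = 0" using zero by simp
    qed (auto simp: PiE_iff)
    also have "\<dots> = (\<Sum>i\<in>{..<k} \<rightarrow>\<^sub>E V. diag (perm_rook ?p * eps M) i * complex_of_real (W k i))"
      using fin by (intro infsum_finite finite_PiE) auto
    also have "\<dots> = (\<Sum>i\<in>{..<Suc m} \<rightarrow>\<^sub>E V. complex_of_real (lam ^ k) * ((\<Prod>l<m. K l (i l) (i (Suc l))) * K m (i m) (i 0)))"
    proof (rule sum.cong)
      fix i assume "i \<in> {..<Suc m} \<rightarrow>\<^sub>E V"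
      then have ai: "a (i l) = lam" if "l < k" for l using v_eigen that k by (auto simp: PiE_iff)
      then have W: "W k i = lam ^ k" using lam by (simp add: W_def w_a)
      have "(\<Prod>l<k. K l (i l) (i (apply ?p l))) = (\<Prod>l<m. K l (i l) (i (Suc l))) * K m (i m) (i 0)"
        unfolding k prod.lessThan_Suc by (intro arg_cong2[where f = "(*)"] prod.cong)
          (simp_all add: cycle_upt_apply del: upt_Suc)
      moreover have "\<not> (\<exists>x\<in>{..<k}. a (i x) < 0)" using ai lam by auto
      ultimately show "diag (perm_rook ?p * eps M) i * complex_of_real (W k i) =
          complex_of_real (lam ^ k) * ((\<Prod>l<m. K l (i l) (i (Suc l))) * K m (i m) (i 0))"
        unfolding D W by (simp only: if_False mult_1_left) (simp add: mult.commute)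
    qed (simp add: k)
    also have "\<dots> = complex_of_real (lam ^ k)"
      unfolding sum_distrib_left[symmetric]
      using closed_chain_sum[OF fin unit, of M m] M by (simp add: K_def k lessThan_Suc_atMost)
    finally show ?thesis unfolding if_not_P[OF False] f_mean[OF TA] .
  qed
qed

subsection \<open>The character of the symmetric group\<close>

definition character :: "nat perm \<Rightarrow> complex" where
  "character p = f (perm_rook p)"

lemma character_cycles:
  assumes "distinct (concat cs)" "\<forall>c\<in>set cs. 2 \<le> length c"
  shows "character (prod_list (map cycle cs)) = complex_of_real (\<Prod>c\<leftarrow>cs. cycle_value (length c))"
proof -
  have "character (prod_list (map cycle cs)) = (\<Prod>c\<leftarrow>cs. f (perm_rook (cycle c)))"
    unfolding character_def by (rule f_cycles(1)) (use assms in auto)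
  also have "\<dots> = (\<Prod>c\<leftarrow>cs. complex_of_real (cycle_value (length c)))"
    using assms by (intro arg_cong[where f = prod_list] map_cong refl f_cycle) (auto simp: distinct_concat_iff)
  also have "\<dots> = complex_of_real (\<Prod>c\<leftarrow>cs. cycle_value (length c))" by (induct cs) simp_all
  finally show ?thesis .
qed

text \<open>Conjugation relabels the entries of the cycles and keeps their lengths, on which alone
  the value depends.\<close>

lemma character_conj: "character (u * g * inverse u) = character g"
proof -
  obtain cs where cs: "g = prod_list (map cycle cs)" "distinct (concat cs)" "\<forall>c\<in>set cs. 2 \<le> length c"
    using cycle_decomposition[of g] by blast
  let ?cs = "map (map (apply u)) cs"
  have "u * prod_list (map cycle ds) * inverse u = prod_list (map cycle (map (map (apply u)) ds))" for ds
  proof (induct ds)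
    case (Cons c ds)
    have "u * prod_list (map cycle (c # ds)) * inverse u =
        (u * cycle c * inverse u) * (u * prod_list (map cycle ds) * inverse u)"
      by (simp add: mult.assoc) (simp flip: mult.assoc)
    then show ?case unfolding Cons conj_cycle by simp
  qed simp
  moreover have "distinct (concat ?cs)"
    unfolding map_concat[symmetric] distinct_map using cs(2) by (auto simp: inj_on_def apply_inj)
  ultimately show ?thesis
    using character_cycles[of ?cs] character_cycles[of cs] cs by (simp add: o_def)
qed

text \<open>The quadratic form of the character at coefficients \<open>c\<close> is the squared GNS
  seminorm of the operator \<open>x\<close>, the sum of all \<open>c g\<close> times
  \<open>Tp g\<close>.\<close>

lemma character_pd: "normalized_central_pd character"
  unfolding normalized_central_pd_def
proof (intro conjI allI)
  show "character 1 = 1" by (simp add: character_def f_one)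
  show "character (g * h) = character (h * g)" for g h
    using character_conj[of h "g * h"] by (simp add: mult.assoc)
  show "positive_definite character"
    unfolding positive_definite_def Let_def
  proof (intro allI impI)
    fix F :: "nat perm set" and c :: "nat perm \<Rightarrow> complex" assume F: "finite F"
    obtain n where "\<Union> (affected ` F) \<subseteq> {..<n}" using finite_nat_bounded[of "\<Union> (affected ` F)"] F by auto
    then have n: "Tp g \<in> tensor_algebra n" if "g \<in> F" for g using that by (intro Tp_in) blast
    define x where "x = (\<Sum>g\<in>F. c g *\<^sub>C Tp g)"
    have x: "x \<in> tensor_algebra n" unfolding x_def by (intro tensor_algebra_sum tensor_algebra_scaleC n)
    have ch: "character (inverse k * g) =
        (\<Sum>\<^sub>\<infinity>i\<in>Conf n. cinner (app (Tp g) (ket i)) (app (Tp k) (ket i)) * complex_of_real (W n i))"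
      if "g \<in> F" "k \<in> F" for g k
    proof -
      have "Th (perm_rook (inverse k * g)) = adj (Tp k) * Tp g" by (simp add: Th_perm Tp_mult adj_Tp)
      moreover have "adj (Tp k) * Tp g \<in> tensor_algebra n"
        by (intro tensor_algebra_closed tensor_algebra_adj n that)
      ultimately show ?thesis
        unfolding character_def by (simp add: f_eq phi_def mean_def app_times cinner_adj' flip: cinner_ket)
    qed
    have sum: "(\<lambda>i. \<Sum>y\<in>S. G y i) summable_on Conf n \<and> infsum (\<lambda>i. \<Sum>y\<in>S. G y i) (Conf n) = (\<Sum>y\<in>S. infsum (G y) (Conf n))"
      if "finite S" "\<And>y. y \<in> S \<Longrightarrow> G y summable_on Conf n" for S and G :: "nat perm \<Rightarrow> (nat \<Rightarrow> 's) \<Rightarrow> complex"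
      using that by (induct S rule: finite_induct) (auto simp: infsum_add intro!: summable_on_add)
    let ?t = "\<lambda>g k i. c g * cnj (c k) * (cinner (app (Tp g) (ket i)) (app (Tp k) (ket i)) * complex_of_real (W n i))"
    have st: "?t g k summable_on Conf n" for g k by (intro summable_on_cmult_right gns_summable)
    have "(\<Sum>g\<in>F. \<Sum>k\<in>F. c g * cnj (c k) * character (inverse k * g)) =
        (\<Sum>g\<in>F. \<Sum>k\<in>F. infsum (?t g k) (Conf n))"
      by (intro sum.cong refl) (simp add: ch infsum_cmult_right')
    also have "\<dots> = (\<Sum>g\<in>F. infsum (\<lambda>i. \<Sum>k\<in>F. ?t g k i) (Conf n))"
      by (intro sum.cong refl) (use sum[OF F st] in simp)
    also have "\<dots> = infsum (\<lambda>i. \<Sum>g\<in>F. \<Sum>k\<in>F. ?t g k i) (Conf n)"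
      using sum[OF F, of "\<lambda>g i. \<Sum>k\<in>F. ?t g k i"] sum[OF F st] by simp
    also have "\<dots> = (\<Sum>\<^sub>\<infinity>i\<in>Conf n. cinner (app x (ket i)) (app x (ket i)) * complex_of_real (W n i))"
      unfolding x_def
      by (intro infsum_cong)
        (simp add: app_sum_op app_scale cinner_sum_left cinner_sum_right cinner_scaleC_left cinner_scaleC_right
          sum_distrib_left sum_distrib_right mult_ac, rule sum.swap)
    also have "\<dots> = gns_form h A x x" by (rule gns_eq[OF x x, symmetric])
    finally have e: "(\<Sum>g\<in>F. \<Sum>k\<in>F. c g * cnj (c k) * character (inverse k * g)) = complex_of_real (N2 x)"
      using N2_has_sum(2)[OF x] by simp
    show "Im (\<Sum>g\<in>F. \<Sum>k\<in>F. c g * cnj (c k) * character (inverse k * g)) = 0 \<and>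
        0 \<le> Re (\<Sum>g\<in>F. \<Sum>k\<in>F. c g * cnj (c k) * character (inverse k * g))"
      unfolding e using N2_nonneg[OF TA_I[OF x]] by simp
  qed
qed

lemma character_indecomposable: "group_character character"
proof (rule multiplicative_group_character[OF character_pd])
  fix g k :: "nat perm" assume "affected g \<inter> affected k = {}"
  then show "character (g * k) = character g * character k"
    unfolding character_def perm_rook_mult by (rule f_mult[OF local_perm local_perm])
qed

text \<open>The positive eigenvalues give \<alpha> and the moduli of the negative ones give \<beta>;
  for \<open>l \<ge> 1\<close> the two power sums recombine index by index to
  \<open>|a| a^(l-1)\<close>. The case \<open>l = 1\<close> supplies the bound on the total
  mass.\<close>

lemma thoma_parameters_exist:
  "\<exists>\<alpha> \<beta>. has_thoma_parameters character \<alpha> \<beta> \<and> (\<forall>l\<ge>1. thoma_cycle_value \<alpha> \<beta> l = cycle_value l)"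
proof -
  let ?p = "\<lambda>s. max (a s) 0" and ?m = "\<lambda>s. max (- a s) 0"
  have sp: "?p summable_on UNIV" "?m summable_on UNIV"
    by (rule summable_on_comparison_test[OF a_summable]; simp)+
  obtain \<alpha> where \<alpha>: "antimono \<alpha>" "\<And>n. 0 \<le> \<alpha> n" "\<And>l. l \<ge> 1 \<Longrightarrow> (\<lambda>n. \<alpha> n ^ l) sums (\<Sum>\<^sub>\<infinity>s. ?p s ^ l)"
    using decreasing_rearrangement[OF _ sp(1)] by auto
  obtain \<beta> where \<beta>: "antimono \<beta>" "\<And>n. 0 \<le> \<beta> n" "\<And>l. l \<ge> 1 \<Longrightarrow> (\<lambda>n. \<beta> n ^ l) sums (\<Sum>\<^sub>\<infinity>s. ?m s ^ l)"
    using decreasing_rearrangement[OF _ sp(2)] by auto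
  have val: "thoma_cycle_value \<alpha> \<beta> l = cycle_value l" if l: "l \<ge> 1" for l
  proof -
    have s: "(\<lambda>s. ?p s ^ l) summable_on UNIV" "(\<lambda>s. ?m s ^ l) summable_on UNIV"
      by (rule summable_power[OF _ sp(1) l], simp) (rule summable_power[OF _ sp(2) l], simp)
    have "thoma_cycle_value \<alpha> \<beta> l = (\<Sum>\<^sub>\<infinity>s. ?p s ^ l) + (-1) ^ (l - 1) * (\<Sum>\<^sub>\<infinity>s. ?m s ^ l)"
      unfolding thoma_cycle_value_def using \<alpha>(3)[OF l] \<beta>(3)[OF l] by (simp add: sums_iff)
    also have "\<dots> = (\<Sum>\<^sub>\<infinity>s. ?p s ^ l + (-1) ^ (l - 1) * ?m s ^ l)"
      using s by (simp add: infsum_add summable_on_cmult_right infsum_cmult_right')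
    also have "\<dots> = cycle_value l"
      unfolding cycle_value_def
    proof (rule infsum_cong)
      fix s
      obtain n where n: "l = Suc n" using l by (cases l) auto
      show "?p s ^ l + (-1) ^ (l - 1) * ?m s ^ l = \<bar>a s\<bar> * a s ^ (l - 1)"
        by (cases "0 \<le> a s") (auto simp: n max_def mult.left_commute simp flip: power_mult_distrib)
    qed
    finally show ?thesis .
  qed
  have "(\<Sum>i. \<alpha> i) + (\<Sum>i. \<beta> i) = (\<Sum>\<^sub>\<infinity>s. \<bar>a s\<bar>)"
    using val[of 1] by (simp add: thoma_cycle_value_def cycle_value_def)
  then have "thoma_parameters \<alpha> \<beta>"
    unfolding thoma_parameters_def
    using \<alpha>(1,2) \<beta>(1,2) \<alpha>(3)[of 1] \<beta>(3)[of 1] a_le by (auto simp: sums_iff)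
  moreover have "(\<Prod>c\<leftarrow>cs. thoma_cycle_value \<alpha> \<beta> (length c)) = (\<Prod>c\<leftarrow>cs. cycle_value (length c))"
    if "\<forall>c\<in>set cs. 2 \<le> length c" for cs :: "nat list list"
    using that by (intro arg_cong[where f = prod_list] map_cong refl val) auto
  ultimately show ?thesis
    unfolding has_thoma_parameters_def using character_cycles val by (intro exI[of _ \<alpha>] exI[of _ \<beta>]) auto
qed

end

subsection \<open>Admissible parameters\<close>

lemma Tr_rank_one:
  fixes b :: "'h::chilbert_space bop"
  assumes h: "ONB (h :: 's \<Rightarrow> 'h)" and b: "\<And>x. app b x = cinner x u *\<^sub>C y"
  shows "Tr b = cinner y u"
proof -
  have "has_trace b (\<Sum>\<^sub>\<infinity>l\<in>{()}. cinner y u)"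
    by (rule has_trace_nuclear[where u = "\<lambda>_. u" and w = "\<lambda>_. y"]) (simp_all add: b has_sum_finiteI)
  then show ?thesis by (intro Tr_eqI[OF _ ONB_range[OF h]]) simp
qed

text \<open>The rank-one projection onto a unit vector in the range of \<open>q\<close> lies below
  \<open>q\<close>, so minimality identifies the two.\<close>

lemma minimal_projection_cases:
  assumes "minimal_projection q" "q \<noteq> 0"
  obtains x where "norm x = 1" "\<And>y. app q y = cinner y x *\<^sub>C x"
proof -
  obtain y where "app q y \<noteq> 0" using assms(2) bop_eqI[of q 0] by auto
  define x where "x = (1 / norm (app q y)) *\<^sub>R app q y"
  have nx: "norm x = 1" using \<open>app q y \<noteq> 0\<close> by (simp add: x_def)
  have P: "projection q" using assms(1) by (simp add: minimal_projection_def)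
  have qx: "app q x = x"
    by (simp add: x_def scaleR_scaleC app_scaleC projection_norm(3)[OF P])
  \<comment> \<open>\<open>matrix_unit\<close> over a one-element index type produces the operator
    sending \<open>z\<close> to \<open>cinner z x\<close> times \<open>x\<close>.\<close>
  define r where "r = matrix_unit (\<lambda>_ :: unit. x) () ()"
  have r: "app r z = cinner z x *\<^sub>C x" for z by (simp add: r_def matrix_unit_app)
  have "projection r"
  proof (rule projectionI)
    show "r * r = r"
      by (rule bop_eqI) (simp add: app_times r cinner_scaleC_left cinner_same nx)
    show "cinner (app r z) u = cinner z (app r u)" for z u
      by (simp add: r cinner_simps mult.commute flip: cinner_commute)
  qed
  moreover have "q * r = r" by (rule bop_eqI) (simp add: app_times r app_scaleC qx)
  moreover have "r \<noteq> 0"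
  proof
    assume "r = 0"
    then have "app r x = 0" by simp
    then show False using nx by (simp add: r cinner_same scaleC_one)
  qed
  ultimately have "q = r" using assms(1) unfolding minimal_projection_def by blast
  then show ?thesis using that nx r by simp
qed

text \<open>Commuting with the rank-one projection onto \<open>h l\<close> forces
  \<open>A (h l)\<close> to be a multiple of \<open>h l\<close>, with a real factor by
  self-adjointness.\<close>

lemma adapted_diagonal:
  assumes "selfadjoint A" "adapted_basis A h"
  shows "diagonal A h (\<lambda>l. Re (cinner (app A (h l)) (h l)))"
proof
  show h: "ONB h" using assms(2) by (simp add: adapted_basis_def ONB_def)
  fix l
  have "app (matrix_unit h l l) (h l) = h l"
    by (simp add: matrix_unit_app ONB_orth[OF h] scaleC_one)
  moreover have "app A (app (matrix_unit h l l) (h l)) = app (matrix_unit h l l) (app A (h l))"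
    using assms(2) unfolding adapted_basis_def by (metis app_times)
  ultimately have "app A (h l) = cinner (app A (h l)) (h l) *\<^sub>C h l"
    by (simp add: matrix_unit_app)
  moreover have "cinner (app A (h l)) (h l) = cnj (cinner (app A (h l)) (h l))"
    using assms(1) unfolding selfadjoint_def by (metis cinner_adj cinner_commute)
  then have "cinner (app A (h l)) (h l) = complex_of_real (Re (cinner (app A (h l)) (h l)))"
    by (simp add: complex_eq_iff)
  ultimately show "app A (h l) = complex_of_real (Re (cinner (app A (h l)) (h l))) *\<^sub>C h l" by simp
qed

context diagonal
begin

lemma abs_summable_trace:
  assumes "trace_class A"
  shows "(\<lambda>l. \<bar>a l\<bar>) summable_on UNIV" "Tr (abs_bop A) = complex_of_real (\<Sum>\<^sub>\<infinity>l. \<bar>a l\<bar>)"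
proof -
  obtain t where t: "has_trace (abs_bop A) t" using assms by (auto simp: trace_class_def)
  then have "((\<lambda>x. cinner (app (abs_bop A) x) x) has_sum t) (range h)"
    using ONB_range[OF h] by (simp add: has_trace_def)
  then have T: "((\<lambda>l. complex_of_real \<bar>a l\<bar>) has_sum t) UNIV"
    using h by (subst (asm) has_sum_reindex)
      (simp_all add: ONB_def o_def abs_bop_app cinner_scaleC_left ONB_orth[OF h])
  show "(\<lambda>l. \<bar>a l\<bar>) summable_on UNIV"
    using has_sum_Re[OF T] by (auto simp: summable_on_def)
  then have "((\<lambda>l. complex_of_real \<bar>a l\<bar>) has_sum complex_of_real (\<Sum>\<^sub>\<infinity>l. \<bar>a l\<bar>)) UNIV"
    by (simp only: has_sum_of_real_iff has_sum_infsum)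
  from has_sum_unique[OF T this] show "Tr (abs_bop A) = complex_of_real (\<Sum>\<^sub>\<infinity>l. \<bar>a l\<bar>)"
    using Tr_eqI[OF t ONB_range[OF h]] by simp
qed

lemma kernel_indices_eq: "kernel_indices h A = {l. a l = 0}"
proof -
  have "range (app (matrix_unit h l l)) \<subseteq> ker A \<longleftrightarrow> a l = 0" for l
  proof
    assume "range (app (matrix_unit h l l)) \<subseteq> ker A"
    then have "app (matrix_unit h l l) (h l) \<in> ker A" by (rule subsetD) (rule rangeI)
    then have "complex_of_real (a l) *\<^sub>C h l = 0"
      by (simp add: ker_def matrix_unit_app ONB_orth[OF h] scaleC_one Ah)
    then have "cinner (complex_of_real (a l) *\<^sub>C h l) (h l) = 0" by simp
    then show "a l = 0" by (simp add: cinner_scaleC_left ONB_orth[OF h])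
  qed (auto simp: ker_def matrix_unit_app app_scaleC Ah scaleC_0_left scaleC_0_right)
  then show ?thesis by (simp add: kernel_indices_def)
qed

text \<open>A kernel vector has coordinates only at indices with eigenvalue 0, so finitely many such
  indices would give a finite spanning set.\<close>

lemma kernel_infinite:
  assumes "\<not> (\<exists>B. finite B \<and> ker A \<subseteq> cspan B)"
  shows "infinite {l. a l = 0}"
proof
  assume fin: "finite {l. a l = 0}"
  have "ker A \<subseteq> cspan (h ` {l. a l = 0})"
  proof
    fix x assume "x \<in> ker A"
    then have z: "cinner x (h l) = 0" if "a l \<noteq> 0" for l
      using diagonal_cinner[OF h Ah, of x l] that by (simp add: ker_def)
    have "((\<lambda>l. cinner x (h l) *\<^sub>C h l) has_sum x) UNIV" by (rule ONB_expansion[OF h])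
    also have "?this \<longleftrightarrow> ((\<lambda>l. cinner x (h l) *\<^sub>C h l) has_sum x) {l. a l = 0}"
      by (rule has_sum_cong_neutral) (auto simp: z scaleC_0_left)
    finally have "x = (\<Sum>l | a l = 0. cinner x (h l) *\<^sub>C h l)"
      using has_sum_finite[OF fin] by (rule has_sum_unique)
    also have "\<dots> \<in> cspan (h ` {l. a l = 0})"
      unfolding cspan_def
      by (intro module.span_sum[OF module_scaleC] module.span_scale[OF module_scaleC]
          module.span_base[OF module_scaleC]) auto
    finally show "x \<in> cspan (h ` {l. a l = 0})" .
  qed
  then show False using assms fin by blast
qed

lemma app_power: "app (A ^ n) (h l) = complex_of_real (a l ^ n) *\<^sub>C h l"
  by (induct n) (simp_all add: app_times Ah app_scaleC scaleC_scaleC scaleC_one mult.commute)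

lemma Tr_abs_power:
  assumes "trace_class A" "\<And>l. \<bar>a l\<bar> \<le> 1"
  shows "Tr (abs_bop A * A ^ n) = complex_of_real (\<Sum>\<^sub>\<infinity>l. \<bar>a l\<bar> * a l ^ n)"
proof -
  let ?b = "abs_bop A * A ^ n"
  have b: "app ?b (h l) = complex_of_real (\<bar>a l\<bar> * a l ^ n) *\<^sub>C h l" for l
    by (simp add: app_times app_power app_scaleC abs_bop_app scaleC_scaleC mult.commute)
  have "has_trace ?b (\<Sum>\<^sub>\<infinity>l. cinner (complex_of_real (\<bar>a l\<bar> * a l ^ n) *\<^sub>C h l) (h l))"
  proof (rule has_trace_nuclear)
    fix x
    have "((\<lambda>l. app ?b (cinner x (h l) *\<^sub>C h l)) has_sum app ?b x) UNIV"
      using has_sum_bounded_linear[OF bounded_linear_app ONB_expansion[OF h, of x], of ?b] by (simp add: o_def)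
    then show "((\<lambda>l. cinner x (h l) *\<^sub>C complex_of_real (\<bar>a l\<bar> * a l ^ n) *\<^sub>C h l) has_sum app ?b x) UNIV"
      unfolding app_scaleC b .
  next
    show "(\<lambda>l. norm (h l) * norm (complex_of_real (\<bar>a l\<bar> * a l ^ n) *\<^sub>C h l)) summable_on UNIV"
    proof (rule summable_on_comparison_test[OF abs_summable_trace(1)[OF assms(1)]])
      fix l
      have "\<bar>a l\<bar> * \<bar>a l\<bar> ^ n \<le> \<bar>a l\<bar> * 1"
        using assms(2) by (intro mult_left_mono power_le_one) auto
      then show "norm (h l) * norm (complex_of_real (\<bar>a l\<bar> * a l ^ n) *\<^sub>C h l) \<le> \<bar>a l\<bar>"
        by (simp add: norm_scaleC ONB_norm_1[OF h] abs_mult power_abs norm_mult norm_power)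
    qed simp
  qed
  then have "Tr ?b = (\<Sum>\<^sub>\<infinity>l. complex_of_real (\<bar>a l\<bar> * a l ^ n))"
    by (intro Tr_eqI[OF _ ONB_range[OF h]]) (simp add: cinner_scaleC_left ONB_orth[OF h])
  then show ?thesis unfolding infsum_of_real .
qed

text \<open>The vector \<open>x\<close> is an eigenvector of both \<open>A\<close> and
  \<open>|A|\<close>, so the operator has rank at most one and its trace can be read off. Keeping
  \<open>cinner x x\<close> covers \<open>q = 0\<close>, where \<open>x = 0\<close>.\<close>

lemma Tr_abs_proj_power:
  assumes x: "\<And>s. cinner x (h s) \<noteq> 0 \<Longrightarrow> a s = lam" and lam: "0 < lam"
    and q: "\<And>y. app q y = cinner y x *\<^sub>C x"
  shows "Tr (abs_bop A * q * A ^ n) = complex_of_real (lam ^ Suc n) * cinner x x"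
proof -
  have Ax: "app A x = complex_of_real lam *\<^sub>C x"
    by (rule ONB_eqI[OF h]) (use x in \<open>auto simp: diagonal_cinner[OF h Ah] cinner_scaleC_left\<close>)
  have absx: "app (abs_bop A) x = complex_of_real lam *\<^sub>C x"
  proof (rule ONB_eqI[OF h])
    fix i show "cinner (app (abs_bop A) x) (h i) = cinner (complex_of_real lam *\<^sub>C x) (h i)"
      using x[of i] lam
      by (cases "cinner x (h i) = 0") (simp_all add: diagonal_cinner[OF h abs_bop_app] cinner_scaleC_left)
  qed
  have pow: "cinner (app (A ^ n) y) x = complex_of_real (lam ^ n) * cinner y x" for y
  proof (induct n)
    case (Suc n)
    have "cinner (app (A ^ Suc n) y) x = cinner (app (A ^ n) y) (app A x)"
      by (simp add: app_times cinner_adj adj_A)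
    then show ?case using Suc by (simp add: Ax cinner_scaleC_right)
  qed simp
  have "app (abs_bop A * q * A ^ n) y = cinner y x *\<^sub>C (complex_of_real (lam ^ Suc n) *\<^sub>C x)" for y
    by (simp add: app_times q app_scaleC absx scaleC_scaleC pow mult_ac)
  then have "Tr (abs_bop A * q * A ^ n) = cinner (complex_of_real (lam ^ Suc n) *\<^sub>C x) x"
    by (rule Tr_rank_one[OF h])
  then show ?thesis by (simp add: cinner_scaleC_left)
qed

end

text \<open>If \<open>q = 0\<close>, any positive \<open>lam\<close> and \<open>x = 0\<close> will do.\<close>

lemma (in diagonal) minimal_projection_eigenvector:
  assumes min: "minimal_projection q" and comm: "A * q = q * A"
    and E: "q * spectral_projection A {-1..0} = 0" and a1: "\<And>l. \<bar>a l\<bar> \<le> 1"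
  shows "\<exists>lam x. 0 < lam \<and> (\<forall>y. app q y = cinner y x *\<^sub>C x) \<and>
    (\<forall>s. cinner x (h s) \<noteq> 0 \<longrightarrow> a s = lam) \<and> (x = 0 \<longleftrightarrow> q = 0) \<and> (x \<noteq> 0 \<longrightarrow> norm x = 1)"
proof (cases "q = 0")
  case True
  then show ?thesis by (intro exI[of _ 1] exI[of _ 0]) (simp add: scaleC_0_left)
next
  case False
  obtain x where x: "norm x = 1" "\<And>y. app q y = cinner y x *\<^sub>C x"
    using minimal_projection_cases[OF min False] by blast
  define mu where "mu = cinner (app A x) x"
  have qx: "app q x = x" by (simp add: x cinner_same scaleC_one)
  have Ax: "app A x = mu *\<^sub>C x"
    using arg_cong[OF comm, of "\<lambda>b. app b x"] by (simp add: app_times qx x(2)[of "app A x"] mu_def)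
  have eig: "complex_of_real (a s) = mu" if "cinner x (h s) \<noteq> 0" for s
  proof -
    have "complex_of_real (a s) * cinner x (h s) = mu * cinner x (h s)"
      using diagonal_cinner[OF h Ah, of x s] unfolding Ax cinner_scaleC_left by (rule sym)
    then show ?thesis by (simp only: mult_right_cancel[OF that])
  qed
  have as: "a s = Re mu" if "cinner x (h s) \<noteq> 0" for s using eig[OF that] by (metis Re_complex_of_real)
  \<comment> \<open>Were the eigenvalue not positive, all coordinates of \<open>x\<close> would
    belong to eigenvalues in \<open>[-1, 0]\<close>, so \<open>E([-1,0])\<close> would fix
    \<open>x\<close>, against condition (e).\<close>
  have "0 < Re mu"
  proof (rule ccontr)
    assume neg: "\<not> 0 < Re mu"
    have "app (spectral_projection A {-1..0}) x = x"
    proof (rule ONB_eqI[OF h])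
      fix s
      have D: "app (spectral_projection A {-1..0}) (h l) = (if a l \<in> {-1..0} then 1 else 0) *\<^sub>C h l" for l
        by (simp add: spectral_projection_app scaleC_one scaleC_0_left)
      have "a s \<in> {-1..0}" if "cinner x (h s) \<noteq> 0" using as[OF that] neg a1[of s] by auto
      then show "cinner (app (spectral_projection A {-1..0}) x) (h s) = cinner x (h s)"
        unfolding diagonal_cinner[OF h D] by auto
    qed
    then have "app (q * spectral_projection A {-1..0}) x = x" by (simp add: app_times qx)
    then show False using E x(1) by auto
  qed
  moreover have "x = 0 \<longleftrightarrow> q = 0" using x(1) False by auto
  ultimately show ?thesis
    using x as by (intro exI[of _ "Re mu"] exI[of _ x]) simp
qed

theorem mainTheorem3:
  fixes A q :: "'h::chilbert_space bop" and h :: "'s::wellorder \<Rightarrow> 'h"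
  assumes params: "admissible_parameters A q"
    and basis: "adapted_basis A h"
  defines "f \<equiv> rook_function h A q"
  shows
    "(\<forall>qs. (\<forall>r\<in>set qs. quasicycle r) \<and> independent qs \<longrightarrow>
        f (prod_list qs) = prod_list (map f qs)) \<and>
     (\<forall>k\<ge>1. \<forall>M\<subseteq>{..<k}. (M = {} \<longrightarrow> k \<ge> 2) \<longrightarrow>
        f (perm_rook (cycle [0..<k]) * eps M) =
          (if M \<noteq> {} then Tr (abs_bop A * q * A ^ (k - 1)) else Tr (abs_bop A * A ^ (k - 1)))) \<and>
     (\<exists>lam>0. q * spectral_projection A {lam} = q \<and>
        (\<exists>\<alpha> \<beta>. group_character (\<lambda>p. f (perm_rook p)) \<and>
           has_thoma_parameters (\<lambda>p. f (perm_rook p)) \<alpha> \<beta> \<and>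
           (\<forall>k\<ge>1. \<forall>M\<subseteq>{..<k}. (M \<noteq> {} \<longrightarrow> q \<noteq> 0) \<and> (M = {} \<longrightarrow> k \<ge> 2) \<longrightarrow>
              f (perm_rook (cycle [0..<k]) * eps M) =
                (if M \<noteq> {} then complex_of_real (lam ^ k)
                 else complex_of_real (thoma_cycle_value \<alpha> \<beta> k)))))"
proof -
  define a where "a = (\<lambda>l. Re (cinner (app A (h l)) (h l)))"
  have par: "minimal_projection q" "A * q = q * A" "trace_class A" "Re (Tr (abs_bop A)) \<le> 1"
    "q * spectral_projection A {-1..0} = 0"
    and ker_inf: "Re (Tr (abs_bop A)) < 1 \<Longrightarrow> \<not> (\<exists>B. finite B \<and> ker A \<subseteq> cspan B)"
    using params by (simp_all add: admissible_parameters_def)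
  interpret dg: diagonal A h a
    unfolding a_def by (rule adapted_diagonal[OF _ basis]) (use params in \<open>simp add: admissible_parameters_def\<close>)
  note onb = dg.h
  define tau where "tau = (\<Sum>\<^sub>\<infinity>l. \<bar>a l\<bar>)"
  have sm: "(\<lambda>l. \<bar>a l\<bar>) summable_on UNIV" and Tr_abs: "Tr (abs_bop A) = complex_of_real tau"
    using dg.abs_summable_trace[OF par(3)] by (simp_all add: tau_def)
  have tau: "tau \<le> 1" using par(4) by (simp add: Tr_abs)
  \<comment> \<open>Eigenvalues are bounded by the trace norm. Hence intervals starting at -1
    capture the whole negative spectrum.\<close>
  have a1: "\<bar>a l\<bar> \<le> 1" for l
    using finite_sum_le_infsum[OF sm, of "{l}"] tau by (simp add: tau_def)
  obtain lam x where lam: "0 < lam" and "\<forall>y. app q y = cinner y x *\<^sub>C x"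
    and "\<forall>s. cinner x (h s) \<noteq> 0 \<longrightarrow> a s = lam"
    and x0: "x = 0 \<longleftrightarrow> q = 0" and "x \<noteq> 0 \<longrightarrow> norm x = 1"
    using dg.minimal_projection_eigenvector[OF par(1,2,5) a1] by (elim exE conjE) (rule that)
  then have qx: "\<And>y. app q y = cinner y x *\<^sub>C x"
    and eig: "\<And>s. cinner x (h s) \<noteq> 0 \<Longrightarrow> a s = lam" and x1: "x \<noteq> 0 \<Longrightarrow> norm x = 1"
    by simp_all
  define v where "v s = cinner x (h s)" for s
  have V0: "{s. v s \<noteq> 0} = {} \<longleftrightarrow> x = 0"
    using ONB_eqI[OF onb, of x 0] by (auto simp: v_def)
  have finV: "finite {s. v s \<noteq> 0}"
  proof (rule finite_subset)
    show "{s. v s \<noteq> 0} \<subseteq> {s. lam \<le> \<bar>a s\<bar>}" using eig lam by (auto simp: v_def)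
    show "finite {s. lam \<le> \<bar>a s\<bar>}" using summable_finite_ge[OF sm _ lam] by simp
  qed
  have unit: "v s * (\<Sum>t | v t \<noteq> 0. cnj (v t) * v t) = v s" for s
  proof (cases "x = 0")
    case False
    have "((\<lambda>t. cnj (v t) * v t) has_sum cinner x x) UNIV"
      using ONB_parseval[OF onb, of x x] by (simp add: v_def mult.commute)
    also have "?this \<longleftrightarrow> ((\<lambda>t. cnj (v t) * v t) has_sum cinner x x) {t. v t \<noteq> 0}"
      by (rule has_sum_cong_neutral) auto
    finally have "(\<Sum>t | v t \<noteq> 0. cnj (v t) * v t) = cinner x x"
      using has_sum_finite[OF finV] has_sum_unique by blast
    then show ?thesis using x1[OF False] by (simp add: cinner_same)
  qed (simp add: v_def)
  define nk where "nk l = enumerate (kernel_indices h A) l" for l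
  \<comment> \<open>The diagonal of the state at site \<open>l\<close>: the eigenvalue moduli, plus
    the missing mass on the kernel vector reserved for that site.\<close>
  define w where "w l s = \<bar>a s\<bar> + (1 - tau) * (if s = nk l then 1 else 0)" for l s
  \<comment> \<open>When \<open>tau = 1\<close> the value of \<open>enumerate\<close> is
    meaningless, but its coefficient \<open>1 - tau\<close> vanishes. Otherwise condition (d) makes
    the enumeration injective.\<close>
  have inf_ker: "infinite (kernel_indices h A)" if "tau \<noteq> 1"
    unfolding dg.kernel_indices_eq using dg.kernel_infinite ker_inf tau that by (simp add: Tr_abs)
  have nk0: "a (nk l) = 0" if "tau \<noteq> 1" for l
    using enumerate_in_set[OF inf_ker[OF that], of l] unfolding nk_def dg.kernel_indices_eq by simp
  have nk_inj: "nk l \<noteq> nk k" if "tau \<noteq> 1" "l \<noteq> k" for l k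
    using enumerate_mono[OF _ inf_ker[OF that(1)], of l k] enumerate_mono[OF _ inf_ker[OF that(1)], of k l] that(2)
    by (cases "l < k") (auto simp: nk_def)
  have psi: "psi h A l (matrix_unit h s t) = (if s = t then complex_of_real (w l s) else 0)" for l s t
  proof -
    have "Tr (matrix_unit h s t * abs_bop A) = cinner (h s) (complex_of_real \<bar>a t\<bar> *\<^sub>C h t)"
      by (rule Tr_rank_one[OF onb])
        (simp add: app_times matrix_unit_app diagonal_cinner[OF onb dg.abs_bop_app] cinner_scaleC_right)
    moreover have "Tr (matrix_unit h s t * matrix_unit h n n) = cinner (h s) (cinner (h t) (h n) *\<^sub>C h n)" for n
      by (rule Tr_rank_one[OF onb])
        (simp add: app_times matrix_unit_app app_scaleC scaleC_scaleC cinner_simps mult.commute ONB_orth[OF onb])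
    ultimately show ?thesis
      by (simp add: psi_def Let_def Tr_abs w_def nk_def cinner_scaleC_right ONB_orth[OF onb])
  qed
  have w_sum: "(w l has_sum 1) UNIV" for l
  proof -
    have "((\<lambda>s. if s = nk l then 1 else 0 :: real) has_sum 1) UNIV \<longleftrightarrow> ((\<lambda>s. 1 :: real) has_sum 1) {nk l}"
      by (rule has_sum_cong_neutral) auto
    then have "((\<lambda>s. if s = nk l then 1 else 0 :: real) has_sum 1) UNIV" by (simp add: has_sum_finiteI)
    then have "((\<lambda>s. \<bar>a s\<bar> + (1 - tau) * (if s = nk l then 1 else 0)) has_sum (tau + (1 - tau) * 1)) UNIV"
      unfolding tau_def by (intro has_sum_add has_sum_cmult_right has_sum_infsum sm)
    then show ?thesis by (simp add: w_def[abs_def])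
  qed
  interpret tw: twisted "\<lambda>s. a s < 0" v
    by unfold_locales (use finV eig lam unit in \<open>auto simp: v_def\<close>)
  have hom: "rook_hom h A q = tw.Th"
  proof (rule tw.rook_hom_eq[OF onb])
    show "app (spectral_projection A {-1..<0}) (h s) = (if a s < 0 then h s else 0)" for s
    proof -
      \<comment> \<open>The spectral projection defining the sign operator thus selects exactly the
        odd basis vectors.\<close>
      have "a s \<in> {-1..<0} \<longleftrightarrow> a s < 0" using a1[of s] by auto
      then show ?thesis by (simp only: dg.spectral_projection_app atLeastLessThan_borel)
    qed
    show "cinner (app q (h t)) (h s) = v s * cnj (v t)" for s t
      by (simp add: qx v_def cinner_scaleC_left mult.commute flip: cinner_commute)
  qed
  interpret th: thoma_state a v h A w q lam
  proof unfold_locales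
    show "psi h A l (matrix_unit h s t) = (if s = t then complex_of_real (w l s) else 0)" for l s t by (rule psi)
    show "0 \<le> w l s" for l s using tau by (simp add: w_def)
    show "(w l has_sum 1) UNIV" for l by (rule w_sum)
    show "rook_hom h A q = tw.Th" by (rule hom)
    show "a s = lam" if "v s \<noteq> 0" for s using eig that by (simp add: v_def)
    show "w l s = \<bar>a s\<bar>" if "a s \<noteq> 0" for l s
      using nk0[of l] that by (cases "tau = 1") (auto simp: w_def)
    show "w l s * w k s = 0" if "a s = 0" "l \<noteq> k" for l k s
      using nk_inj[OF _ that(2)] that(1) by (cases "tau = 1") (auto simp: w_def)
  qed (use lam sm tau in \<open>simp_all add: tau_def\<close>)
  have char: "(\<lambda>p. f (perm_rook p)) = th.character"
    by (simp add: f_def th.character_def[abs_def])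
  have quasi: "f (perm_rook (cycle [0..<k]) * eps M) = (if q = 0 then 0 else complex_of_real (lam ^ k))"
    if "M \<subseteq> {..<k}" "M \<noteq> {}" for k M
    unfolding f_def th.f_cycle_eps[OF that] V0 x0 ..
  have cyc: "f (perm_rook (cycle [0..<k]) * eps {}) = complex_of_real (th.cycle_value k)" if "k \<ge> 2" for k
    using th.f_cycle[of "[0..<k]"] that by (simp add: f_def)
  have "\<forall>qs. (\<forall>r\<in>set qs. quasicycle r) \<and> independent qs \<longrightarrow> f (prod_list qs) = prod_list (map f qs)"
    unfolding f_def using th.f_independent by blast
  moreover have "\<forall>k\<ge>1. \<forall>M\<subseteq>{..<k}. (M = {} \<longrightarrow> k \<ge> 2) \<longrightarrow>
        f (perm_rook (cycle [0..<k]) * eps M) =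
          (if M \<noteq> {} then Tr (abs_bop A * q * A ^ (k - 1)) else Tr (abs_bop A * A ^ (k - 1)))"
  proof (intro allI impI)
    fix k :: nat and M assume k: "1 \<le> k" and M: "M \<subseteq> {..<k}" "M = {} \<longrightarrow> 2 \<le> k"
    show "f (perm_rook (cycle [0..<k]) * eps M) =
          (if M \<noteq> {} then Tr (abs_bop A * q * A ^ (k - 1)) else Tr (abs_bop A * A ^ (k - 1)))"
    proof (cases "M = {}")
      case True
      then show ?thesis using cyc[of k] M(2) dg.Tr_abs_power[OF par(3) a1] by (simp add: th.cycle_value_def)
    next
      case False
      have "Suc (k - 1) = k" using k by simp
      then have "Tr (abs_bop A * q * A ^ (k - 1)) = complex_of_real (lam ^ k) * cinner x x"
        using dg.Tr_abs_proj_power[OF eig lam qx, of "k - 1"] by (simp del: power_Suc)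
      also have "\<dots> = (if q = 0 then 0 else complex_of_real (lam ^ k))"
        using x0 x1 by (auto simp: cinner_same)
      finally show ?thesis using False quasi[OF M(1)] by simp
    qed
  qed
  moreover have "\<exists>lam>0. q * spectral_projection A {lam} = q \<and>
        (\<exists>\<alpha> \<beta>. group_character (\<lambda>p. f (perm_rook p)) \<and>
           has_thoma_parameters (\<lambda>p. f (perm_rook p)) \<alpha> \<beta> \<and>
           (\<forall>k\<ge>1. \<forall>M\<subseteq>{..<k}. (M \<noteq> {} \<longrightarrow> q \<noteq> 0) \<and> (M = {} \<longrightarrow> k \<ge> 2) \<longrightarrow>
              f (perm_rook (cycle [0..<k]) * eps M) =
                (if M \<noteq> {} then complex_of_real (lam ^ k)
                 else complex_of_real (thoma_cycle_value \<alpha> \<beta> k))))"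
  proof (intro exI[of _ lam] conjI lam)
    have "cinner (h s) x = 0" if "a s \<noteq> lam" for s
      using eig[of s] that by (metis cinner_commute complex_cnj_zero)
    then show "q * spectral_projection A {lam} = q"
      by (intro ONB_bop_eqI[OF onb]) (simp add: app_times dg.spectral_projection_app qx scaleC_0_left)
    obtain \<alpha> \<beta> where "has_thoma_parameters th.character \<alpha> \<beta>" "\<And>l. l \<ge> 1 \<Longrightarrow> thoma_cycle_value \<alpha> \<beta> l = th.cycle_value l"
      using th.thoma_parameters_exist by blast
    then show "\<exists>\<alpha> \<beta>. group_character (\<lambda>p. f (perm_rook p)) \<and>
           has_thoma_parameters (\<lambda>p. f (perm_rook p)) \<alpha> \<beta> \<and>
           (\<forall>k\<ge>1. \<forall>M\<subseteq>{..<k}. (M \<noteq> {} \<longrightarrow> q \<noteq> 0) \<and> (M = {} \<longrightarrow> k \<ge> 2) \<longrightarrow>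
              f (perm_rook (cycle [0..<k]) * eps M) =
                (if M \<noteq> {} then complex_of_real (lam ^ k)
                 else complex_of_real (thoma_cycle_value \<alpha> \<beta> k)))"
      unfolding char using th.character_indecomposable quasi cyc
      by (intro exI[of _ \<alpha>] exI[of _ \<beta>]) auto
  qed
  ultimately show ?thesis by blast
qed

end
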